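(* Let $C>0$ and $a_1,a_2,a_3\in\mathbb R$. On $\mathbb R^7\times I$, where $\mathbb R^7$ (coordinates $x_1,\dots,x_7$) is the seven dimensional quaternionic Heisenberg group and $I$ is any open interval of values of $u$ on which $(u+a_1)(u+a_2)(a_3-u)>0$, the metric $$\begin{aligned} g=\;&C\,(u+a_1)(u+a_2)(a_3-u)\,(dx_1^2+dx_2^2+dx_3^2+dx_4^2)\\ &+\frac2C\frac1{(u+a_1)^2}(dx_5+2x_1dx_2+2x_3dx_4)^2+\frac2C\frac1{(u+a_2)^2}(dx_6+2x_1dx_3+2x_4dx_2)^2\\ &+\frac2C\frac1{(a_3-u)^2}(dx_7+2x_1dx_4+2x_2dx_3)^2+\frac{C^3}8(u+a_1)^2(u+a_2)^2(a_3-u)^2du^2 \end{aligned}$$ has holonomy contained in $Spin(7)$. Moreover, for any triple $a_1,a_2,a_3$ of real numbers one can find an open interval $J\subset\mathbb R$ such that for $u\in J$ the holonomy of this metric equals $Spin(7)$.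
   Context: The seven dimensional quaternionic Heisenberg group is the simply connected Lie group with left-invariant forms $e^a=dx_a$ ($1\le a\le4$), $\eta_1=dx_5+2x_1dx_2+2x_3dx_4$, $\eta_2=dx_6+2x_1dx_3+2x_4dx_2$, $\eta_3=dx_7+2x_1dx_4+2x_2dx_3$, satisfying $de^a=0$, $d\eta_1=2(e^{12}+e^{34})$, $d\eta_2=2(e^{13}+e^{42})$, $d\eta_3=2(e^{14}+e^{23})$. The interval $J$ is understood to lie in the set of $u$ where the expression is a Riemannian metric. *)

theory Defs
  imports "HOL-Analysis.Analysis"
begin

section \<open>Riemannian metrics on open subsets of a Euclidean space\<close>

text \<open>
  Every tangent space of an open set \<open>U\<close> in \<open>'a\<close> is identified with \<open>'a\<close>; a metric is
  \<open>g p v w\<close>, the inner product of the tangent vectors \<open>v\<close>, \<open>w\<close> at the point \<open>p\<close>.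
\<close>

text \<open>Only meant for open \<open>U\<close>, where \<open>frechet_derivative\<close> is the derivative.\<close>

primrec Ck_on :: "nat \<Rightarrow> 'a::euclidean_space set \<Rightarrow> ('a \<Rightarrow> real) \<Rightarrow> bool" where
  "Ck_on 0 U f \<longleftrightarrow> continuous_on U f"
| "Ck_on (Suc k) U f \<longleftrightarrow>
     (\<forall>p\<in>U. f differentiable (at p)) \<and>
     (\<forall>v. Ck_on k U (\<lambda>p. frechet_derivative f (at p) v))"

definition smooth_on :: "'a::euclidean_space set \<Rightarrow> ('a \<Rightarrow> real) \<Rightarrow> bool" where
  "smooth_on U f \<longleftrightarrow> (\<forall>k. Ck_on k U f)"

definition riemannian_metric_on ::
  "'a::euclidean_space set \<Rightarrow> ('a \<Rightarrow> 'a \<Rightarrow> 'a \<Rightarrow> real) \<Rightarrow> bool" where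
  "riemannian_metric_on U g \<longleftrightarrow>
     open U \<and>
     (\<forall>p\<in>U. bilinear (g p) \<and> (\<forall>v w. g p v w = g p w v) \<and> (\<forall>v. v \<noteq> 0 \<longrightarrow> g p v v > 0)) \<and>
     (\<forall>v w. smooth_on U (\<lambda>p. g p v w))"

text \<open>
  The Levi-Civita connection at \<open>p\<close>, given by its Christoffel map \<open>G v w\<close>, the covariant
  derivative in direction \<open>v\<close> of the constant vector field \<open>w\<close>. Constant vector fields commute,
  so vanishing torsion is the symmetry of \<open>G\<close>; the last clause is metric compatibility.
\<close>

definition levi_civita ::
  "('a::euclidean_space \<Rightarrow> 'a \<Rightarrow> 'a \<Rightarrow> real) \<Rightarrow> 'a \<Rightarrow> 'a \<Rightarrow> 'a \<Rightarrow> 'a" where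
  "levi_civita g p = (THE G. bilinear G \<and>
     (\<forall>v w. G v w = G w v) \<and>
     (\<forall>v w y. frechet_derivative (\<lambda>q. g q w y) (at p) v = g p (G v w) y + g p w (G v y)))"


section \<open>Parallel transport and holonomy\<close>

text \<open>
  Stronger than \<open>valid_path\<close>: the velocity extends continuously to both ends of each piece.
\<close>

definition piecewise_C1_path :: "(real \<Rightarrow> 'a::euclidean_space) \<Rightarrow> bool" where
  "piecewise_C1_path \<gamma> \<longleftrightarrow>
     (\<exists>(n::nat) t. t 0 = (0::real) \<and> t n = 1 \<and>
        (\<forall>i<n. t i < t (Suc i) \<and>
          (\<exists>c. continuous_on {t i..t (Suc i)} c \<and>
            (\<forall>s\<in>{t i..t (Suc i)}.
               (\<gamma> has_vector_derivative c s) (at s within {t i..t (Suc i)})))))"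

definition parallel_along ::
  "('a::euclidean_space \<Rightarrow> 'a \<Rightarrow> 'a \<Rightarrow> real) \<Rightarrow> (real \<Rightarrow> 'a) \<Rightarrow> (real \<Rightarrow> 'a) \<Rightarrow> bool" where
  "parallel_along g \<gamma> V \<longleftrightarrow>
     continuous_on {0..1} V \<and>
     (\<exists>S. finite S \<and> (\<forall>t\<in>{0..1} - S. \<exists>c.
        (\<gamma> has_vector_derivative c) (at t) \<and>
        (V has_vector_derivative - levi_civita g (\<gamma> t) c (V t)) (at t)))"

definition parallel_transport ::
  "('a::euclidean_space \<Rightarrow> 'a \<Rightarrow> 'a \<Rightarrow> real) \<Rightarrow> (real \<Rightarrow> 'a) \<Rightarrow> ('a \<Rightarrow> 'a) \<Rightarrow> bool" where
  "parallel_transport g \<gamma> P \<longleftrightarrow>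
     (\<forall>v. \<exists>V. parallel_along g \<gamma> V \<and> V 0 = v \<and> V 1 = P v)"

definition holonomy_group ::
  "'a::euclidean_space set \<Rightarrow> ('a \<Rightarrow> 'a \<Rightarrow> 'a \<Rightarrow> real) \<Rightarrow> 'a \<Rightarrow> ('a \<Rightarrow> 'a) set" where
  "holonomy_group U g p =
     {P. \<exists>\<gamma>. piecewise_C1_path \<gamma> \<and> path_image \<gamma> \<subseteq> U \<and> pathstart \<gamma> = p \<and> pathfinish \<gamma> = p \<and>
          parallel_transport g \<gamma> P}"

definition orthonormal_frame ::
  "('a::euclidean_space \<Rightarrow> 'a \<Rightarrow> 'a \<Rightarrow> real) \<Rightarrow> 'a \<Rightarrow> ('b::euclidean_space \<Rightarrow> 'a) \<Rightarrow> bool" where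
  "orthonormal_frame g p L \<longleftrightarrow>
     linear L \<and> bij L \<and> (\<forall>v w. g p (L v) (L w) = v \<bullet> w)"

text \<open>
  A holonomy group is a subgroup of the orthogonal group only up to the choice of an orthonormal
  frame, so it is compared with a subgroup \<open>H\<close> of the model space up to that choice.
\<close>

definition holonomy_contained_in ::
  "'a::euclidean_space set \<Rightarrow> ('a \<Rightarrow> 'a \<Rightarrow> 'a \<Rightarrow> real) \<Rightarrow>
    ('b::euclidean_space \<Rightarrow> 'b) set \<Rightarrow> bool" where
  "holonomy_contained_in U g H \<longleftrightarrow>
     (\<forall>p\<in>U. \<exists>L. orthonormal_frame g p L \<and>
        (\<lambda>P. inv L \<circ> P \<circ> L) ` holonomy_group U g p \<subseteq> H)"

definition holonomy_equals ::
  "'a::euclidean_space set \<Rightarrow> ('a \<Rightarrow> 'a \<Rightarrow> 'a \<Rightarrow> real) \<Rightarrow>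
    ('b::euclidean_space \<Rightarrow> 'b) set \<Rightarrow> bool" where
  "holonomy_equals U g H \<longleftrightarrow>
     (\<forall>p\<in>U. \<exists>L. orthonormal_frame g p L \<and>
        (\<lambda>P. inv L \<circ> P \<circ> L) ` holonomy_group U g p = H)"


section \<open>The group Spin(7)\<close>

definition dx4 :: "8 \<Rightarrow> 8 \<Rightarrow> 8 \<Rightarrow> 8 \<Rightarrow> real^8 \<Rightarrow> real^8 \<Rightarrow> real^8 \<Rightarrow> real^8 \<Rightarrow> real" where
  "dx4 i j k l v w x y =
     det (vector [vector [v $ i, v $ j, v $ k, v $ l],
                  vector [w $ i, w $ j, w $ k, w $ l],
                  vector [x $ i, x $ j, x $ k, x $ l],
                  vector [y $ i, y $ j, y $ k, y $ l]] :: real^4^4)"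

text \<open>
  The fundamental (Cayley) 4-form, with the sign conventions of Joyce's book on special holonomy.
  The index \<open>8 :: 8\<close> is \<open>0\<close>.
\<close>

definition cayley_form :: "real^8 \<Rightarrow> real^8 \<Rightarrow> real^8 \<Rightarrow> real^8 \<Rightarrow> real" where
  "cayley_form v w x y =
     dx4 1 2 3 4 v w x y + dx4 1 2 5 6 v w x y + dx4 1 2 7 8 v w x y + dx4 1 3 5 7 v w x y
     - dx4 1 3 6 8 v w x y - dx4 1 4 5 8 v w x y - dx4 1 4 6 7 v w x y - dx4 2 3 5 8 v w x y
     - dx4 2 3 6 7 v w x y - dx4 2 4 5 7 v w x y + dx4 2 4 6 8 v w x y + dx4 3 4 5 6 v w x y
     + dx4 3 4 7 8 v w x y + dx4 5 6 7 8 v w x y"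

text \<open>The stabiliser of the 4-form in \<open>GL(8, \<real>)\<close>; it lies in \<open>SO(8)\<close> automatically.\<close>

definition Spin7 :: "(real^8 \<Rightarrow> real^8) set" where
  "Spin7 = {A. linear A \<and> bij A \<and>
     (\<forall>v w x y. cayley_form (A v) (A w) (A x) (A y) = cayley_form v w x y)}"


section \<open>The metric on the quaternionic Heisenberg group times an interval\<close>

text \<open>
  The left-invariant forms \<open>\<eta>\<^sub>1, \<eta>\<^sub>2, \<eta>\<^sub>3\<close> at the point \<open>x\<close>, applied to the tangent vector \<open>v\<close>;
  \<open>e\<^sup>a = dx\<^sub>a\<close> is the coordinate \<open>v $ a\<close>.
\<close>

definition eta1 :: "real^7 \<Rightarrow> real^7 \<Rightarrow> real" where
  "eta1 x v = v $ 5 + 2 * x $ 1 * v $ 2 + 2 * x $ 3 * v $ 4"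

definition eta2 :: "real^7 \<Rightarrow> real^7 \<Rightarrow> real" where
  "eta2 x v = v $ 6 + 2 * x $ 1 * v $ 3 + 2 * x $ 4 * v $ 2"

definition eta3 :: "real^7 \<Rightarrow> real^7 \<Rightarrow> real" where
  "eta3 x v = v $ 7 + 2 * x $ 1 * v $ 4 + 2 * x $ 2 * v $ 3"

fun heis_metric :: "real \<Rightarrow> real \<Rightarrow> real \<Rightarrow> real \<Rightarrow>
    (real^7) \<times> real \<Rightarrow> (real^7) \<times> real \<Rightarrow> (real^7) \<times> real \<Rightarrow> real" where
  "heis_metric C a1 a2 a3 (x, u) (v, s) (w, t) =
     C * (u + a1) * (u + a2) * (a3 - u)
       * (v $ 1 * w $ 1 + v $ 2 * w $ 2 + v $ 3 * w $ 3 + v $ 4 * w $ 4)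
     + 2 / C * (1 / (u + a1)^2) * (eta1 x v * eta1 x w)
     + 2 / C * (1 / (u + a2)^2) * (eta2 x v * eta2 x w)
     + 2 / C * (1 / (a3 - u)^2) * (eta3 x v * eta3 x w)
     + C^3 / 8 * (u + a1)^2 * (u + a2)^2 * (a3 - u)^2 * (s * t)"

end

theory Submission
  imports Defs "HOL-Real_Asymp.Real_Asymp"
begin

text \<open>
  Put \<open>\<theta>\<^sub>1 = \<beta> P du\<close>, \<open>\<theta>\<^sub>2 = \<rho> \<eta>\<^sub>1 / (u + a\<^sub>1)\<close>, \<open>\<theta>\<^sub>3 = \<rho> \<eta>\<^sub>2 / (u + a\<^sub>2)\<close>, \<open>\<theta>\<^sub>4 = \<rho> \<eta>\<^sub>3 / (a\<^sub>3 - u)\<close> and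
  \<open>\<theta>\<^sub>5, \<dots>, \<theta>\<^sub>8 = \<mu> dx\<^sub>1, \<dots>, \<mu> dx\<^sub>4\<close>. In this orthonormal coframe the connection form takes values in
  \<open>spin(7)\<close>, so parallel transport preserves the inner product and the Cayley form; hence the containment.

  For equality, let \<open>u\<close> run over a neighbourhood of \<open>-\<infinity>\<close>. Transport in the coframe is trivial along \<open>\<partial>\<^sub>u\<close>, and
  along a left-invariant field \<open>X\<^sub>m\<close> at level \<open>u\<close> it is \<open>exp (- t A\<^sub>m(u))\<close>, an explicit product of plane
  rotations. The velocities at the identity of curves of holonomies form a linear subspace \<open>T\<close>, closed
  under bracket with every \<open>A\<^sub>m(u)\<close>. The loops \<open>X\<^sub>m\<close> at level \<open>u\<close>, then \<open>- X\<^sub>m\<close> at level \<open>u'\<close>, give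
  \<open>A\<^sub>m(u') - A\<^sub>m(u) \<in> T\<close>; as \<open>A\<^sub>m(u') \<rightarrow> 0\<close> for \<open>u' \<rightarrow> -\<infinity>\<close>, every \<open>A\<^sub>m(u)\<close> lies in \<open>T\<close>, and so do the limits of their
  rescalings, which no longer depend on the \<open>a\<^sub>i\<close>. These seven matrices and their brackets span \<open>spin(7)\<close>.

  An open mapping argument then gives a neighbourhood of the identity in \<open>Spin(7)\<close>, hence all plane
  rotations in \<open>Spin(7)\<close>; a singular value decomposition by such rotations reduces an arbitrary
  stabiliser of the Cayley form to a positive diagonal matrix, which must be the identity.
\<close>

section \<open>The Cayley form and its infinitesimal stabiliser\<close>

text \<open>The holonomy group is given only as a set of transport maps; it is not known to be
  closed or a Lie group. So every holonomy is built from an explicit loop, and tangent vectors at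
  the identity come from curves that are continuous but differentiable at one parameter only. This
  weak regularity is why the local step uses an open mapping theorem for maps differentiable at a
  single point instead of the inverse function theorem. Exponentials stay elementary because each
  connection matrix rotates four disjoint coordinate planes. The unbounded interval does two jobs.
  Transport along a left-invariant field dies out at minus infinity, which isolates a single
  connection matrix from a difference of two. Moreover \<open>u + a1\<close>, \<open>u + a2\<close>
  and \<open>- (a3 - u)\<close> are all asymptotic to \<open>u\<close>, so one computation with
  constant coefficients settles every triple. The coefficients of the metric enter through
  \<open>2 * rho * beta = C\<close>: it makes the fibre terms and the \<open>du\<close> terms of the
  structure equations share the same factor, which places the connection in
  \<open>spin(7)\<close>.\<close>

lemma exhaust_8: fixes x :: 8
  shows "x = 1 \<or> x = 2 \<or> x = 3 \<or> x = 4 \<or> x = 5 \<or> x = 6 \<or> x = 7 \<or> x = 8"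
proof (induct x)
  case (of_int z)
  then have "0 \<le> z" and "z < 8" by simp_all
  then have "z = 0 | z = 1 | z = 2 | z = 3 | z = 4 | z = 5 | z = 6 | z = 7" by arith
  then show ?case by auto
qed

lemma exhaust_7: fixes x :: 7
  shows "x = 1 \<or> x = 2 \<or> x = 3 \<or> x = 4 \<or> x = 5 \<or> x = 6 \<or> x = 7"
proof (induct x)
  case (of_int z)
  then have "0 \<le> z" and "z < 7" by simp_all
  then have "z = 0 | z = 1 | z = 2 | z = 3 | z = 4 | z = 5 | z = 6" by arith
  then show ?case by auto
qed

lemma forall_8: "(\<forall>i::8. P i) \<longleftrightarrow> P 1 \<and> P 2 \<and> P 3 \<and> P 4 \<and> P 5 \<and> P 6 \<and> P 7 \<and> P 8"
  by (metis exhaust_8)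

lemma forall_7: "(\<forall>i::7. P i) \<longleftrightarrow> P 1 \<and> P 2 \<and> P 3 \<and> P 4 \<and> P 5 \<and> P 6 \<and> P 7"
  by (metis exhaust_7)

lemma UNIV_8: "UNIV = {1::8, 2, 3, 4, 5, 6, 7, 8}"
  using exhaust_8 by auto

lemma sum_8: "sum f (UNIV::8 set) = f 1 + f 2 + f 3 + f 4 + f 5 + f 6 + f 7 + f 8"
  unfolding UNIV_8 by (simp add: ac_simps)

lemma vector_8 [simp]:
  "(vector [a,b,c,d,e,f,g,h] ::('a::zero)^8) $ 1 = a"
  "(vector [a,b,c,d,e,f,g,h] ::('a::zero)^8) $ 2 = b"
  "(vector [a,b,c,d,e,f,g,h] ::('a::zero)^8) $ 3 = c"
  "(vector [a,b,c,d,e,f,g,h] ::('a::zero)^8) $ 4 = d"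
  "(vector [a,b,c,d,e,f,g,h] ::('a::zero)^8) $ 5 = e"
  "(vector [a,b,c,d,e,f,g,h] ::('a::zero)^8) $ 6 = f"
  "(vector [a,b,c,d,e,f,g,h] ::('a::zero)^8) $ 7 = g"
  "(vector [a,b,c,d,e,f,g,h] ::('a::zero)^8) $ 8 = h"
  unfolding vector_def by simp_all


lemma vector_4 [simp]:
  "(vector [a,b,c,d] ::('a::zero)^4) $ 1 = a"
  "(vector [a,b,c,d] ::('a::zero)^4) $ 2 = b"
  "(vector [a,b,c,d] ::('a::zero)^4) $ 3 = c"
  "(vector [a,b,c,d] ::('a::zero)^4) $ 4 = d"
  unfolding vector_def by simp_all

lemma det_4:
  "det (A::'a::comm_ring_1^4^4) =
    A$1$1 * (A$2$2 * (A$3$3 * A$4$4 - A$3$4 * A$4$3) - A$2$3 * (A$3$2 * A$4$4 - A$3$4 * A$4$2) + A$2$4 * (A$3$2 * A$4$3 - A$3$3 * A$4$2))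
  - A$1$2 * (A$2$1 * (A$3$3 * A$4$4 - A$3$4 * A$4$3) - A$2$3 * (A$3$1 * A$4$4 - A$3$4 * A$4$1) + A$2$4 * (A$3$1 * A$4$3 - A$3$3 * A$4$1))
  + A$1$3 * (A$2$1 * (A$3$2 * A$4$4 - A$3$4 * A$4$2) - A$2$2 * (A$3$1 * A$4$4 - A$3$4 * A$4$1) + A$2$4 * (A$3$1 * A$4$2 - A$3$2 * A$4$1))
  - A$1$4 * (A$2$1 * (A$3$2 * A$4$3 - A$3$3 * A$4$2) - A$2$2 * (A$3$1 * A$4$3 - A$3$3 * A$4$1) + A$2$3 * (A$3$1 * A$4$2 - A$3$2 * A$4$1))"
proof -
  have f1234: "finite {2::4, 3, 4}" "1 \<notin> {2::4, 3, 4}" by auto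
  have f234: "finite {3::4, 4}" "2 \<notin> {3::4, 4}" by auto
  have f34: "finite {4::4}" "3 \<notin> {4::4}" by auto
  show ?thesis
    unfolding det_def UNIV_4
    unfolding sum_over_permutations_insert[OF f1234]
    unfolding sum_over_permutations_insert[OF f234]
    unfolding sum_over_permutations_insert[OF f34]
    unfolding permutes_sing
    by (simp add: sign_swap_id permutation_swap_id sign_compose sign_id swap_id_eq permutation_compose algebra_simps)
qed

text \<open>
  \<open>sg m i\<close> is the bitwise exclusive or of \<open>m - 1\<close> and \<open>i - 1\<close>, plus 1. For \<open>m \<noteq> 1\<close> its cycles split the eight
  coordinates into four planes, and \<open>so(8)\<close> is the direct sum of the seven resulting spaces of
  rotation generators \<open>gen m c\<close>. In each of them \<open>spin(7)\<close> is cut out by one equation, \<open>nu m \<bullet> c = 0\<close>.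
\<close>

definition sg :: "8 \<Rightarrow> 8 \<Rightarrow> 8" where
  "sg m i = (vector [
     vector [1, 2, 3, 4, 5, 6, 7, 8],
     vector [2, 1, 4, 3, 6, 5, 8, 7],
     vector [3, 4, 1, 2, 7, 8, 5, 6],
     vector [4, 3, 2, 1, 8, 7, 6, 5],
     vector [5, 6, 7, 8, 1, 2, 3, 4],
     vector [6, 5, 8, 7, 2, 1, 4, 3],
     vector [7, 8, 5, 6, 3, 4, 1, 2],
     vector [8, 7, 6, 5, 4, 3, 2, 1]] :: 8^8^8) $ m $ i"

lemma sg_simps [simp]:
  "sg 1 1 = 1" "sg 1 2 = 2" "sg 1 3 = 3" "sg 1 4 = 4" "sg 1 5 = 5" "sg 1 6 = 6" "sg 1 7 = 7" "sg 1 8 = 8"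
  "sg 2 1 = 2" "sg 2 2 = 1" "sg 2 3 = 4" "sg 2 4 = 3" "sg 2 5 = 6" "sg 2 6 = 5" "sg 2 7 = 8" "sg 2 8 = 7"
  "sg 3 1 = 3" "sg 3 2 = 4" "sg 3 3 = 1" "sg 3 4 = 2" "sg 3 5 = 7" "sg 3 6 = 8" "sg 3 7 = 5" "sg 3 8 = 6"
  "sg 4 1 = 4" "sg 4 2 = 3" "sg 4 3 = 2" "sg 4 4 = 1" "sg 4 5 = 8" "sg 4 6 = 7" "sg 4 7 = 6" "sg 4 8 = 5"
  "sg 5 1 = 5" "sg 5 2 = 6" "sg 5 3 = 7" "sg 5 4 = 8" "sg 5 5 = 1" "sg 5 6 = 2" "sg 5 7 = 3" "sg 5 8 = 4"
  "sg 6 1 = 6" "sg 6 2 = 5" "sg 6 3 = 8" "sg 6 4 = 7" "sg 6 5 = 2" "sg 6 6 = 1" "sg 6 7 = 4" "sg 6 8 = 3"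
  "sg 7 1 = 7" "sg 7 2 = 8" "sg 7 3 = 5" "sg 7 4 = 6" "sg 7 5 = 3" "sg 7 6 = 4" "sg 7 7 = 1" "sg 7 8 = 2"
  "sg 8 1 = 8" "sg 8 2 = 7" "sg 8 3 = 6" "sg 8 4 = 5" "sg 8 5 = 4" "sg 8 6 = 3" "sg 8 7 = 2" "sg 8 8 = 1"
  by (simp_all add: sg_def)

text \<open>Read as the 2-form with coefficients \<open>nu m $ i\<close> on
  \<open>dx_i \<and> dx_(sg m i)\<close>; for \<open>m = 2\<close> it is e12 + e34 + e56 + e78. Half
  the square of each consists of six signed terms of the Cayley form. The seven of them span the
  7-dimensional Spin(7)-summand of the 2-forms, and \<open>spin(7)\<close> is its orthogonal
  complement.\<close>

definition nu :: "8 \<Rightarrow> real^8" where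
  "nu m = (vector [0,
     vector [1, 0, 1, 0, 1, 0, 1, 0], vector [1, -1, 0, 0, 1, -1, 0, 0],
     vector [1, 1, 0, 0, -1, -1, 0, 0], vector [1, -1, -1, 1, 0, 0, 0, 0],
     vector [1, 1, 1, 1, 0, 0, 0, 0], vector [1, -1, 1, -1, 0, 0, 0, 0],
     vector [1, 1, -1, -1, 0, 0, 0, 0]] :: real^8^8) $ m"

text \<open>Since \<open>sg m\<close> is an involution, the middle clause is skew-symmetry of
  \<open>gen m c\<close>.\<close>

definition adm :: "8 \<Rightarrow> real^8 \<Rightarrow> bool" where
  "adm m c \<longleftrightarrow> m \<noteq> 1 \<and> (\<forall>i. c $ sg m i = - c $ i) \<and> nu m \<bullet> c = 0"

definition gen :: "8 \<Rightarrow> real^8 \<Rightarrow> real^8^8" where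
  "gen m c = (\<chi> i j. if j = sg m i then c $ i else 0)"

lemma gen_mult [simp]: "(gen m c *v v) $ i = c $ i * v $ sg m i"
  by (simp add: gen_def matrix_vector_mult_def if_distrib [where f = "\<lambda>x. x * _"] cong: if_cong)

lemma dx4_expand:
  "dx4 i j k l v w x y =
    v$i * (w$j * (x$k * y$l - x$l * y$k) - w$k * (x$j * y$l - x$l * y$j) + w$l * (x$j * y$k - x$k * y$j))
  - v$j * (w$i * (x$k * y$l - x$l * y$k) - w$k * (x$i * y$l - x$l * y$i) + w$l * (x$i * y$k - x$k * y$i))
  + v$k * (w$i * (x$j * y$l - x$l * y$j) - w$j * (x$i * y$l - x$l * y$i) + w$l * (x$i * y$j - x$j * y$i))
  - v$l * (w$i * (x$j * y$k - x$k * y$j) - w$j * (x$i * y$k - x$k * y$i) + w$k * (x$i * y$j - x$j * y$i))"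
  unfolding dx4_def det_4 by simp

definition cayley_action :: "real^8^8 \<Rightarrow> real^8 \<Rightarrow> real^8 \<Rightarrow> real^8 \<Rightarrow> real^8 \<Rightarrow> real" where
  "cayley_action X v w x y = cayley_form (X *v v) w x y + cayley_form v (X *v w) x y
     + cayley_form v w (X *v x) y + cayley_form v w x (X *v y)"

text \<open>The transpose of \<open>gen m c\<close> sends the covector \<open>dx_i\<close> to
  \<open>c $ i\<close> times \<open>dx_(sg m i)\<close>, so acting on the four arguments is the same
  as acting on the four indices. Invariance of the form thereby becomes bookkeeping with
  indices.\<close>

lemma dx4_gen:
  "dx4 i j k l (gen m c *v v) w x y + dx4 i j k l v (gen m c *v w) x y
     + dx4 i j k l v w (gen m c *v x) y + dx4 i j k l v w x (gen m c *v y)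
   = c $ i * dx4 (sg m i) j k l v w x y + c $ j * dx4 i (sg m j) k l v w x y
     + c $ k * dx4 i j (sg m k) l v w x y + c $ l * dx4 i j k (sg m l) v w x y"
  unfolding dx4_expand gen_mult by algebra

lemma dx4_same [simp]:
  "dx4 i i k l v w x y = 0" "dx4 i j i l v w x y = 0" "dx4 i j k i v w x y = 0"
  "dx4 i j j l v w x y = 0" "dx4 i j k j v w x y = 0" "dx4 i j k k v w x y = 0"
  unfolding dx4_expand by algebra+

lemma dx4_swap:
  "dx4 j i k l v w x y = - dx4 i j k l v w x y" 
  "dx4 i k j l v w x y = - dx4 i j k l v w x y" 
  "dx4 i j l k v w x y = - dx4 i j k l v w x y" 
  unfolding dx4_expand by algebra+

lemma cayley_action_gen:
  "cayley_action (gen m c) v w x y =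
    (let D = (\<lambda>i j k l. c $ i * dx4 (sg m i) j k l v w x y + c $ j * dx4 i (sg m j) k l v w x y
     + c $ k * dx4 i j (sg m k) l v w x y + c $ l * dx4 i j k (sg m l) v w x y) in
     D 1 2 3 4 + D 1 2 5 6 + D 1 2 7 8 + D 1 3 5 7 - D 1 3 6 8 - D 1 4 5 8 - D 1 4 6 7 - D 2 3 5 8
     - D 2 3 6 7 - D 2 4 5 7 + D 2 4 6 8 + D 3 4 5 6 + D 3 4 7 8 + D 5 6 7 8)"
  unfolding Let_def dx4_gen [symmetric] cayley_action_def cayley_form_def by simp

lemma inner_8: "(v::real^8) \<bullet> w = v$1*w$1 + v$2*w$2 + v$3*w$3 + v$4*w$4 + v$5*w$5 + v$6*w$6 + v$7*w$7 + v$8*w$8"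
  by (simp add: inner_vec_def sum_8)

lemma nu_simps [simp]: "nu 2 = vector [1, 0, 1, 0, 1, 0, 1, 0]" "nu 3 = vector [1, -1, 0, 0, 1, -1, 0, 0]"
   "nu 4 = vector [1, 1, 0, 0, -1, -1, 0, 0]" "nu 5 = vector [1, -1, -1, 1, 0, 0, 0, 0]"
   "nu 6 = vector [1, 1, 1, 1, 0, 0, 0, 0]" "nu 7 = vector [1, -1, 1, -1, 0, 0, 0, 0]"
   "nu 8 = vector [1, 1, -1, -1, 0, 0, 0, 0]"
  by (simp_all add: nu_def)

text \<open>The equations are oriented as rewrite rules that leave three free coefficients in each
  case.\<close>

lemma adm_cases:
  assumes "adm m c"
  obtains "m = 2" "c$2 = - c$1" "c$4 = - c$3" "c$6 = - c$5" "c$8 = - c$7" "c$1 = - c$3 - c$5 - c$7"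
  | "m = 3" "c$3 = - c$1" "c$4 = - c$2" "c$7 = - c$5" "c$8 = - c$6" "c$1 = c$2 - c$5 + c$6"
  | "m = 4" "c$4 = - c$1" "c$3 = - c$2" "c$8 = - c$5" "c$7 = - c$6" "c$1 = - c$2 + c$5 + c$6"
  | "m = 5" "c$5 = - c$1" "c$6 = - c$2" "c$7 = - c$3" "c$8 = - c$4" "c$1 = c$2 + c$3 - c$4"
  | "m = 6" "c$6 = - c$1" "c$5 = - c$2" "c$8 = - c$3" "c$7 = - c$4" "c$1 = - c$2 - c$3 - c$4"
  | "m = 7" "c$7 = - c$1" "c$8 = - c$2" "c$5 = - c$3" "c$6 = - c$4" "c$1 = c$2 - c$3 + c$4"
  | "m = 8" "c$8 = - c$1" "c$7 = - c$2" "c$6 = - c$3" "c$5 = - c$4" "c$1 = - c$2 + c$3 + c$4"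
proof -
  have *: "m \<noteq> 1" "\<forall>i. c $ sg m i = - c $ i" "nu m \<bullet> c = 0"
    using assms by (simp_all add: adm_def)
  consider "m = 2" | "m = 3" | "m = 4" | "m = 5" | "m = 6" | "m = 7" | "m = 8"
    using *(1) exhaust_8 [of m] by blast
  then show ?thesis
  proof cases
    case 1
    have "c $ sg m 1 = - c $ 1" "c $ sg m 3 = - c $ 3" "c $ sg m 5 = - c $ 5" "c $ sg m 7 = - c $ 7"
      using *(2) by blast+
    then have e: "c$2 = - c$1" "c$4 = - c$3" "c$6 = - c$5" "c$8 = - c$7"
      by (simp_all only: 1 sg_simps)
    have "c$1 - (- c$3 - c$5 - c$7) = nu m \<bullet> c"
      unfolding 1 nu_simps inner_8 vector_8 by simp
    with *(3) have "c$1 = - c$3 - c$5 - c$7" by simp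
    with 1 e show ?thesis by (rule that(1))
  next
    case 2
    have "c $ sg m 1 = - c $ 1" "c $ sg m 2 = - c $ 2" "c $ sg m 5 = - c $ 5" "c $ sg m 6 = - c $ 6"
      using *(2) by blast+
    then have e: "c$3 = - c$1" "c$4 = - c$2" "c$7 = - c$5" "c$8 = - c$6"
      by (simp_all only: 2 sg_simps)
    have "c$1 - (c$2 - c$5 + c$6) = nu m \<bullet> c"
      unfolding 2 nu_simps inner_8 vector_8 by simp
    with *(3) have "c$1 = c$2 - c$5 + c$6" by simp
    with 2 e show ?thesis by (rule that(2))
  next
    case 3
    have "c $ sg m 1 = - c $ 1" "c $ sg m 2 = - c $ 2" "c $ sg m 5 = - c $ 5" "c $ sg m 6 = - c $ 6"
      using *(2) by blast+
    then have e: "c$4 = - c$1" "c$3 = - c$2" "c$8 = - c$5" "c$7 = - c$6"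
      by (simp_all only: 3 sg_simps)
    have "c$1 - (- c$2 + c$5 + c$6) = nu m \<bullet> c"
      unfolding 3 nu_simps inner_8 vector_8 by simp
    with *(3) have "c$1 = - c$2 + c$5 + c$6" by simp
    with 3 e show ?thesis by (rule that(3))
  next
    case 4
    have "c $ sg m 1 = - c $ 1" "c $ sg m 2 = - c $ 2" "c $ sg m 3 = - c $ 3" "c $ sg m 4 = - c $ 4"
      using *(2) by blast+
    then have e: "c$5 = - c$1" "c$6 = - c$2" "c$7 = - c$3" "c$8 = - c$4"
      by (simp_all only: 4 sg_simps)
    have "c$1 - (c$2 + c$3 - c$4) = nu m \<bullet> c"
      unfolding 4 nu_simps inner_8 vector_8 by simp
    with *(3) have "c$1 = c$2 + c$3 - c$4" by simp
    with 4 e show ?thesis by (rule that(4))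
  next
    case 5
    have "c $ sg m 1 = - c $ 1" "c $ sg m 2 = - c $ 2" "c $ sg m 3 = - c $ 3" "c $ sg m 4 = - c $ 4"
      using *(2) by blast+
    then have e: "c$6 = - c$1" "c$5 = - c$2" "c$8 = - c$3" "c$7 = - c$4"
      by (simp_all only: 5 sg_simps)
    have "c$1 - (- c$2 - c$3 - c$4) = nu m \<bullet> c"
      unfolding 5 nu_simps inner_8 vector_8 by simp
    with *(3) have "c$1 = - c$2 - c$3 - c$4" by simp
    with 5 e show ?thesis by (rule that(5))
  next
    case 6
    have "c $ sg m 1 = - c $ 1" "c $ sg m 2 = - c $ 2" "c $ sg m 3 = - c $ 3" "c $ sg m 4 = - c $ 4"
      using *(2) by blast+
    then have e: "c$7 = - c$1" "c$8 = - c$2" "c$5 = - c$3" "c$6 = - c$4"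
      by (simp_all only: 6 sg_simps)
    have "c$1 - (c$2 - c$3 + c$4) = nu m \<bullet> c"
      unfolding 6 nu_simps inner_8 vector_8 by simp
    with *(3) have "c$1 = c$2 - c$3 + c$4" by simp
    with 6 e show ?thesis by (rule that(6))
  next
    case 7
    have "c $ sg m 1 = - c $ 1" "c $ sg m 2 = - c $ 2" "c $ sg m 3 = - c $ 3" "c $ sg m 4 = - c $ 4"
      using *(2) by blast+
    then have e: "c$8 = - c$1" "c$7 = - c$2" "c$6 = - c$3" "c$5 = - c$4"
      by (simp_all only: 7 sg_simps)
    have "c$1 - (- c$2 + c$3 + c$4) = nu m \<bullet> c"
      unfolding 7 nu_simps inner_8 vector_8 by simp
    with *(3) have "c$1 = - c$2 + c$3 + c$4" by simp
    with 7 e show ?thesis by (rule that(7))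
  qed
qed

text \<open>The order of the type \<open>8\<close> is unsuitable for sorting indices, since \<open>8 = 0\<close> there.\<close>

definition rk :: "8 \<Rightarrow> nat" where
  "rk i = (vector [1, 2, 3, 4, 5, 6, 7, 8] :: nat^8) $ i"

lemma rk_simps [simp]: "rk 1 = 1" "rk 2 = 2" "rk 3 = 3" "rk 4 = 4" "rk 5 = 5" "rk 6 = 6" "rk 7 = 7" "rk 8 = 8"
  by (simp_all add: rk_def)

text \<open>Guarded by the rank, antisymmetry becomes a terminating rewrite system that brings
  indices into increasing order, so that equal terms are recognised and cancel.\<close>

lemma dx4_sort:
  "rk i < rk j \<Longrightarrow> dx4 j i k l v w x y = - dx4 i j k l v w x y"
  "rk j < rk k \<Longrightarrow> dx4 i k j l v w x y = - dx4 i j k l v w x y"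
  "rk k < rk l \<Longrightarrow> dx4 i j l k v w x y = - dx4 i j k l v w x y"
  by (rule dx4_swap)+

lemma cayley_action_gen_adm:
  assumes "adm m c"
  shows "cayley_action (gen m c) v w x y = 0"
  using assms
proof (cases rule: adm_cases)
  case 1
  show ?thesis by (simp add: 1 cayley_action_gen Let_def dx4_sort algebra_simps)
next
  case 2
  show ?thesis by (simp add: 2 cayley_action_gen Let_def dx4_sort algebra_simps)
next
  case 3
  show ?thesis by (simp add: 3 cayley_action_gen Let_def dx4_sort algebra_simps)
next
  case 4
  show ?thesis by (simp add: 4 cayley_action_gen Let_def dx4_sort algebra_simps)
next
  case 5
  show ?thesis by (simp add: 5 cayley_action_gen Let_def dx4_sort algebra_simps)
next
  case 6
  show ?thesis by (simp add: 6 cayley_action_gen Let_def dx4_sort algebra_simps)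
next
  case 7
  show ?thesis by (simp add: 7 cayley_action_gen Let_def dx4_sort algebra_simps)
qed

section \<open>Derivatives and multilinearity of the Cayley form\<close>

lemma dx4_has_derivative:
  assumes "(a has_derivative a') (at z within S)" "(b has_derivative b') (at z within S)"
    "(c has_derivative c') (at z within S)" "(d has_derivative d') (at z within S)"
  shows "((\<lambda>z. dx4 i j k l (a z) (b z) (c z) (d z)) has_derivative
    (\<lambda>h. dx4 i j k l (a' h) (b z) (c z) (d z) + dx4 i j k l (a z) (b' h) (c z) (d z)
       + dx4 i j k l (a z) (b z) (c' h) (d z) + dx4 i j k l (a z) (b z) (c z) (d' h))) (at z within S)"
proof -
  have nth: "((\<lambda>z. f z $ n) has_derivative (\<lambda>h. f' h $ n)) (at z within S)"
    if "(f has_derivative f') (at z within S)" for f :: "'a \<Rightarrow> real^8" and f' n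
    using bounded_linear.has_derivative [OF bounded_linear_vec_nth that] .
  note abcd = assms [THEN nth]
  show ?thesis
    unfolding dx4_expand
    by (rule has_derivative_eq_rhs, (rule derivative_intros abcd)+, rule ext, algebra)
qed

lemma cayley_form_has_derivative:
  assumes "(a has_derivative a') (at z within S)" "(b has_derivative b') (at z within S)"
    "(c has_derivative c') (at z within S)" "(d has_derivative d') (at z within S)"
  shows "((\<lambda>z. cayley_form (a z) (b z) (c z) (d z)) has_derivative
    (\<lambda>h. cayley_form (a' h) (b z) (c z) (d z) + cayley_form (a z) (b' h) (c z) (d z)
       + cayley_form (a z) (b z) (c' h) (d z) + cayley_form (a z) (b z) (c z) (d' h))) (at z within S)"
  unfolding cayley_form_def
  by (rule derivative_eq_intros dx4_has_derivative [OF assms] | (rule ext, simp; fail))+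

lemma dx4_linear:
  "dx4 i j k l (v + v') w x y = dx4 i j k l v w x y + dx4 i j k l v' w x y"
  "dx4 i j k l v (w + w') x y = dx4 i j k l v w x y + dx4 i j k l v w' x y"
  "dx4 i j k l v w (x + x') y = dx4 i j k l v w x y + dx4 i j k l v w x' y"
  "dx4 i j k l v w x (y + y') = dx4 i j k l v w x y + dx4 i j k l v w x y'"
  "dx4 i j k l (r *\<^sub>R v) w x y = r * dx4 i j k l v w x y"
  "dx4 i j k l v (r *\<^sub>R w) x y = r * dx4 i j k l v w x y"
  "dx4 i j k l v w (r *\<^sub>R x) y = r * dx4 i j k l v w x y"
  "dx4 i j k l v w x (r *\<^sub>R y) = r * dx4 i j k l v w x y"
  by (simp_all add: dx4_expand algebra_simps)

lemma cayley_form_linear: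
  "linear (\<lambda>v. cayley_form v w x y)" "linear (\<lambda>v. cayley_form w v x y)"
  "linear (\<lambda>v. cayley_form w x v y)" "linear (\<lambda>v. cayley_form w x y v)"
  by (rule linearI; simp add: cayley_form_def dx4_linear algebra_simps)+

section \<open>One-parameter groups of plane rotations\<close>

lemma sg_sg [simp]: "sg m (sg m i) = i"
proof -
  have "\<forall>m i. sg m (sg m i) = i" by (simp add: forall_8)
  then show ?thesis by blast
qed

lemma sg_neq [simp]: "m \<noteq> 1 \<Longrightarrow> sg m i \<noteq> i"
proof -
  have "\<forall>m. m \<noteq> 1 \<longrightarrow> (\<forall>i. sg m i \<noteq> i)" by (simp add: forall_8)
  then show "m \<noteq> 1 \<Longrightarrow> sg m i \<noteq> i" by blast
qed

text \<open>For \<open>m \<noteq> 1\<close> and \<open>c\<close> odd under \<open>sg m\<close>, this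
  is the exponential of \<open>t\<close> times \<open>gen m c\<close>: the plane of \<open>i\<close>
  and \<open>sg m i\<close> turns by the angle \<open>c $ i * t\<close>. The closed form replaces
  the matrix exponential.\<close>

definition rot :: "8 \<Rightarrow> real^8 \<Rightarrow> real \<Rightarrow> real^8^8" where
  "rot m c t = (\<chi> i j. if j = i then cos (c $ i * t) else if j = sg m i then sin (c $ i * t) else 0)"

lemma rot_mult:
  assumes "m \<noteq> 1"
  shows "(rot m c t *v v) $ i = cos (c $ i * t) * v $ i + sin (c $ i * t) * v $ sg m i"
proof -
  have "(rot m c t *v v) $ i = (\<Sum>j\<in>UNIV. (if j = i then cos (c $ i * t) * v $ j else 0)
      + (if j = sg m i then sin (c $ i * t) * v $ j else 0))"
    unfolding rot_def matrix_vector_mult_def using assms by (auto intro!: sum.cong)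
  then show ?thesis by (simp add: sum.distrib)
qed

lemma has_vector_derivative_vec:
  fixes f :: "real \<Rightarrow> real^'n"
  assumes "\<And>i. ((\<lambda>x. f x $ i) has_real_derivative f' $ i) (at x within S)"
  shows "(f has_vector_derivative f') (at x within S)"
  unfolding has_vector_derivative_def
proof (subst has_derivative_componentwise_within, rule ballI)
  fix b :: "real^'n" assume "b \<in> Basis"
  then obtain i where b: "b = axis i 1" unfolding Basis_vec_def by auto
  show "((\<lambda>x. f x \<bullet> b) has_derivative (\<lambda>x. x *\<^sub>R f' \<bullet> b)) (at x within S)"
    using assms [of i] unfolding b inner_axis has_field_derivative_def
    by (simp add: mult_commute_abs)
qed

lemma rot_has_vector_derivative:
  assumes "adm m c"
  shows "((\<lambda>t. rot m c t *v v) has_vector_derivative gen m c *v (rot m c t *v v)) (at t within S)"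
proof (rule has_vector_derivative_vec)
  fix i
  have m: "m \<noteq> 1" "c $ sg m i = - c $ i" using assms by (auto simp: adm_def)
  show "((\<lambda>t. (rot m c t *v v) $ i) has_real_derivative (gen m c *v (rot m c t *v v)) $ i) (at t within S)"
    unfolding gen_mult rot_mult [OF m(1)] sg_sg m(2)
    by (auto intro!: derivative_eq_intros simp: algebra_simps)
qed

lemma rot_0 [simp]: "m \<noteq> 1 \<Longrightarrow> rot m c 0 = mat 1"
  by (simp add: matrix_eq vec_eq_iff rot_mult)

definition preserves_cayley :: "real^8^8 \<Rightarrow> bool" where
  "preserves_cayley A \<longleftrightarrow>
     (\<forall>v w x y. cayley_form (A *v v) (A *v w) (A *v x) (A *v y) = cayley_form v w x y)"

text \<open>The derivative at any \<open>t\<close> is the infinitesimal action evaluated at the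
  rotated arguments, hence zero, and \<open>rot m c 0\<close> is the identity.\<close>

lemma preserves_cayley_rot:
  assumes "adm m c"
  shows "preserves_cayley (rot m c t)"
  unfolding preserves_cayley_def
proof (intro allI)
  fix v w x y
  let ?f = "\<lambda>t. cayley_form (rot m c t *v v) (rot m c t *v w) (rot m c t *v x) (rot m c t *v y)"
  have "DERIV ?f t :> 0" for t
  proof -
    have d: "((\<lambda>t. rot m c t *v v) has_derivative (\<lambda>h. h *\<^sub>R (gen m c *v (rot m c t *v v)))) (at t)" for v
      using rot_has_vector_derivative [OF assms] by (simp add: has_vector_derivative_def)
    have "cayley_action (gen m c) (rot m c t *v v) (rot m c t *v w) (rot m c t *v x) (rot m c t *v y) = 0"
      by (rule cayley_action_gen_adm [OF assms])
    then show ?thesis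
      unfolding has_field_derivative_def cayley_action_def
      by (intro has_derivative_eq_rhs [OF cayley_form_has_derivative [OF d d d d]] ext)
        (simp add: cayley_form_linear [THEN linear_scale] flip: distrib_left)
  qed
  then have "?f t = ?f 0" by (intro DERIV_isconst_all) auto
  then show "?f t = cayley_form v w x y"
    using assms by (simp add: adm_def)
qed

section \<open>The kernel of the infinitesimal action\<close>

text \<open>For each pair \<open>i\<close>, \<open>j\<close> exactly one \<open>m\<close> satisfies
  \<open>sg m i = j\<close>, so the 64 entries split into eight disjoint blocks.\<close>

lemma mat_eq_sum_gen: "X = (\<Sum>m\<in>UNIV. gen m (\<chi> i. X $ i $ sg m i))"
proof -
  have "\<forall>i j. X $ i $ j = (\<Sum>m\<in>UNIV. gen m (\<chi> i. X $ i $ sg m i) $ i $ j)"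
    by (simp add: forall_8 sum_8 gen_def)
  then show ?thesis unfolding vec_eq_iff sum_component by blast
qed

text \<open>Expansion along the first row: a 3 by 3 minor of increasing basis vectors with
  increasing indices is 0 or 1. The slot \<open>v\<close> stays free to receive a column of an
  unknown matrix.\<close>

lemma dx4_axis:
  assumes "rk a < rk b" "rk b < rk c" "rk c < rk d" "rk j < rk k" "rk k < rk l"
  shows "dx4 a b c d v (axis j 1) (axis k 1) (axis l 1) =
     (if b = j \<and> c = k \<and> d = l then v $ a else 0) - (if a = j \<and> c = k \<and> d = l then v $ b else 0)
   + (if a = j \<and> b = k \<and> d = l then v $ c else 0) - (if a = j \<and> b = k \<and> c = l then v $ d else 0)"
proof -
  have minor: "axis j 1 $ p * (axis k 1 $ q * axis l 1 $ r - axis k 1 $ r * axis l 1 $ q)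
      - axis j 1 $ q * (axis k 1 $ p * axis l 1 $ r - axis k 1 $ r * axis l 1 $ p)
      + axis j 1 $ r * (axis k 1 $ p * axis l 1 $ q - axis k 1 $ q * axis l 1 $ p)
      = (if p = j \<and> q = k \<and> r = l then 1 else (0::real))" if "rk p < rk q" "rk q < rk r" for p q r
    using that assms(4,5) by (auto simp: axis_def)
  show ?thesis
    unfolding dx4_expand using assms(1-3)
    by (subst minor, simp, simp)+ auto
qed

lemma cayley_form_swap:
  "cayley_form w v x y = - cayley_form v w x y"
  "cayley_form v x w y = - cayley_form v w x y"
  "cayley_form v w y x = - cayley_form v w x y"
proof -
  have "dx4 i j k l w v x y = - dx4 i j k l v w x y" "dx4 i j k l v x w y = - dx4 i j k l v w x y"
    "dx4 i j k l v w y x = - dx4 i j k l v w x y" for i j k l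
    unfolding dx4_expand by algebra+
  then show "cayley_form w v x y = - cayley_form v w x y"
    "cayley_form v x w y = - cayley_form v w x y" "cayley_form v w y x = - cayley_form v w x y"
    unfolding cayley_form_def by simp_all
qed

lemma cayley_form_cycle:
  "cayley_form v w x y = cayley_form x v w y"
  "cayley_form v w x y = - cayley_form y v w x"
  by (metis cayley_form_swap minus_minus)+

text \<open>
  The 70 equations for the coordinate axes fall into one block of 14 for the diagonal entries and, for
  each \<open>m \<noteq> 1\<close>, a block of 8 for the entries \<open>X $ i $ sg m i\<close>.
\<close>

lemma cayley_action_kernel:
  assumes "\<And>v w x y. cayley_action X v w x y = 0"
  shows "X \<in> span {gen m c | m c. adm m c}"
proof -
  let ?c = "\<lambda>m j k l. cayley_form (column m X) (axis j 1) (axis k 1) (axis l 1)"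
  \<comment> \<open>Antisymmetry moves the altered argument of each of the four terms into the first
    slot, the one that \<open>dx4_axis\<close> leaves free.\<close>
  have h: "?c i j k l - ?c j i k l + ?c k i j l - ?c l i j k = 0" for i j k l
  proof -
    have "cayley_form (axis i 1) (column j X) (axis k 1) (axis l 1) = - ?c j i k l"
      by (rule cayley_form_swap)
    moreover have "cayley_form (axis i 1) (axis j 1) (column k X) (axis l 1) = ?c k i j l"
      by (rule cayley_form_cycle)
    moreover have "cayley_form (axis i 1) (axis j 1) (axis k 1) (column l X) = - ?c l i j k"
      by (rule cayley_form_cycle)
    ultimately show ?thesis
      using assms [of "axis i 1" "axis j 1" "axis k 1" "axis l 1"]
      by (simp add: cayley_action_def matrix_vector_mult_basis)
  qed
  note [simp] = cayley_form_def dx4_axis column_def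
  note h2 = h[of 1 3 5 8, simplified] h[of 1 3 6 7, simplified] h[of 1 4 5 7, simplified] h[of 1 4 6 8, simplified] h[of 2 3 5 7, simplified] h[of 2 3 6 8, simplified] h[of 2 4 5 8, simplified] h[of 2 4 6 7, simplified]
  have k2: "X$2$1 = - X$1$2" "X$4$3 = - X$3$4" "X$6$5 = - X$5$6" "X$8$7 = - X$7$8" "X$1$2 + X$3$4 + X$5$6 + X$7$8 = 0"
    using h2 by simp_all
  note h3 = h[of 1 2 5 8, simplified] h[of 1 2 6 7, simplified] h[of 1 4 5 6, simplified] h[of 1 4 7 8, simplified] h[of 2 3 5 6, simplified] h[of 2 3 7 8, simplified] h[of 3 4 5 8, simplified] h[of 3 4 6 7, simplified]
  have k3: "X$3$1 = - X$1$3" "X$4$2 = - X$2$4" "X$7$5 = - X$5$7" "X$8$6 = - X$6$8" "X$1$3 - X$2$4 + X$5$7 - X$6$8 = 0"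
    using h3 by simp_all
  note h4 = h[of 1 2 5 7, simplified] h[of 1 2 6 8, simplified] h[of 1 3 5 6, simplified] h[of 1 3 7 8, simplified] h[of 2 4 5 6, simplified] h[of 2 4 7 8, simplified] h[of 3 4 5 7, simplified] h[of 3 4 6 8, simplified]
  have k4: "X$4$1 = - X$1$4" "X$3$2 = - X$2$3" "X$8$5 = - X$5$8" "X$7$6 = - X$6$7" "X$1$4 + X$2$3 - X$5$8 - X$6$7 = 0"
    using h4 by simp_all
  note h5 = h[of 1 2 3 8, simplified] h[of 1 2 4 7, simplified] h[of 1 3 4 6, simplified] h[of 1 6 7 8, simplified] h[of 2 3 4 5, simplified] h[of 2 5 7 8, simplified] h[of 3 5 6 8, simplified] h[of 4 5 6 7, simplified]
  have k5: "X$5$1 = - X$1$5" "X$6$2 = - X$2$6" "X$7$3 = - X$3$7" "X$8$4 = - X$4$8" "X$1$5 - X$2$6 - X$3$7 + X$4$8 = 0"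
    using h5 by simp_all
  note h6 = h[of 1 2 3 7, simplified] h[of 1 2 4 8, simplified] h[of 1 3 4 5, simplified] h[of 1 5 7 8, simplified] h[of 2 3 4 6, simplified] h[of 2 6 7 8, simplified] h[of 3 5 6 7, simplified] h[of 4 5 6 8, simplified]
  have k6: "X$6$1 = - X$1$6" "X$5$2 = - X$2$5" "X$8$3 = - X$3$8" "X$7$4 = - X$4$7" "X$1$6 + X$2$5 + X$3$8 + X$4$7 = 0"
    using h6 by simp_all
  note h7 = h[of 1 2 3 6, simplified] h[of 1 2 4 5, simplified] h[of 1 3 4 8, simplified] h[of 1 5 6 8, simplified] h[of 2 3 4 7, simplified] h[of 2 5 6 7, simplified] h[of 3 6 7 8, simplified] h[of 4 5 7 8, simplified]
  have k7: "X$7$1 = - X$1$7" "X$8$2 = - X$2$8" "X$5$3 = - X$3$5" "X$6$4 = - X$4$6" "X$1$7 - X$2$8 + X$3$5 - X$4$6 = 0"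
    using h7 by simp_all
  note h8 = h[of 1 2 3 5, simplified] h[of 1 2 4 6, simplified] h[of 1 3 4 7, simplified] h[of 1 5 6 7, simplified] h[of 2 3 4 8, simplified] h[of 2 5 6 8, simplified] h[of 3 5 7 8, simplified] h[of 4 6 7 8, simplified]
  have k8: "X$8$1 = - X$1$8" "X$7$2 = - X$2$7" "X$6$3 = - X$3$6" "X$5$4 = - X$4$5" "X$1$8 + X$2$7 - X$3$6 - X$4$5 = 0"
    using h8 by simp_all
  note h1 = h[of 1 2 3 4, simplified] h[of 1 2 5 6, simplified] h[of 1 2 7 8, simplified] h[of 1 3 5 7, simplified] h[of 1 3 6 8, simplified] h[of 1 4 5 8, simplified] h[of 1 4 6 7, simplified] h[of 2 3 5 8, simplified] h[of 2 3 6 7, simplified] h[of 2 4 5 7, simplified] h[of 2 4 6 8, simplified] h[of 3 4 5 6, simplified] h[of 3 4 7 8, simplified] h[of 5 6 7 8, simplified]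
  have k1: "X$1$1 = 0" "X$2$2 = 0" "X$3$3 = 0" "X$4$4 = 0" "X$5$5 = 0" "X$6$6 = 0" "X$7$7 = 0" "X$8$8 = 0"
    using h1 by simp_all

  have "adm m (\<chi> i. X $ i $ sg m i)" if "m \<noteq> 1" for m
  proof -
    have "\<forall>m. m \<noteq> 1 \<longrightarrow> adm m (\<chi> i. X $ i $ sg m i)"
      unfolding adm_def by (simp add: forall_8 inner_8 k2 k3 k4 k5 k6 k7 k8)
    with that show ?thesis by blast
  qed
  moreover have "gen 1 (\<chi> i. X $ i $ sg 1 i) = 0"
    by (simp add: gen_def vec_eq_iff forall_8 k1)
  ultimately have "gen m (\<chi> i. X $ i $ sg m i) \<in> span {gen m c | m c. adm m c}" for m
    by (cases "m = 1") (auto intro!: span_base span_zero)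
  then show ?thesis
    by (subst mat_eq_sum_gen) (intro span_sum, blast)
qed

section \<open>Matrix groups near the identity\<close>

lemma bounded_bilinear_matrix_mult: "bounded_bilinear ((**) :: real^'n^'m \<Rightarrow> real^'k^'n \<Rightarrow> real^'k^'m)"
  unfolding bilinear_conv_bounded_bilinear [symmetric] bilinear_def
  by (auto intro!: linearI simp: matrix_add_ldistrib matrix_matrix_mult_def vec_eq_iff
      sum.distrib sum_distrib_left algebra_simps)

lemma bounded_bilinear_matrix_vector_mult:
  "bounded_bilinear ((*v) :: real^'n^'m \<Rightarrow> real^'n \<Rightarrow> real^'m)"
  unfolding bilinear_conv_bounded_bilinear [symmetric] bilinear_def
  by (auto intro!: linearI simp: matrix_vector_mult_def vec_eq_iff
      sum.distrib sum_distrib_left algebra_simps)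

interpretation mm: bounded_bilinear "(**) :: real^8^8 \<Rightarrow> real^8^8 \<Rightarrow> real^8^8"
  by (rule bounded_bilinear_matrix_mult)

interpretation mv: bounded_bilinear "(*v) :: real^8^8 \<Rightarrow> real^8 \<Rightarrow> real^8"
  by (rule bounded_bilinear_matrix_vector_mult)

lemma preserves_cayley_mult_iff:
  assumes "preserves_cayley A"
  shows "preserves_cayley (A ** B) \<longleftrightarrow> preserves_cayley B"
  using assms by (simp add: preserves_cayley_def flip: matrix_vector_mul_assoc)

lemma rot_add:
  assumes "adm m c"
  shows "rot m c (s + t) = rot m c s ** rot m c t"
proof -
  have m: "m \<noteq> 1" and cs: "c $ sg m i = - c $ i" for i using assms by (auto simp: adm_def)
  show ?thesis
    by (simp add: matrix_eq vec_eq_iff rot_mult [OF m] cs cos_add sin_add algebra_simps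
        flip: matrix_vector_mul_assoc)
qed

text \<open>Curves lie in \<open>H\<close> at all parameters, so they can be multiplied and
  rescaled. Continuity everywhere serves the open mapping theorem; differentiability is asked only
  at the identity.\<close>

definition curve_tangents :: "(real^8^8) set \<Rightarrow> (real^8^8) set" where
  "curve_tangents H = {X. \<exists>h. continuous_on UNIV h \<and> (\<forall>t. h t \<in> H) \<and> h 0 = mat 1 \<and>
     (h has_vector_derivative X) (at (0::real))}"

locale matrix_monoid =
  fixes H :: "(real^8^8) set"
  assumes one_mem: "mat 1 \<in> H" and mult_mem: "A \<in> H \<Longrightarrow> B \<in> H \<Longrightarrow> A ** B \<in> H"
begin

text \<open>Pointwise products of curves add velocities, and rescaling the parameter, also by
  negative factors, multiplies them; thus no inverses in \<open>H\<close> enter.\<close>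

lemma subspace_curve_tangents: "subspace (curve_tangents H)"
  unfolding subspace_def
proof (intro conjI ballI allI)
  show "0 \<in> curve_tangents H"
    unfolding curve_tangents_def using one_mem
    by (auto intro!: exI [of _ "\<lambda>t. mat 1"])
next
  fix X Y assume "X \<in> curve_tangents H" "Y \<in> curve_tangents H"
  then obtain f g where
    f: "continuous_on UNIV f" "\<forall>t. f t \<in> H" "f 0 = mat 1" "(f has_vector_derivative X) (at 0)" and
    g: "continuous_on UNIV g" "\<forall>t. g t \<in> H" "g 0 = mat 1" "(g has_vector_derivative Y) (at 0)"
    unfolding curve_tangents_def by blast
  have "((\<lambda>t. f t ** g t) has_vector_derivative X + Y) (at 0)"
    using mm.has_vector_derivative [OF f(4) g(4)] f(3) g(3) by (simp add: add.commute)
  moreover have "continuous_on UNIV (\<lambda>t. f t ** g t)"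
    by (intro mm.continuous_on f g)
  ultimately show "X + Y \<in> curve_tangents H"
    unfolding curve_tangents_def using f g mult_mem
    by (auto intro!: exI [of _ "\<lambda>t. f t ** g t"])
next
  fix r X assume "X \<in> curve_tangents H"
  then obtain f where
    f: "continuous_on UNIV f" "\<forall>t. f t \<in> H" "f 0 = mat 1" "(f has_vector_derivative X) (at 0)"
    unfolding curve_tangents_def by blast
  have "((\<lambda>t. f (r * t)) has_vector_derivative r *\<^sub>R X) (at 0)"
    using vector_diff_chain_at [of "\<lambda>t. r * t" r 0 f X] f(4)
    by (simp add: o_def) (auto intro!: derivative_eq_intros simp: has_real_derivative_iff_has_vector_derivative [symmetric])
  moreover have "continuous_on UNIV (\<lambda>t. f (r * t))"
    by (rule continuous_on_compose2 [OF f(1)]) (auto intro!: continuous_intros)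
  ultimately show "r *\<^sub>R X \<in> curve_tangents H"
    unfolding curve_tangents_def using f
    by (auto intro!: exI [of _ "\<lambda>t. f (r * t)"])
qed

text \<open>\<open>k\<close> may lie outside \<open>H\<close> as long as it conjugates
  \<open>H\<close> into itself. This lets transports along open paths act on the tangent
  space.\<close>

lemma curve_tangents_conj:
  assumes X: "X \<in> curve_tangents H" and k: "\<And>A. A \<in> H \<Longrightarrow> k ** A ** k' \<in> H" "k ** k' = mat 1"
  shows "k ** X ** k' \<in> curve_tangents H"
proof -
  obtain f where
    f: "continuous_on UNIV f" "\<forall>t. f t \<in> H" "f 0 = mat 1" "(f has_vector_derivative X) (at 0)"
    using X unfolding curve_tangents_def by blast
  have "((\<lambda>t. k ** f t ** k') has_vector_derivative k ** X ** k') (at 0)"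
    using bounded_linear.has_vector_derivative [OF bounded_linear_compose
        [OF mm.bounded_linear_left [of k'] mm.bounded_linear_right [of k]] f(4)] .
  moreover have "continuous_on UNIV (\<lambda>t. k ** f t ** k')"
    by (intro mm.continuous_on f continuous_on_const)
  ultimately show ?thesis
    unfolding curve_tangents_def using f k
    by (auto intro!: exI [of _ "\<lambda>t. k ** f t ** k'"])
qed

text \<open>One curve per element of \<open>B\<close>, run for the time
  \<open>Z \<bullet> b\<close>, all multiplied together: canonical coordinates of the second kind.
  For orthonormal \<open>B\<close> the derivative is the orthogonal projection onto the
  span.\<close>

lemma product_of_curves:
  assumes "finite B" "B \<subseteq> curve_tangents H"
  shows "\<exists>h. continuous_on UNIV h \<and> (\<forall>Z. h Z \<in> H) \<and> h 0 = mat 1 \<and>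
    (h has_derivative (\<lambda>Z. \<Sum>b\<in>B. (Z \<bullet> b) *\<^sub>R b)) (at 0)"
  using assms
proof (induction B)
  case empty
  then show ?case using one_mem by (auto intro!: exI [of _ "\<lambda>t. mat 1"])
next
  case (insert X B)
  then obtain h where
    h: "continuous_on UNIV h" "\<forall>Z. h Z \<in> H" "h 0 = mat 1"
      "(h has_derivative (\<lambda>Z. \<Sum>b\<in>B. (Z \<bullet> b) *\<^sub>R b)) (at 0)" by auto
  obtain f where
    f: "continuous_on UNIV f" "\<forall>t. f t \<in> H" "f 0 = mat 1" "(f has_vector_derivative X) (at 0)"
    using insert.prems unfolding curve_tangents_def by blast
  have 1: "((\<lambda>Z. f (Z \<bullet> X)) has_derivative (\<lambda>Z. (Z \<bullet> X) *\<^sub>R X)) (at 0)"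
    using diff_chain_at [of "\<lambda>Z. Z \<bullet> X" "\<lambda>Z. Z \<bullet> X" 0 f "\<lambda>t. t *\<^sub>R X"] f(4)
    by (simp add: o_def has_vector_derivative_def bounded_linear_imp_has_derivative bounded_linear_inner_left)
  have "((\<lambda>Z. f (Z \<bullet> X) ** h Z) has_derivative (\<lambda>Z. \<Sum>b\<in>insert X B. (Z \<bullet> b) *\<^sub>R b)) (at 0)"
    using mm.FDERIV [OF 1 h(4)] f(3) h(3) insert.hyps by (simp add: add.commute)
  moreover have "continuous_on UNIV (\<lambda>Z. f (Z \<bullet> X) ** h Z)"
    by (intro mm.continuous_on h continuous_on_compose2 [OF f(1)]) (auto intro!: continuous_intros)
  ultimately show ?case
    using f h mult_mem by (auto intro!: exI [of _ "\<lambda>Z. f (Z \<bullet> X) ** h Z"])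
qed

end

text \<open>
  Linearising the equation at the identity: a short vector transverse to the kernel of the
  linearised action cannot lead out of the identity inside the stabiliser.
\<close>

lemma transverse_slice:
  assumes ker: "\<And>X. (\<And>v w x y. cayley_action X v w x y = 0) \<Longrightarrow> X \<in> span B"
  shows "\<exists>r>0. \<forall>Y. norm Y < r \<longrightarrow> (\<forall>b\<in>B. Y \<bullet> b = 0) \<longrightarrow> preserves_cayley (mat 1 + Y) \<longrightarrow> Y = 0"
proof (rule ccontr)
  assume "\<not> ?thesis"
  then have "\<exists>Y. norm Y < r \<and> (\<forall>b\<in>B. Y \<bullet> b = 0) \<and> preserves_cayley (mat 1 + Y) \<and> Y \<noteq> 0"
    if "r > 0" for r using that by blast
  then have "\<forall>n. \<exists>Y. norm Y < inverse (real (Suc n)) \<and> (\<forall>b\<in>B. Y \<bullet> b = 0) \<and> preserves_cayley (mat 1 + Y) \<and> Y \<noteq> 0"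
    by simp
  then obtain Y where Y: "\<And>n. norm (Y n) < inverse (real (Suc n))" "\<And>n b. b \<in> B \<Longrightarrow> Y n \<bullet> b = 0"
    "\<And>n. preserves_cayley (mat 1 + Y n)" "\<And>n. Y n \<noteq> 0"
    by metis
  \<comment> \<open>The directions of the counterexamples accumulate at a unit vector
    \<open>L\<close>. Linearising the invariance puts \<open>L\<close> into the span of
    \<open>B\<close>, while orthogonality to \<open>B\<close> passes to the limit, a
    contradiction.\<close>
  define Z where "Z n = Y n /\<^sub>R norm (Y n)" for n
  have "\<forall>n. Z n \<in> sphere 0 1" using Y(4) by (simp add: Z_def)
  then obtain L \<sigma> where L: "L \<in> sphere 0 1" "strict_mono \<sigma>" "(Z \<circ> \<sigma>) \<longlonglongrightarrow> L"
    using compact_sphere [of "0 :: real^8^8" 1] unfolding compact_def by metis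
  have Y0: "Y \<longlonglongrightarrow> 0"
    by (rule Lim_null_comparison [OF always_eventually LIMSEQ_inverse_real_of_nat])
      (intro allI less_imp_le Y(1))
  have "cayley_action L v w x y = 0" for v w x y
  proof -
    let ?f = "\<lambda>X. cayley_form ((mat 1 + X) *v v) ((mat 1 + X) *v w) ((mat 1 + X) *v x) ((mat 1 + X) *v y)"
    let ?D = "\<lambda>X. cayley_action X v w x y"
    have d: "((\<lambda>X. (mat 1 + X) *v v) has_derivative (\<lambda>X. X *v v)) (at 0)" for v :: "real^8"
      using bounded_linear_imp_has_derivative [OF mv.bounded_linear_left [of v]]
      by (auto intro!: derivative_eq_intros simp: matrix_vector_mult_add_rdistrib)
    have D: "(?f has_derivative ?D) (at 0)"
      using cayley_form_has_derivative [OF d d d d, of v w x y] by (simp add: cayley_action_def)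
    then have lin: "bounded_linear ?D" by (rule has_derivative_bounded_linear)
    have lim: "((\<lambda>X. norm (?f X - ?f 0 - ?D X) / norm X) \<longlongrightarrow> 0) (at 0)"
      using D by (simp add: has_derivative_at)
    have "filterlim Y (at 0) sequentially"
      using Y0 Y(4) by (simp add: filterlim_at)
    from filterlim_compose [OF lim this]
    have "(\<lambda>n. norm (?f (Y n) - ?f 0 - ?D (Y n)) / norm (Y n)) \<longlonglongrightarrow> 0" .
    moreover have "norm (?f (Y n) - ?f 0 - ?D (Y n)) / norm (Y n) = \<bar>?D (Z n)\<bar>" for n
    proof -
      have "?f (Y n) = ?f 0" using Y(3) by (simp add: preserves_cayley_def)
      moreover have "?D (Z n) = ?D (Y n) / norm (Y n)"
        using linear_scale [OF bounded_linear.linear [OF lin]] by (simp add: Z_def divide_inverse mult.commute)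
      ultimately show ?thesis by (simp add: abs_div)
    qed
    ultimately have "(\<lambda>n. \<bar>?D (Z n)\<bar>) \<longlonglongrightarrow> 0" by simp
    then have "(\<lambda>n. ?D (Z n)) \<longlonglongrightarrow> 0" by (rule tendsto_rabs_zero_cancel)
    then have "(\<lambda>n. ?D (Z (\<sigma> n))) \<longlonglongrightarrow> 0"
      using LIMSEQ_subseq_LIMSEQ [OF _ L(2)] by (auto simp: o_def)
    moreover have "(\<lambda>n. ?D (Z (\<sigma> n))) \<longlonglongrightarrow> ?D L"
      using bounded_linear.tendsto [OF lin L(3)] by (simp add: o_def)
    ultimately show ?thesis using LIMSEQ_unique by blast
  qed
  then have "L \<in> span B" by (rule ker)
  moreover have "orthogonal L b" if "b \<in> B" for b
  proof -
    have "(\<lambda>n. (Z \<circ> \<sigma>) n \<bullet> b) \<longlonglongrightarrow> L \<bullet> b" by (intro tendsto_inner L(3) tendsto_const)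
    moreover have "(Z \<circ> \<sigma>) n \<bullet> b = 0" for n by (simp add: Z_def Y(2) that)
    ultimately show ?thesis by (simp add: orthogonal_def LIMSEQ_const_iff)
  qed
  ultimately have "orthogonal L L" using orthogonal_to_span by blast
  then show False using L(1) by (auto simp: orthogonal_self)
qed

context matrix_monoid
begin

text \<open>Near the identity every matrix factors as an element of \<open>H\<close> times
  \<open>mat 1 + Y\<close> with \<open>Y\<close> orthogonal to the tangent space. If the product
  preserves the form, so does the second factor, and \<open>transverse_slice\<close> forces
  \<open>Y = 0\<close>.\<close>

lemma neighbourhood_of_one:
  assumes H: "\<And>A. A \<in> H \<Longrightarrow> preserves_cayley A"
    and gens: "\<And>m c. adm m c \<Longrightarrow> gen m c \<in> curve_tangents H"
  obtains d where "d > 0" "\<And>A. preserves_cayley A \<Longrightarrow> dist (mat 1) A < d \<Longrightarrow> A \<in> H"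
proof -
  let ?T = "curve_tangents H"
  obtain B where B: "B \<subseteq> ?T" "pairwise orthogonal B" "\<And>x. x \<in> B \<Longrightarrow> norm x = 1"
      "independent B" "span B = ?T"
    using orthonormal_basis_subspace [OF subspace_curve_tangents] by metis
  have fin: "finite B" using B(4) by (rule independent_imp_finite)
  define P where "P Z = (\<Sum>b\<in>B. (Z \<bullet> b) *\<^sub>R b)" for Z
  have P: "(Z - P Z) \<bullet> b = 0" if "b \<in> B" for Z b
  proof -
    have "P Z \<bullet> b = (\<Sum>b'\<in>B. if b' = b then Z \<bullet> b else 0)"
      unfolding P_def inner_sum_left
    proof (rule sum.cong [OF refl])
      fix b' assume "b' \<in> B"
      then show "(Z \<bullet> b') *\<^sub>R b' \<bullet> b = (if b' = b then Z \<bullet> b else 0)"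
        using B(2,3) that by (auto simp: pairwise_def orthogonal_def dot_square_norm)
    qed
    then show ?thesis using fin that by (simp add: inner_diff_left)
  qed
  have nP: "norm (Z - P Z) \<le> norm Z" for Z
  proof -
    have "(Z - P Z) \<bullet> P Z = 0"
      unfolding P_def inner_sum_right inner_scaleR_right by (simp add: P [unfolded P_def])
    then have "(norm Z)\<^sup>2 = (norm (Z - P Z))\<^sup>2 + (norm (P Z))\<^sup>2"
      using norm_add_Pythagorean [of "Z - P Z" "P Z"] by (simp add: orthogonal_def)
    then show ?thesis by (metis le_add_same_cancel1 norm_ge_zero power2_le_imp_le zero_le_power2)
  qed
  have blP: "bounded_linear P"
    unfolding P_def by (intro bounded_linear_sum bounded_linear_scaleR_const bounded_linear_inner_left)
  obtain h where
    h: "continuous_on UNIV h" "\<And>Z. h Z \<in> H" "h 0 = mat 1" "(h has_derivative P) (at 0)"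
    using product_of_curves [OF fin B(1)] unfolding P_def by blast
  have "{gen m c | m c. adm m c} \<subseteq> span B" using gens B(5) by blast
  then have "X \<in> span B" if "\<And>v w x y. cayley_action X v w x y = 0" for X
    using cayley_action_kernel [OF that] span_mono span_span by blast
  then obtain r where r: "r > 0"
    "\<And>Y. norm Y < r \<Longrightarrow> \<forall>b\<in>B. Y \<bullet> b = 0 \<Longrightarrow> preserves_cayley (mat 1 + Y) \<Longrightarrow> Y = 0"
    using transverse_slice by meson
  \<comment> \<open>The projection \<open>P\<close> moves inside \<open>H\<close> and the complement
    \<open>Z - P Z\<close> transversally, so the derivative at 0 is the identity.\<close>
  define \<Psi> where "\<Psi> Z = h Z ** (mat 1 + (Z - P Z))" for Z
  have d1: "((\<lambda>Z. mat 1 + (Z - P Z)) has_derivative (\<lambda>Z. Z - P Z)) (at 0)"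
    by (auto intro!: derivative_eq_intros bounded_linear_imp_has_derivative blP)
  have P0: "P 0 = 0" by (simp add: P_def)
  have "(\<Psi> has_derivative id) (at 0)"
    unfolding \<Psi>_def using mm.FDERIV [OF h(4) d1] by (simp add: h(3) P0 id_def)
  moreover have "continuous_on UNIV \<Psi>"
    unfolding \<Psi>_def
    by (intro mm.continuous_on h(1) continuous_intros linear_continuous_on blP)
  ultimately have "\<Psi> 0 \<in> interior (\<Psi> ` ball 0 r)"
    using r(1) by (intro sussmann_open_mapping [where S = UNIV and f' = id and g' = id])
      (auto simp: bounded_linear_ident [folded id_def] interior_open)
  then obtain d where d: "d > 0" "ball (mat 1) d \<subseteq> \<Psi> ` ball 0 r"
    unfolding mem_interior by (auto simp: \<Psi>_def h(3) P0)
  have "A \<in> H" if A: "preserves_cayley A" "dist (mat 1) A < d" for A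
  proof -
    have "A \<in> \<Psi> ` ball 0 r" using d(2) A(2) by auto
    then obtain Z where Z: "norm Z < r" "A = h Z ** (mat 1 + (Z - P Z))"
      by (auto simp: \<Psi>_def)
    have "preserves_cayley (mat 1 + (Z - P Z))"
      using A(1) H [OF h(2)] unfolding Z(2) by (simp add: preserves_cayley_mult_iff)
    moreover have "norm (Z - P Z) < r" using nP [of Z] Z(1) by linarith
    ultimately have "Z - P Z = 0" using r(2) P by blast
    then show ?thesis using Z(2) h(2) by simp
  qed
  with d(1) that show thesis by blast
qed

text \<open>\<open>rot m c t\<close> is the \<open>n\<close>-th power of
  \<open>rot m c (t / n)\<close>, which is close to the identity for large \<open>n\<close>.\<close>

lemma rot_mem:
  assumes "d > 0" and d: "\<And>A. preserves_cayley A \<Longrightarrow> dist (mat 1) A < d \<Longrightarrow> A \<in> H"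
    and c: "adm m c"
  shows "rot m c t \<in> H"
proof -
  have m: "m \<noteq> 1" using c by (auto simp: adm_def)
  have pow: "rot m c (real n * s) \<in> H" if "rot m c s \<in> H" for n s
    by (induction n) (use m one_mem mult_mem [OF that] rot_add [OF c] in \<open>simp_all add: algebra_simps\<close>)
  have "((\<lambda>s. rot m c s) \<longlongrightarrow> rot m c 0) (at 0)"
    unfolding rot_def
    by (intro tendsto_vec_lambda) (auto intro!: tendsto_eq_intros)
  then have "\<forall>\<^sub>F s in at 0. dist (rot m c s) (mat 1) < d"
    using \<open>d > 0\<close> m by (auto dest: tendstoD)
  then obtain e where e: "e > 0" "\<And>s. s \<noteq> 0 \<Longrightarrow> \<bar>s\<bar> < e \<Longrightarrow> dist (rot m c s) (mat 1) < d"
    unfolding eventually_at by (auto simp: dist_real_def)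
  obtain n where n: "\<bar>t\<bar> / e < real n" using reals_Archimedean2 by blast
  then have n0: "n > 0" using e(1) by (cases n) (auto simp: field_simps)
  have "\<bar>t / real n\<bar> < e" using n n0 e(1) by (simp add: field_simps)
  then have "dist (mat 1) (rot m c (t / real n)) < d"
    using e(2) [of "t / real n"] \<open>d > 0\<close> m n0 by (cases "t = 0") (auto simp: dist_commute)
  then have "rot m c (t / real n) \<in> H" using d preserves_cayley_rot [OF c] by blast
  from pow [OF this, of n] show ?thesis using n0 by simp
qed

end

section \<open>Generating the stabiliser by plane rotations\<close>

text \<open>\<open>t\<close> is the polar angle of \<open>(a, b)\<close>, the angle of a Givens
  rotation that annihilates \<open>b\<close>.\<close>

lemma exists_angle:
  obtains t where "cos t * a + sin t * b = sqrt (a\<^sup>2 + b\<^sup>2)" "cos t * b = sin t * (a :: real)"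
proof (cases "a = 0 \<and> b = 0")
  case True
  then show ?thesis using that by auto
next
  case False
  let ?r = "sqrt (a\<^sup>2 + b\<^sup>2)"
  have r: "?r > 0" using False by (auto simp: sum_power2_gt_zero_iff)
  have sq: "?r\<^sup>2 = a\<^sup>2 + b\<^sup>2" by simp
  have "(a / ?r)\<^sup>2 + (b / ?r)\<^sup>2 = 1"
    using False by (simp add: power_divide add_divide_distrib [symmetric] sum_power2_eq_zero_iff)
  then obtain t where t: "a / ?r = cos t" "b / ?r = sin t" using sincos_total_2pi by metis
  have "cos t * a + sin t * b = (a\<^sup>2 + b\<^sup>2) / ?r"
    by (simp add: t [symmetric] power2_eq_square add_divide_distrib)
  also have "\<dots> = ?r" by (simp add: real_div_sqrt)
  finally show ?thesis using that [of t] by (simp add: t [symmetric])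
qed

definition supported :: "8 set \<Rightarrow> real^8 \<Rightarrow> bool" where
  "supported S w \<longleftrightarrow> (\<forall>i. i \<notin> S \<longrightarrow> w $ i = 0)"

lemma transpose_rot:
  assumes "adm m c"
  shows "transpose (rot m c t) = rot m c (- t)"
proof -
  have m: "m \<noteq> 1" and cs: "c $ sg m i = - c $ i" for i using assms by (auto simp: adm_def)
  have "sg m i = j \<longleftrightarrow> sg m j = i" for i j using sg_sg by metis
  then show ?thesis
    using cs m by (auto simp: transpose_def rot_def vec_eq_iff)
qed

lemma orthogonal_matrix_rot:
  assumes "adm m c"
  shows "orthogonal_matrix (rot m c t)"
  using rot_add [OF assms, of t "- t"] rot_add [OF assms, of "- t" t] assms
  by (simp add: orthogonal_matrix_def transpose_rot adm_def)

lemma orthogonal_matrix_inner: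
  fixes k :: "real^'n^'n"
  assumes "orthogonal_matrix k"
  shows "(k *v v) \<bullet> (k *v w) = v \<bullet> w"
  using assms orthogonal_transformation_matrix [of "(*v) k"]
  by (simp add: orthogonal_transformation_def)

lemma orthogonal_matrix_norm:
  fixes k :: "real^'n^'n"
  shows "orthogonal_matrix k \<Longrightarrow> norm (k *v v) = norm v"
  by (simp add: norm_eq_sqrt_inner orthogonal_matrix_inner)

locale rot_monoid = matrix_monoid +
  assumes rot_in: "adm m c \<Longrightarrow> rot m c t \<in> H"
    and preserves: "A \<in> H \<Longrightarrow> preserves_cayley A"
begin

text \<open>Membership of the transpose is built in because \<open>H\<close> is only a monoid: it
  supplies the inverse.\<close>

definition fixers :: "8 set \<Rightarrow> (real^8^8) set" where
  "fixers S = {k \<in> H. transpose k \<in> H \<and> orthogonal_matrix k \<and>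
     (\<forall>j. j \<notin> S \<longrightarrow> k *v axis j 1 = axis j 1)}"

lemma fixers_mult:
  assumes "k \<in> fixers S" "l \<in> fixers S"
  shows "k ** l \<in> fixers S"
  using assms by (auto simp: fixers_def mult_mem matrix_transpose_mul orthogonal_matrix_mul
      simp flip: matrix_vector_mul_assoc)

lemma fixers_transpose:
  assumes "k \<in> fixers S"
  shows "transpose k \<in> fixers S"
proof -
  have o: "transpose k ** k = mat 1" using assms by (simp add: fixers_def orthogonal_matrix_def)
  have "transpose k *v axis j 1 = axis j 1" if "j \<notin> S" for j
  proof -
    have "transpose k *v axis j 1 = transpose k *v (k *v axis j 1)"
      using assms that by (simp add: fixers_def)
    also have "\<dots> = axis j 1" by (simp add: matrix_vector_mul_assoc o)
    finally show ?thesis .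
  qed
  then show ?thesis using assms by (simp add: fixers_def)
qed

lemma fixers_nth:
  assumes "k \<in> fixers S" "j \<notin> S"
  shows "(k *v v) $ j = v $ j"
proof -
  have "(k *v v) $ j = (k *v v) \<bullet> (k *v axis j 1)"
    using assms by (simp add: fixers_def inner_axis)
  also have "\<dots> = v \<bullet> axis j 1"
    using assms(1) unfolding fixers_def by (intro orthogonal_matrix_inner) simp
  also have "\<dots> = v $ j" by (simp add: inner_axis)
  finally show ?thesis .
qed

lemma fixers_supported:
  assumes "k \<in> fixers S" "supported S w"
  shows "supported S (k *v w)"
  using assms fixers_nth by (simp add: supported_def)

lemma rot_in_fixers:
  assumes "adm m c" "\<forall>j. j \<notin> S \<longrightarrow> c $ j = 0"
  shows "rot m c t \<in> fixers S"
proof -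
  have m: "m \<noteq> 1" and cs: "c $ sg m i = - c $ i" for i using assms by (auto simp: adm_def)
  have "rot m c t *v axis j 1 = axis j 1" if "j \<notin> S" for j
  proof -
    have "(rot m c t *v axis j 1) $ i = axis j 1 $ i" for i
    proof (cases "c $ i = 0")
      case False
      then have "i \<noteq> j" "sg m i \<noteq> j" using assms(2) that cs by auto
      then show ?thesis by (simp add: rot_mult [OF m] axis_def)
    qed (simp add: rot_mult [OF m])
    then show ?thesis by (simp add: vec_eq_iff)
  qed
  then show ?thesis
    using assms(1) by (simp add: fixers_def rot_in transpose_rot orthogonal_matrix_rot)
qed

section \<open>Transitivity of successive stabilisers on spheres\<close>

definition moves :: "8 set \<Rightarrow> 8 set \<Rightarrow> 8 set \<Rightarrow> bool" where
  "moves S T T' \<longleftrightarrow> (\<forall>w. supported T w \<longrightarrow> (\<exists>k\<in>fixers S. supported T' (k *v w)))"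

lemma moves_trans: "moves S T T' \<Longrightarrow> moves S T' T'' \<Longrightarrow> moves S T T''"
  unfolding moves_def by (metis fixers_mult matrix_vector_mul_assoc)

text \<open>The angle annihilates coordinate \<open>sg m i\<close>. The last hypothesis protects the
  rest: any other coordinate outside \<open>T'\<close> was zero and stays zero, being unrotated or
  paired with a zero coordinate.\<close>

lemma givens_step:
  assumes "adm m c" "c $ i = 1" "\<forall>j. j \<notin> S \<longrightarrow> c $ j = 0"
    and "\<forall>j. j \<notin> T' \<longrightarrow> j = sg m i \<or> j \<notin> T \<and> (c $ j = 0 \<or> sg m j \<notin> T)"
  shows "moves S T T'"
  unfolding moves_def
proof (intro allI impI)
  fix w assume w: "supported T w"
  have m: "m \<noteq> 1" and cs: "c $ sg m i = - c $ i" for i using assms(1) by (auto simp: adm_def)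
  obtain t where t: "cos t * w $ sg m i = sin t * w $ i"
    by (rule exists_angle [of "w $ i" "w $ sg m i"])
  have "supported T' (rot m c t *v w)"
    unfolding supported_def rot_mult [OF m]
  proof (intro allI impI)
    fix j assume "j \<notin> T'"
    then consider "j = sg m i" | "j \<notin> T" "c $ j = 0 \<or> sg m j \<notin> T" using assms(4) by blast
    then show "cos (c $ j * t) * w $ j + sin (c $ j * t) * w $ sg m j = 0"
      using w t by cases (auto simp: cs assms(2) supported_def)
  qed
  then show "\<exists>k\<in>fixers S. supported T' (k *v w)"
    using rot_in_fixers [OF assms(1,3)] by blast
qed

text \<open>Transitivity of Spin(7) on the 7-sphere. The equation
  \<open>nu m \<bullet> c = 0\<close> forbids turning a single plane, so each step also turns a
  second one, chosen with both coordinates still allowed or both already zero.\<close>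

lemma moves_1: "moves UNIV UNIV {1}"
proof -
  have "moves UNIV UNIV {1,2,3,4,5,7,8}"
    by (rule givens_step [of 2 "vector [-1, 1, 0, 0, 1, -1, 0, 0]" 5])
      (simp_all add: adm_def forall_8 inner_8)
  moreover have "moves UNIV {1,2,3,4,5,7,8} {1,2,3,4,5,8}"
    by (rule givens_step [of 3 "vector [-1, 0, 1, 0, 1, 0, -1, 0]" 5])
      (simp_all add: adm_def forall_8 inner_8)
  moreover have "moves UNIV {1,2,3,4,5,8} {1,2,3,4,5}"
    by (rule givens_step [of 4 "vector [1, 0, 0, -1, 1, 0, 0, -1]" 5])
      (simp_all add: adm_def forall_8 inner_8)
  moreover have "moves UNIV {1,2,3,4,5} {1,2,3,5}"
    by (rule givens_step [of 2 "vector [0, 0, 1, -1, 0, 0, -1, 1]" 3])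
      (simp_all add: adm_def forall_8 inner_8)
  moreover have "moves UNIV {1,2,3,5} {1,2,5}"
    by (rule givens_step [of 4 "vector [0, 1, -1, 0, 0, 1, -1, 0]" 2])
      (simp_all add: adm_def forall_8 inner_8)
  moreover have "moves UNIV {1,2,5} {1,5}"
    by (rule givens_step [of 6 "vector [0, -1, 1, 0, 1, 0, 0, -1]" 5])
      (simp_all add: adm_def forall_8 inner_8)
  moreover have "moves UNIV {1,5} {1}"
    by (rule givens_step [of 5 "vector [1, 1, 0, 0, -1, -1, 0, 0]" 1])
      (simp_all add: adm_def forall_8 inner_8)
  ultimately show ?thesis using moves_trans by meson
qed

text \<open>The stabiliser of a unit vector in Spin(7) is a copy of G2, transitive on the 6-sphere;
  now no rotation may touch axis 1.\<close>

lemma moves_2: "moves (- {1}) (- {1}) {2}"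
proof -
  have "moves (- {1}) (- {1}) {2,3,4,5,7,8}"
    by (rule givens_step [of 2 "vector [0, 0, -1, 1, 1, -1, 0, 0]" 5])
      (simp_all add: adm_def forall_8 inner_8)
  moreover have "moves (- {1}) {2,3,4,5,7,8} {2,3,4,5,8}"
    by (rule givens_step [of 3 "vector [0, 1, 0, -1, 1, 0, -1, 0]" 5])
      (simp_all add: adm_def forall_8 inner_8)
  moreover have "moves (- {1}) {2,3,4,5,8} {2,3,4,5}"
    by (rule givens_step [of 4 "vector [0, 1, -1, 0, 1, 0, 0, -1]" 5])
      (simp_all add: adm_def forall_8 inner_8)
  moreover have "moves (- {1}) {2,3,4,5} {2,3,5}"
    by (rule givens_step [of 2 "vector [0, 0, 1, -1, 0, 0, -1, 1]" 3])
      (simp_all add: adm_def forall_8 inner_8)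
  moreover have "moves (- {1}) {2,3,5} {2,5}"
    by (rule givens_step [of 4 "vector [0, 1, -1, 0, 0, 1, -1, 0]" 2])
      (simp_all add: adm_def forall_8 inner_8)
  moreover have "moves (- {1}) {2,5} {2}"
    by (rule givens_step [of 6 "vector [0, 1, -1, 0, -1, 0, 0, 1]" 2])
      (simp_all add: adm_def forall_8 inner_8)
  ultimately show ?thesis using moves_trans by meson
qed

text \<open>Fixing two axes leaves a copy of SU(3), transitive on the 5-sphere.\<close>

lemma moves_3: "moves (- {1,2}) (- {1,2}) {3}"
proof -
  have "moves (- {1,2}) (- {1,2}) {3,4,5,6,7}"
    by (rule givens_step [of 2 "vector [0, 0, 0, 0, -1, 1, 1, -1]" 7])
      (simp_all add: adm_def forall_8 inner_8)
  moreover have "moves (- {1,2}) {3,4,5,6,7} {3,4,5,7}"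
    by (rule givens_step [of 2 "vector [0, 0, -1, 1, 1, -1, 0, 0]" 5])
      (simp_all add: adm_def forall_8 inner_8)
  moreover have "moves (- {1,2}) {3,4,5,7} {3,4,5}"
    by (rule givens_step [of 3 "vector [0, 0, 0, 0, 1, 1, -1, -1]" 5])
      (simp_all add: adm_def forall_8 inner_8)
  moreover have "moves (- {1,2}) {3,4,5} {3,5}"
    by (rule givens_step [of 2 "vector [0, 0, 1, -1, 0, 0, -1, 1]" 3])
      (simp_all add: adm_def forall_8 inner_8)
  moreover have "moves (- {1,2}) {3,5} {3}"
    by (rule givens_step [of 7 "vector [0, 0, 1, 1, -1, -1, 0, 0]" 3])
      (simp_all add: adm_def forall_8 inner_8)
  ultimately show ?thesis using moves_trans by meson
qed

text \<open>
  With \<open>z\<^sub>1 = w\<^sub>5 + i w\<^sub>6\<close> and \<open>z\<^sub>2 = w\<^sub>7 + i w\<^sub>8\<close>, the first rotation makes \<open>z\<^sub>1\<close> and \<open>z\<^sub>2\<close> real multiples of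
  one complex number, so that the second, a real rotation of \<open>(z\<^sub>1, z\<^sub>2)\<close>, can annihilate \<open>z\<^sub>2\<close>.
\<close>

lemma moves_4: "moves {5,6,7,8} {5,6,7,8} {5}"
proof -
  let ?S = "{5,6,7,8} :: 8 set"
  have "moves ?S ?S {5,6}"
    unfolding moves_def
  proof (intro allI impI)
    fix w assume w: "supported ?S w"
    \<comment> \<open>\<open>s\<close> is an argument of \<open>z\<^sub>1\<close> times the
      conjugate of \<open>z\<^sub>2\<close>. Turning \<open>z\<^sub>1\<close> and
      \<open>z\<^sub>2\<close> in opposite senses by half of it makes this product real.\<close>
    obtain s where s: "cos s * (w$6 * w$7 - w$5 * w$8) = sin s * (w$5 * w$7 + w$6 * w$8)"
      by (rule exists_angle [of "w$5 * w$7 + w$6 * w$8" "w$6 * w$7 - w$5 * w$8"])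
    let ?k = "rot 2 (vector [0, 0, 0, 0, 1, -1, -1, 1]) (s / 2)"
    have k: "?k \<in> fixers ?S"
      by (rule rot_in_fixers) (simp_all add: adm_def forall_8 inner_8)
    define v where "v = ?k *v w"
    have v: "v$5 = cos (s/2) * w$5 + sin (s/2) * w$6" "v$6 = cos (s/2) * w$6 - sin (s/2) * w$5"
      "v$7 = cos (s/2) * w$7 - sin (s/2) * w$8" "v$8 = cos (s/2) * w$8 + sin (s/2) * w$7"
      by (simp_all add: v_def rot_mult)
    have "v$6 * v$7 - v$5 * v$8 =
        (cos (s/2) ^ 2 - sin (s/2) ^ 2) * (w$6 * w$7 - w$5 * w$8)
        - 2 * sin (s/2) * cos (s/2) * (w$5 * w$7 + w$6 * w$8)"
      unfolding v by algebra
    also have "\<dots> = 0"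
      using s cos_double [of "s/2"] sin_double [of "s/2"] by simp
    finally have par: "v$6 * v$7 = v$5 * v$8" by simp
    have "\<exists>t. cos t * v$7 = sin t * v$5 \<and> cos t * v$8 = sin t * v$6"
    proof (cases "v$5 = 0 \<and> v$7 = 0")
      case True
      obtain t where "cos t * v$8 = sin t * v$6"
        by (rule exists_angle [of "v$6" "v$8"])
      with True show ?thesis by auto
    next
      case False
      obtain t where t: "cos t * v$5 + sin t * v$7 = sqrt ((v$5)\<^sup>2 + (v$7)\<^sup>2)" "cos t * v$7 = sin t * v$5"
        by (rule exists_angle [of "v$5" "v$7"])
      have "sqrt ((v$5)\<^sup>2 + (v$7)\<^sup>2) * (cos t * v$8 - sin t * v$6) = 0"
        unfolding t(1) [symmetric] using t(2) par by algebra
      moreover have "sqrt ((v$5)\<^sup>2 + (v$7)\<^sup>2) \<noteq> 0" using False by (simp add: sum_power2_eq_zero_iff)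
      ultimately show ?thesis using t(2) by auto
    qed
    then obtain t where t: "cos t * v$7 = sin t * v$5" "cos t * v$8 = sin t * v$6" by blast
    let ?l = "rot 3 (vector [0, 0, 0, 0, 1, 1, -1, -1]) t"
    have l: "?l \<in> fixers ?S"
      by (rule rot_in_fixers) (simp_all add: adm_def forall_8 inner_8)
    have "supported ?S (?l *v v)"
      using fixers_supported [OF l] fixers_supported [OF k w] by (simp add: v_def)
    moreover have "(?l *v v) $ 7 = 0" "(?l *v v) $ 8 = 0"
      using t by (simp_all add: rot_mult)
    ultimately have "supported {5,6} (?l *v v)" by (simp add: supported_def forall_8)
    then show "\<exists>k\<in>fixers ?S. supported {5,6} (k *v w)"
      using fixers_mult [OF l k] by (auto simp: v_def matrix_vector_mul_assoc)
  qed
  moreover have "moves ?S {5,6} {5}"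
    by (rule givens_step [of 2 "vector [0, 0, 0, 0, 1, -1, -1, 1]" 5])
      (simp_all add: adm_def forall_8 inner_8)
  ultimately show ?thesis by (rule moves_trans)
qed

end

section \<open>Rigidity of diagonal stabilisers\<close>

lemma axis_component: "axis i x $ j = (if j = i then x else 0)"
  by (simp add: axis_def)

lemma norm_axis_combination:
  "(norm (r *\<^sub>R axis s 1 + t *\<^sub>R v))\<^sup>2 = r\<^sup>2 + 2 * t * r * v $ s + t\<^sup>2 * (norm (v :: real^'n))\<^sup>2"
  using dot_norm [of "r *\<^sub>R axis s 1" "t *\<^sub>R v"] by (simp add: inner_axis' power_mult_distrib)

lemma supported_singleton: "supported {s} w \<Longrightarrow> w = (w $ s) *\<^sub>R axis s 1"
  by (auto simp: supported_def vec_eq_iff axis_def)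

text \<open>The triple cross products of axes 1, 2, 3, 5 are, up to sign, the remaining axes 4, 6,
  7, 8; these four axes therefore control the whole matrix.\<close>

lemma cayley_form_axes:
  "cayley_form (axis 1 1) (axis 2 1) (axis 3 1) x = x $ 4"
  "cayley_form (axis 1 1) (axis 2 1) (axis 5 1) x = x $ 6"
  "cayley_form (axis 1 1) (axis 3 1) (axis 5 1) x = x $ 7"
  "cayley_form (axis 2 1) (axis 3 1) (axis 5 1) x = - x $ 8"
  by (subst cayley_form_cycle(2), simp add: cayley_form_def dx4_axis)+

lemma cayley_form_two_axes:
  "cayley_form (axis 1 1) (axis 2 1) y z =
     y$3 * z$4 - y$4 * z$3 + (y$5 * z$6 - y$6 * z$5) + (y$7 * z$8 - y$8 * z$7)"
  "cayley_form (axis 1 1) (axis 3 1) y z =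
     y$4 * z$2 - y$2 * z$4 + (y$5 * z$7 - y$7 * z$5) - (y$6 * z$8 - y$8 * z$6)"
  by (simp_all add: cayley_form_def dx4_expand axis_def)

lemma cayley_form_scaleR:
  "cayley_form (r *\<^sub>R v) w x y = r * cayley_form v w x y"
  "cayley_form v (r *\<^sub>R w) x y = r * cayley_form v w x y"
  "cayley_form v w (r *\<^sub>R x) y = r * cayley_form v w x y"
  "cayley_form v w x (r *\<^sub>R y) = r * cayley_form v w x y"
  using cayley_form_linear [THEN linear_scale] by simp_all

lemma matrix_eq_axis:
  fixes A B :: "real^'n^'m"
  assumes "\<And>j. A *v axis j 1 = B *v axis j 1"
  shows "A = B"
  using assms by (simp add: matrix_vector_mult_basis column_def vec_eq_iff)

text \<open>Each of the 14 terms of the form forces a product of four diagonal entries to be 1.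
  Positivity permits logarithms, and the resulting linear system has only the zero solution.\<close>

lemma diagonal_preserves_cayley:
  assumes A: "preserves_cayley A" and d: "\<And>j. A *v axis j 1 = d j *\<^sub>R axis j 1" "\<And>j. d j > 0"
  shows "A = mat 1"
proof -
  have eq: "d i * d j * d k * d l * cayley_form (axis i 1) (axis j 1) (axis k 1) (axis l 1)
      = cayley_form (axis i 1) (axis j 1) (axis k 1) (axis l 1)" for i j k l
    using A unfolding preserves_cayley_def
    by (metis (no_types, lifting) cayley_form_scaleR d(1) mult.assoc)
  have log: "ln (d i) + ln (d j) + ln (d k) + ln (d l) = 0"
    if "cayley_form (axis i 1) (axis j 1) (axis k 1) (axis l 1) \<noteq> 0" for i j k l
  proof -
    have "d i * d j * d k * d l = 1" using eq [of i j k l] that by simp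
    then have "ln (d i * d j * d k * d l) = 0" by simp
    moreover have "d j \<noteq> 0" for j using d(2) [of j] by simp
    ultimately show ?thesis using d(2) by (simp add: ln_mult)
  qed
  note [simp] = cayley_form_def dx4_axis
  have "ln (d 1) + ln (d 2) + ln (d 3) + ln (d 4) = 0" "ln (d 1) + ln (d 2) + ln (d 5) + ln (d 6) = 0"
    "ln (d 1) + ln (d 2) + ln (d 7) + ln (d 8) = 0" "ln (d 3) + ln (d 4) + ln (d 5) + ln (d 6) = 0"
    "ln (d 3) + ln (d 4) + ln (d 7) + ln (d 8) = 0" "ln (d 5) + ln (d 6) + ln (d 7) + ln (d 8) = 0"
    "ln (d 1) + ln (d 3) + ln (d 5) + ln (d 7) = 0" "ln (d 1) + ln (d 3) + ln (d 6) + ln (d 8) = 0"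
    "ln (d 1) + ln (d 4) + ln (d 5) + ln (d 8) = 0" "ln (d 1) + ln (d 4) + ln (d 6) + ln (d 7) = 0"
    "ln (d 2) + ln (d 3) + ln (d 5) + ln (d 8) = 0" "ln (d 2) + ln (d 3) + ln (d 6) + ln (d 7) = 0"
    "ln (d 2) + ln (d 4) + ln (d 5) + ln (d 7) = 0" "ln (d 2) + ln (d 4) + ln (d 6) + ln (d 8) = 0"
    by (rule log; simp add: axis_component)+
  then have "ln (d 1) = 0 \<and> ln (d 2) = 0 \<and> ln (d 3) = 0 \<and> ln (d 4) = 0 \<and> ln (d 5) = 0 \<and> ln (d 6) = 0
      \<and> ln (d 7) = 0 \<and> ln (d 8) = 0"
    by linarith
  then have "\<forall>j. ln (d j) = 0" by (simp only: forall_8)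
  then have "d j = 1" for j using d(2) [of j] ln_eq_zero_iff by blast
  then show ?thesis using d(1) by (intro matrix_eq_axis) simp
qed

text \<open>Coordinates 4, 6, 7, 8 of an image are read off by inserting three of the diagonalised
  axes into the form. This removes all off-diagonal entries except those in row 5 and makes the
  remaining diagonal entries positive.\<close>

lemma partly_diagonal_preserves_cayley:
  assumes A: "preserves_cayley A"
    and d: "\<And>j. j \<in> {1, 2, 3, 5} \<Longrightarrow> A *v axis j 1 = d j *\<^sub>R axis j 1 \<and> d j \<ge> 0"
    and s: "\<And>w. supported {4,5,6,7,8} w \<Longrightarrow> supported {4,5,6,7,8} (A *v w)"
  shows "A = mat 1"
proof -
  have inv: "cayley_form (A *v v) (A *v w) (A *v x) (A *v y) = cayley_form v w x y" for v w x y
    using A by (simp add: preserves_cayley_def)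
  have n: "d 1 * d 2 * d 3 * (A *v x) $ 4 = x $ 4" "d 1 * d 2 * d 5 * (A *v x) $ 6 = x $ 6"
    "d 1 * d 3 * d 5 * (A *v x) $ 7 = x $ 7" "d 2 * d 3 * d 5 * (A *v x) $ 8 = x $ 8" for x
    using inv [of "axis 1 1" "axis 2 1" "axis 3 1" x] inv [of "axis 1 1" "axis 2 1" "axis 5 1" x]
      inv [of "axis 1 1" "axis 3 1" "axis 5 1" x] inv [of "axis 2 1" "axis 3 1" "axis 5 1" x]
    by (simp_all add: d cayley_form_scaleR cayley_form_axes mult_ac)
  have nz: "d 1 \<noteq> 0" "d 2 \<noteq> 0" "d 3 \<noteq> 0" "d 5 \<noteq> 0"
    using n(1) [of "axis 4 1"] n(4) [of "axis 8 1"] by auto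
  have pos: "d 1 > 0" "d 2 > 0" "d 3 > 0" "d 5 > 0" using nz d by (auto simp: less_le)
  define e where "e j = A *v axis j 1" for j
  have de: "e 1 = d 1 *\<^sub>R axis 1 1" "e 2 = d 2 *\<^sub>R axis 2 1" "e 3 = d 3 *\<^sub>R axis 3 1" "e 5 = d 5 *\<^sub>R axis 5 1"
    using d by (simp_all add: e_def)
  have sup: "e j $ 1 = 0 \<and> e j $ 2 = 0 \<and> e j $ 3 = 0" if "j \<in> {4,5,6,7,8}" for j
    using s [of "axis j 1"] that by (auto simp: e_def supported_def axis_component)
  have off: "e 4 $ 6 = 0" "e 4 $ 7 = 0" "e 4 $ 8 = 0" "e 6 $ 4 = 0" "e 6 $ 7 = 0" "e 6 $ 8 = 0"
    "e 7 $ 4 = 0" "e 7 $ 6 = 0" "e 7 $ 8 = 0" "e 8 $ 4 = 0" "e 8 $ 6 = 0" "e 8 $ 7 = 0"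
    using n [of "axis 4 1"] n [of "axis 6 1"] n [of "axis 7 1"] n [of "axis 8 1"] nz
    by (auto simp: e_def axis_component)
  have diag: "e 4 $ 4 > 0" "e 6 $ 6 > 0" "e 7 $ 7 > 0" "e 8 $ 8 > 0"
  proof -
    have *: "x > 0" if "y * x = 1" "y > 0" for x y :: real
      using that by (metis zero_less_mult_pos zero_less_one)
    show "e 4 $ 4 > 0" by (rule * [of "d 1 * d 2 * d 3"]) (use n(1) [of "axis 4 1"] pos in \<open>simp_all add: e_def\<close>)
    show "e 6 $ 6 > 0" by (rule * [of "d 1 * d 2 * d 5"]) (use n(2) [of "axis 6 1"] pos in \<open>simp_all add: e_def\<close>)
    show "e 7 $ 7 > 0" by (rule * [of "d 1 * d 3 * d 5"]) (use n(3) [of "axis 7 1"] pos in \<open>simp_all add: e_def\<close>)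
    show "e 8 $ 8 > 0" by (rule * [of "d 2 * d 3 * d 5"]) (use n(4) [of "axis 8 1"] pos in \<open>simp_all add: e_def\<close>)
  qed
  have two: "cayley_form (axis 1 1) (axis 2 1) (e j) (e k) = 0"
    if "cayley_form (axis 1 1) (axis 2 1) (axis j 1) (axis k 1) = 0" for j k
    using inv [of "axis 1 1" "axis 2 1" "axis j 1" "axis k 1"] that nz
    by (simp add: d cayley_form_scaleR e_def)
  have three: "cayley_form (axis 1 1) (axis 3 1) (e j) (e k) = 0"
    if "cayley_form (axis 1 1) (axis 3 1) (axis j 1) (axis k 1) = 0" for j k
    using inv [of "axis 1 1" "axis 3 1" "axis j 1" "axis k 1"] that nz
    by (simp add: d cayley_form_scaleR e_def)
  \<comment> \<open>Row 5 is reached by inserting only two axes: the surviving term is the unknown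
    entry times a nonzero diagonal entry.\<close>
  have off5: "e 4 $ 5 = 0" "e 6 $ 5 = 0" "e 7 $ 5 = 0" "e 8 $ 5 = 0"
    using two [of 4 6] three [of 6 7] two [of 7 6] two [of 8 6] diag sup [of 6] sup [of 7] sup [of 4] sup [of 8]
    by (auto simp: cayley_form_two_axes off axis_component)
  define d' where "d' j = e j $ j" for j
  have "\<forall>j. e j = d' j *\<^sub>R axis j 1"
    unfolding forall_8 using sup [of 4] sup [of 6] sup [of 7] sup [of 8] off off5
    by (simp add: d'_def vec_eq_iff forall_8 axis_component de)
  moreover have "\<forall>j. d' j > 0"
    unfolding forall_8 using pos diag by (simp add: d'_def de)
  ultimately show ?thesis using diagonal_preserves_cayley [OF A, of d'] unfolding e_def by blast
qed

section \<open>Singular value decomposition by rotations in the stabiliser\<close>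

context rot_monoid
begin

lemma fixers_mono: "S \<subseteq> T \<Longrightarrow> fixers S \<subseteq> fixers T"
  by (auto simp: fixers_def)

text \<open>Preservation of the norm fixes the remaining coefficient up to sign; a half turn with
  \<open>c $ s = 1\<close> corrects a negative one.\<close>

lemma moves_align:
  assumes "moves S T {s}" "adm m c" "c $ s = 1" "\<forall>j. j \<notin> S \<longrightarrow> c $ j = 0" "supported T w"
  shows "\<exists>k\<in>fixers S. k *v w = norm w *\<^sub>R axis s 1"
proof -
  have m: "m \<noteq> 1" and cs: "c $ sg m i = - c $ i" for i using assms(2) by (auto simp: adm_def)
  obtain k where k: "k \<in> fixers S" "supported {s} (k *v w)"
    using assms(1,5) unfolding moves_def by blast
  define a where "a = (k *v w) $ s"
  have a: "k *v w = a *\<^sub>R axis s 1" using supported_singleton [OF k(2)] by (simp add: a_def)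
  have "norm w = norm (k *v w)" using k(1) by (simp add: fixers_def orthogonal_matrix_norm)
  then have na: "norm w = \<bar>a\<bar>" by (simp add: a)
  show ?thesis
  proof (cases "a \<ge> 0")
    case True
    with na a k(1) show ?thesis by auto
  next
    case False
    have "(rot m c pi *v axis s 1) $ i = (- axis s 1) $ i" for i
    proof (cases "i = s \<or> i = sg m s")
      case True
      then show ?thesis using assms(3) m cs [of s] by (auto simp: rot_mult [OF m] axis_component)
    next
      case False
      then have "sg m i \<noteq> s" using sg_sg by metis
      then show ?thesis using False by (simp add: rot_mult [OF m] axis_component)
    qed
    then have "rot m c pi *v axis s 1 = - axis s 1" unfolding vec_eq_iff by blast
    then have "(rot m c pi ** k) *v w = norm w *\<^sub>R axis s 1"
      using False na a by (simp add: mv.scaleR_right flip: matrix_vector_mul_assoc)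
    then show ?thesis using fixers_mult rot_in_fixers [OF assms(2,4)] k(1) by blast
  qed
qed

text \<open>
  One step of a singular value decomposition: where the norm of \<open>A w\<close> is maximal on the unit sphere,
  orthogonal vectors have orthogonal images.
\<close>

lemma singular_step:
  assumes align: "\<And>w. supported S w \<Longrightarrow> \<exists>k\<in>fixers S. k *v w = norm w *\<^sub>R axis s 1"
    and s: "s \<in> S" and A: "\<And>w. supported S w \<Longrightarrow> supported S (A *v w)"
  shows "\<exists>k\<in>fixers S. \<exists>k'\<in>fixers S. \<exists>l\<ge>0. (k ** A ** k') *v axis s 1 = l *\<^sub>R axis s 1 \<and>
    (\<forall>w. supported (S - {s}) w \<longrightarrow> supported (S - {s}) ((k ** A ** k') *v w))"
proof -
  let ?M = "sphere 0 1 \<inter> {w. supported S w}"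
  have "closed {w. supported S w}"
  proof -
    have "{w. supported S w} = (\<Inter>i\<in>-S. {w. w $ i = 0})" by (auto simp: supported_def)
    then show ?thesis by (auto intro!: closed_INT closed_Collect_eq continuous_on_component continuous_on_id continuous_on_const)
  qed
  then have "compact ?M" by (intro compact_Int_closed) auto
  moreover have "axis s 1 \<in> ?M" using s by (auto simp: supported_def axis_component)
  moreover have "continuous_on ?M (\<lambda>w. norm (A *v w))"
    by (intro continuous_intros mv.continuous_on)
  ultimately obtain w where w: "w \<in> ?M" "\<And>v. v \<in> ?M \<Longrightarrow> norm (A *v v) \<le> norm (A *v w)"
    using continuous_attains_sup [of ?M] by blast
  define l where "l = norm (A *v w)"
  have bound: "norm (A *v v) \<le> l * norm v" if "supported S v" for v
  proof (cases "v = 0")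
    case False
    then have "norm (A *v (v /\<^sub>R norm v)) \<le> l"
      unfolding l_def using that by (intro w(2)) (auto simp: supported_def)
    then show ?thesis using False by (simp add: mv.scaleR_right field_simps)
  qed simp
  obtain k where k: "k \<in> fixers S" "k *v (A *v w) = l *\<^sub>R axis s 1"
    using align A w(1) unfolding l_def by blast
  obtain k0 where k0: "k0 \<in> fixers S" "k0 *v w = axis s 1"
    using align w(1) by fastforce
  define k' where "k' = transpose k0"
  have k': "k' \<in> fixers S" "k' *v axis s 1 = w"
    using fixers_transpose [OF k0(1)] k0
    by (simp_all add: k'_def fixers_def orthogonal_matrix_def matrix_vector_mul_assoc flip: k0(2))
  define B where "B = k ** A ** k'"
  have Bv: "B *v v = k *v (A *v (k' *v v))" for v
    by (simp add: B_def matrix_vector_mul_assoc matrix_mul_assoc)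
  have norm: "norm (g *v v) = norm v" if "g \<in> fixers S" for g v
    using that by (simp add: fixers_def orthogonal_matrix_norm)
  have Bs: "B *v axis s 1 = l *\<^sub>R axis s 1" by (simp add: Bv k'(2) k(2))
  have Bb: "norm (B *v v) \<le> l * norm v" if "supported S v" for v
    using bound [OF fixers_supported [OF k'(1) that]] by (simp add: Bv norm k(1) k'(1))
  have sup: "supported (S - {s}) (B *v v)" if v: "supported (S - {s}) v" for v
  proof -
    have vS: "supported S v" "v $ s = 0" using v by (auto simp: supported_def)
    have "supported S (B *v v)"
      unfolding Bv by (intro fixers_supported [OF k(1)] A fixers_supported [OF k'(1)] vS)
    moreover have "(B *v v) $ s = 0"
    proof (rule ccontr)
      define q where "q = (B *v v) $ s"
      assume "(B *v v) $ s \<noteq> 0"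
      then have q: "q \<noteq> 0" by (simp add: q_def)
      have "v \<noteq> 0" using q by (auto simp: q_def)
      have key: "2 * t * l * q + t\<^sup>2 * (norm (B *v v))\<^sup>2 \<le> l\<^sup>2 * t\<^sup>2 * (norm v)\<^sup>2" for t
      proof -
        let ?u = "axis s 1 + t *\<^sub>R v"
        have "supported S ?u" using vS s by (auto simp: supported_def axis_component)
        from Bb [OF this] have "(norm (B *v ?u))\<^sup>2 \<le> l\<^sup>2 * (norm ?u)\<^sup>2"
          by (metis norm_ge_zero power_mono power_mult_distrib)
        moreover have "(norm (B *v ?u))\<^sup>2 = l\<^sup>2 + 2 * t * l * q + t\<^sup>2 * (norm (B *v v))\<^sup>2"
          using norm_axis_combination [of l s t "B *v v"]
          by (simp add: matrix_vector_right_distrib mv.scaleR_right Bs q_def)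
        moreover have "(norm ?u)\<^sup>2 = 1 + t\<^sup>2 * (norm v)\<^sup>2"
          using norm_axis_combination [of 1 s t v] vS(2) by simp
        ultimately show ?thesis by (simp add: algebra_simps)
      qed
      show False
      proof (cases "l = 0")
        case True
        with Bb [OF vS(1)] q show False by (simp add: q_def)
      next
        case False
        then have l: "l > 0" by (simp add: l_def)
        \<comment> \<open>At this \<open>t\<close> the linear term equals
          \<open>2 * q\<^sup>2 / (norm v)\<^sup>2\<close>, twice the bound on the right of
          \<open>key\<close>.\<close>
        define t where "t = q / (l * (norm v)\<^sup>2)"
        have nv: "(norm v)\<^sup>2 > 0" using \<open>v \<noteq> 0\<close> by simp
        have "2 * t * l * q \<le> l\<^sup>2 * t\<^sup>2 * (norm v)\<^sup>2"
          using key [of t] by (smt (verit) mult_nonneg_nonneg zero_le_power2)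
        moreover have "2 * t * l * q = 2 * (q\<^sup>2 / (norm v)\<^sup>2)"
          using l by (simp add: t_def power2_eq_square)
        moreover have "l\<^sup>2 * t\<^sup>2 * (norm v)\<^sup>2 = q\<^sup>2 / (norm v)\<^sup>2"
          using l nv by (simp add: t_def power2_eq_square)
        moreover have "q\<^sup>2 / (norm v)\<^sup>2 > 0" using q nv by simp
        ultimately show False by linarith
      qed
    qed
    ultimately show ?thesis by (auto simp: supported_def)
  qed
  have "l \<ge> 0" by (simp add: l_def)
  then show ?thesis using k(1) k'(1) Bs sup unfolding B_def by blast
qed

text \<open>After axes 1, 2, 3 are diagonalised, one more rotation aligns the image of axis 5. The
  result satisfies the rigidity lemma, so it is the identity, and undoing the factors exhibits
  \<open>A\<close> as a product in \<open>H\<close>.\<close>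

lemma contains_preservers:
  assumes A: "preserves_cayley A"
  shows "A \<in> H"
proof -
  have al1: "supported UNIV w \<Longrightarrow> \<exists>k\<in>fixers UNIV. k *v w = norm w *\<^sub>R axis 1 1" for w
    by (rule moves_align [OF moves_1, of 2 "vector [1, -1, -1, 1, 0, 0, 0, 0]"])
      (simp_all add: adm_def forall_8 inner_8)
  have al2: "supported (- {1}) w \<Longrightarrow> \<exists>k\<in>fixers (- {1}). k *v w = norm w *\<^sub>R axis 2 1" for w
    by (rule moves_align [OF moves_2, of 4 "vector [0, 1, -1, 0, 0, 1, -1, 0]"])
      (simp_all add: adm_def forall_8 inner_8)
  have al3: "supported (- {1,2}) w \<Longrightarrow> \<exists>k\<in>fixers (- {1,2}). k *v w = norm w *\<^sub>R axis 3 1" for w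
    by (rule moves_align [OF moves_3, of 2 "vector [0, 0, 1, -1, -1, 1, 0, 0]"])
      (simp_all add: adm_def forall_8 inner_8)
  have al4: "supported {5,6,7,8} w \<Longrightarrow> \<exists>k\<in>fixers {5,6,7,8}. k *v w = norm w *\<^sub>R axis 5 1" for w
    by (rule moves_align [OF moves_4, of 2 "vector [0, 0, 0, 0, 1, -1, -1, 1]"])
      (simp_all add: adm_def forall_8 inner_8)
  have m1: "supported UNIV w \<Longrightarrow> supported UNIV (A *v w)" for w
    by (simp add: supported_def)
  obtain k1 k1' l1 where 1: "k1 \<in> fixers UNIV" "k1' \<in> fixers UNIV" "l1 \<ge> 0"
    "(k1 ** A ** k1') *v axis 1 1 = l1 *\<^sub>R axis 1 1"
    "\<And>w. supported (UNIV - {1}) w \<Longrightarrow> supported (UNIV - {1}) ((k1 ** A ** k1') *v w)"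
    using singular_step [OF al1 UNIV_I m1] by blast
  define B1 where "B1 = k1 ** A ** k1'"
  have i2: "2 \<in> - {1 :: 8}" and i3: "3 \<in> - {1, 2 :: 8}" by simp_all
  have m2: "supported (- {1}) w \<Longrightarrow> supported (- {1}) (B1 *v w)" for w
    using 1(5) by (simp add: B1_def Compl_eq_Diff_UNIV)
  obtain k2 k2' l2 where 2: "k2 \<in> fixers (- {1})" "k2' \<in> fixers (- {1})" "l2 \<ge> 0"
    "(k2 ** B1 ** k2') *v axis 2 1 = l2 *\<^sub>R axis 2 1"
    "\<And>w. supported (- {1} - {2}) w \<Longrightarrow> supported (- {1} - {2}) ((k2 ** B1 ** k2') *v w)"
    using singular_step [OF al2 i2 m2] by blast
  define B2 where "B2 = k2 ** B1 ** k2'"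
  have s12: "- {1} - {2} = (- {1,2} :: 8 set)" by auto
  have m3: "supported (- {1,2}) w \<Longrightarrow> supported (- {1,2}) (B2 *v w)" for w
    using 2(5) s12 by (simp add: B2_def)
  obtain k3 k3' l3 where 3: "k3 \<in> fixers (- {1,2})" "k3' \<in> fixers (- {1,2})" "l3 \<ge> 0"
    "(k3 ** B2 ** k3') *v axis 3 1 = l3 *\<^sub>R axis 3 1"
    "\<And>w. supported (- {1,2} - {3}) w \<Longrightarrow> supported (- {1,2} - {3}) ((k3 ** B2 ** k3') *v w)"
    using singular_step [OF al3 i3 m3] by blast
  define B3 where "B3 = k3 ** B2 ** k3'"
  have s123: "- {1,2} - {3} = ({4,5,6,7,8} :: 8 set)" using UNIV_8 by auto
  have B3: "B3 *v axis 1 1 = l1 *\<^sub>R axis 1 1" "B3 *v axis 2 1 = l2 *\<^sub>R axis 2 1" "B3 *v axis 3 1 = l3 *\<^sub>R axis 3 1"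
    using 1(4) 2(1,2,4) 3(1,2,4)
    by (simp_all add: B3_def B2_def fixers_def mv.scaleR_right flip: B1_def matrix_vector_mul_assoc)
  have B3s: "supported {4,5,6,7,8} (B3 *v w)" if "supported {4,5,6,7,8} w" for w
    using 3(5) that by (simp add: s123 B3_def)
  have H1: "k1 \<in> H" "k1' \<in> H" "k2 \<in> H" "k2' \<in> H" "k3 \<in> H" "k3' \<in> H"
    using 1 2 3 by (simp_all add: fixers_def)
  have mulp: "preserves_cayley (P ** Q)" if "preserves_cayley P" "preserves_cayley Q" for P Q
    using that by (simp add: preserves_cayley_mult_iff)
  have pB3: "preserves_cayley B3"
    unfolding B3_def B2_def B1_def by (intro mulp preserves H1 A)
  \<comment> \<open>Axis 4 is the triple cross product of axes 1, 2, 3. So the image of axis 5 has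
    no fourth component and can be aligned without disturbing the first four axes.\<close>
  have four: "l1 * l2 * l3 * (B3 *v x) $ 4 = x $ 4" for x
  proof -
    have "cayley_form (B3 *v axis 1 1) (B3 *v axis 2 1) (B3 *v axis 3 1) (B3 *v x)
        = cayley_form (axis 1 1) (axis 2 1) (axis 3 1) x"
      using pB3 by (simp add: preserves_cayley_def)
    then show ?thesis by (simp add: B3 cayley_form_scaleR cayley_form_axes mult_ac)
  qed
  have l123: "l1 * l2 * l3 \<noteq> 0" using four [of "axis 4 1"] by auto
  have s5: "supported {5,6,7,8} (B3 *v axis 5 1)"
  proof -
    have "supported {4,5,6,7,8} (B3 *v axis 5 1)" by (rule B3s) (simp add: supported_def axis_component)
    moreover have "(B3 *v axis 5 1) $ 4 = 0" using four [of "axis 5 1"] l123 by (simp add: axis_component)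
    ultimately show ?thesis unfolding supported_def by (metis insert_iff)
  qed
  obtain k4 where 4: "k4 \<in> fixers {5,6,7,8}" "k4 *v (B3 *v axis 5 1) = norm (B3 *v axis 5 1) *\<^sub>R axis 5 1"
    using al4 [OF s5] by blast
  define B where "B = k4 ** B3"
  have k4: "k4 *v axis j 1 = axis j 1" if "j \<in> {1,2,3,4}" for j
    using 4(1) that by (auto simp: fixers_def)
  have "B = mat 1"
  proof (rule partly_diagonal_preserves_cayley)
    show "preserves_cayley B"
      unfolding B_def using 4(1) by (intro mulp preserves pB3) (simp add: fixers_def)
    let ?d = "\<lambda>j. if j = 1 then l1 else if j = 2 then l2 else if j = 3 then l3 else norm (B3 *v axis 5 1)"
    show "B *v axis j 1 = ?d j *\<^sub>R axis j 1 \<and> ?d j \<ge> 0" if "j \<in> {1,2,3,5}" for j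
      using that 1(3) 2(3) 3(3)
      by (auto simp: B_def B3 4(2) k4 mv.scaleR_right simp flip: matrix_vector_mul_assoc)
    show "supported {4,5,6,7,8} (B *v w)" if "supported {4,5,6,7,8} w" for w
      unfolding B_def using B3s [OF that] fixers_supported [of k4 "{4,5,6,7,8}"] fixers_mono [of "{5,6,7,8}" "{4,5,6,7,8}"] 4(1)
      by (auto simp flip: matrix_vector_mul_assoc)
  qed
  \<comment> \<open>Transposes of fixers are their inverses and lie in \<open>H\<close>, so both
    factors cancel inside the monoid.\<close>
  have unwrap: "Q \<in> H" if "k \<in> fixers S" "k' \<in> fixers S" "k ** Q ** k' \<in> H" for k k' Q S
  proof -
    have "transpose k ** (k ** Q ** k') ** transpose k' = Q"
      using that(1,2) by (simp add: fixers_def orthogonal_matrix_def matrix_mul_assoc)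
        (simp add: fixers_def orthogonal_matrix_def flip: matrix_mul_assoc)
    moreover have "transpose k \<in> H" "transpose k' \<in> H" using that by (simp_all add: fixers_def)
    ultimately show ?thesis using that(3) mult_mem by metis
  qed
  have one: "mat 1 \<in> fixers S" for S by (simp add: fixers_def one_mem orthogonal_matrix_id)
  have "B3 \<in> H"
    by (rule unwrap [OF 4(1) one]) (use \<open>B = mat 1\<close> one_mem in \<open>simp add: B_def\<close>)
  then have "B2 \<in> H" unfolding B3_def by (rule unwrap [OF 3(1,2)])
  then have "B1 \<in> H" unfolding B2_def by (rule unwrap [OF 2(1,2)])
  then show "A \<in> H" unfolding B1_def by (rule unwrap [OF 1(1,2)])
qed

end

section \<open>Generating the Lie algebra\<close>

text \<open>
  \<open>gen m (lc r s t m)\<close> is the connection form in direction \<open>m\<close> for the structure equations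
  \<open>d\<theta>\<^sub>a = (r + s + t) / 2 \<theta>\<^sub>1\<^sub>a\<close> for \<open>a \<ge> 5\<close>, \<open>d\<theta>\<^sub>2 = r (- \<theta>\<^sub>1\<^sub>2 + \<theta>\<^sub>5\<^sub>6 + \<theta>\<^sub>7\<^sub>8)\<close>,
  \<open>d\<theta>\<^sub>3 = s (- \<theta>\<^sub>1\<^sub>3 + \<theta>\<^sub>5\<^sub>7 - \<theta>\<^sub>6\<^sub>8)\<close>, \<open>d\<theta>\<^sub>4 = t (- \<theta>\<^sub>1\<^sub>4 - \<theta>\<^sub>5\<^sub>8 - \<theta>\<^sub>6\<^sub>7)\<close>.
\<close>

definition lc :: "real \<Rightarrow> real \<Rightarrow> real \<Rightarrow> 8 \<Rightarrow> real^8" where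
  "lc r s t m = (let h = (r + s + t) / 2 in
    vector [0,
      vector [r, - r, 0, 0, - r / 2, r / 2, - r / 2, r / 2],
      vector [s, 0, - s, 0, - s / 2, s / 2, s / 2, - s / 2],
      vector [t, 0, 0, - t, t / 2, t / 2, - t / 2, - t / 2],
      vector [- h, - r / 2, - s / 2, t / 2, h, r / 2, s / 2, - t / 2],
      vector [- h, r / 2, s / 2, t / 2, - r / 2, h, - t / 2, - s / 2],
      vector [- h, - r / 2, s / 2, - t / 2, - s / 2, t / 2, h, r / 2],
      vector [- h, r / 2, - s / 2, - t / 2, t / 2, s / 2, - r / 2, h]] :: real^8^8) $ m"

lemma lc_simps:
  "lc r s t 2 = vector [r, - r, 0, 0, - r / 2, r / 2, - r / 2, r / 2]"
  "lc r s t 3 = vector [s, 0, - s, 0, - s / 2, s / 2, s / 2, - s / 2]"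
  "lc r s t 4 = vector [t, 0, 0, - t, t / 2, t / 2, - t / 2, - t / 2]"
  "lc r s t 5 = vector [- ((r + s + t) / 2), - r / 2, - s / 2, t / 2, (r + s + t) / 2, r / 2, s / 2, - t / 2]"
  "lc r s t 6 = vector [- ((r + s + t) / 2), r / 2, s / 2, t / 2, - r / 2, (r + s + t) / 2, - t / 2, - s / 2]"
  "lc r s t 7 = vector [- ((r + s + t) / 2), - r / 2, s / 2, - t / 2, - s / 2, t / 2, (r + s + t) / 2, r / 2]"
  "lc r s t 8 = vector [- ((r + s + t) / 2), r / 2, - s / 2, - t / 2, t / 2, s / 2, - r / 2, (r + s + t) / 2]"
  by (simp_all add: lc_def Let_def)

lemma adm_lc: "m \<noteq> 1 \<Longrightarrow> adm m (lc r s t m)"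
proof -
  have "\<forall>m. m \<noteq> 1 \<longrightarrow> adm m (lc r s t m)"
    by (simp add: forall_8 adm_def inner_8 lc_simps field_simps)
  then show "m \<noteq> 1 \<Longrightarrow> adm m (lc r s t m)" by blast
qed

lemma gen_linear:
  "gen m (c + d) = gen m c + gen m d" "gen m (r *\<^sub>R c) = r *\<^sub>R gen m c"
  by (simp_all add: gen_def vec_eq_iff)

text \<open>The blocks grade the matrices by the group of bit vectors under exclusive or: a bracket
  of blocks \<open>a\<close> and \<open>b\<close> lies in the block of their composite.\<close>

lemma gen_commutator:
  assumes "\<forall>i. sg b (sg a i) = sg p i" "\<forall>i. sg a (sg b i) = sg p i"
  shows "gen a c ** gen b d - gen b d ** gen a c = gen p (\<chi> i. c $ i * d $ sg a i - d $ i * c $ sg b i)"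
  by (simp add: matrix_eq vec_eq_iff matrix_vector_mult_diff_rdistrib assms algebra_simps
      flip: matrix_vector_mul_assoc)

text \<open>
  For each \<open>m\<close> the admissible generators form a space of dimension 3, with a basis chosen among
  \<open>gen m (lc 1 1 1 m)\<close> and the commutators of the \<open>gen a (lc 1 1 1 a)\<close>, \<open>gen b (lc 1 1 1 b)\<close> with \<open>sg a \<circ> sg b = sg m\<close>.
\<close>

lemma generated_subspace:
  assumes T: "subspace T"
    and M: "\<And>m. m \<noteq> 1 \<Longrightarrow> gen m (lc 1 1 1 m) \<in> T"
    and ad: "\<And>m X. m \<noteq> 1 \<Longrightarrow> X \<in> T \<Longrightarrow> gen m (lc 1 1 1 m) ** X - X ** gen m (lc 1 1 1 m) \<in> T"
    and c: "adm m c"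
  shows "gen m c \<in> T"
proof -
  have br: "gen p e \<in> T" if "a \<noteq> 1" "b \<noteq> 1" "\<forall>i. sg b (sg a i) = sg p i" "\<forall>i. sg a (sg b i) = sg p i"
    "\<forall>i. e $ i = lc 1 1 1 a $ i * lc 1 1 1 b $ sg a i - lc 1 1 1 b $ i * lc 1 1 1 a $ sg b i" for a b p e
  proof -
    have "e = (\<chi> i. lc 1 1 1 a $ i * lc 1 1 1 b $ sg a i - lc 1 1 1 b $ i * lc 1 1 1 a $ sg b i)"
      using that(5) by (simp add: vec_eq_iff)
    then show ?thesis
      using ad [OF that(1) M [OF that(2)]] gen_commutator [OF that(3,4)] by simp
  qed
  have comb: "gen m (x *\<^sub>R u + y *\<^sub>R v + z *\<^sub>R w) \<in> T" if "gen m u \<in> T" "gen m v \<in> T" "gen m w \<in> T" for m u v w x y z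
    unfolding gen_linear using that T by (intro subspace_add subspace_scale)
  show ?thesis
    using c
  proof (cases rule: adm_cases)
    case 1
    have "gen 2 (vector [1, - 1, 0, 0, - 1/2, 1/2, - 1/2, 1/2]) \<in> T"
      using M [of 2] by (simp add: lc_simps)
    moreover have "gen 2 (vector [0, 0, - 1, 1, 1/2, - 1/2, 1/2, - 1/2]) \<in> T"
      by (rule br [of 3 4]) (simp_all add: forall_8 lc_simps vec_eq_iff)
    moreover have "gen 2 (vector [3/2, - 3/2, 1/2, - 1/2, - 5/2, 5/2, 1/2, - 1/2]) \<in> T"
      by (rule br [of 5 6]) (simp_all add: forall_8 lc_simps vec_eq_iff)
    \<comment> \<open>The coefficients solve the 3 by 3 linear system for the free coordinates
      \<open>c$3\<close>, \<open>c$5\<close>, \<open>c$7\<close>; the other cases are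
      analogous.\<close>
    moreover have "c = ((- 1 * c$3) + (- 1/2 * c$5) + (- 3/2 * c$7)) *\<^sub>R vector [1, - 1, 0, 0, - 1/2, 1/2, - 1/2, 1/2] + ((- 1 * c$3) + (- 1/6 * c$5) + 1/6 * c$7) *\<^sub>R vector [0, 0, - 1, 1, 1/2, - 1/2, 1/2, - 1/2] + ((- 1/3 * c$5) + 1/3 * c$7) *\<^sub>R vector [3/2, - 3/2, 1/2, - 1/2, - 5/2, 5/2, 1/2, - 1/2]"
      by (simp add: vec_eq_iff forall_8 1 field_simps)
    ultimately show ?thesis unfolding 1(1) by (metis comb)
  next
    case 2
    have "gen 3 (vector [1, 0, - 1, 0, - 1/2, 1/2, 1/2, - 1/2]) \<in> T"
      using M [of 3] by (simp add: lc_simps)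
    moreover have "gen 3 (vector [0, - 1, 0, 1, - 1/2, 1/2, 1/2, - 1/2]) \<in> T"
      by (rule br [of 2 4]) (simp_all add: forall_8 lc_simps vec_eq_iff)
    moreover have "gen 3 (vector [3/2, - 1/2, - 3/2, 1/2, - 5/2, - 1/2, 5/2, 1/2]) \<in> T"
      by (rule br [of 5 7]) (simp_all add: forall_8 lc_simps vec_eq_iff)
    moreover have "c = (1 * c$2 + (- 1/2 * c$5) + 3/2 * c$6) *\<^sub>R vector [1, 0, - 1, 0, - 1/2, 1/2, 1/2, - 1/2] + ((- 1 * c$2) + 1/6 * c$5 + 1/6 * c$6) *\<^sub>R vector [0, - 1, 0, 1, - 1/2, 1/2, 1/2, - 1/2] + ((- 1/3 * c$5) + (- 1/3 * c$6)) *\<^sub>R vector [3/2, - 1/2, - 3/2, 1/2, - 5/2, - 1/2, 5/2, 1/2]"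
      by (simp add: vec_eq_iff forall_8 2 field_simps)
    ultimately show ?thesis unfolding 2(1) by (metis comb)
  next
    case 3
    have "gen 4 (vector [1, 0, 0, - 1, 1/2, 1/2, - 1/2, - 1/2]) \<in> T"
      using M [of 4] by (simp add: lc_simps)
    moreover have "gen 4 (vector [0, - 1, 1, 0, - 1/2, - 1/2, 1/2, 1/2]) \<in> T"
      by (rule br [of 2 3]) (simp_all add: forall_8 lc_simps vec_eq_iff)
    moreover have "gen 4 (vector [- 3/2, - 1/2, 1/2, 3/2, - 5/2, 1/2, - 1/2, 5/2]) \<in> T"
      by (rule br [of 5 8]) (simp_all add: forall_8 lc_simps vec_eq_iff)
    moreover have "c = ((- 1 * c$2) + 1/2 * c$5 + 3/2 * c$6) *\<^sub>R vector [1, 0, 0, - 1, 1/2, 1/2, - 1/2, - 1/2] + ((- 1 * c$2) + 1/6 * c$5 + (- 1/6 * c$6)) *\<^sub>R vector [0, - 1, 1, 0, - 1/2, - 1/2, 1/2, 1/2] + ((- 1/3 * c$5) + 1/3 * c$6) *\<^sub>R vector [- 3/2, - 1/2, 1/2, 3/2, - 5/2, 1/2, - 1/2, 5/2]"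
      by (simp add: vec_eq_iff forall_8 3 field_simps)
    ultimately show ?thesis unfolding 3(1) by (metis comb)
  next
    case 4
    \<comment> \<open>From here on the three brackets of blocks 2, 3, 4 with blocks among 5 to 8 are
      already a basis.\<close>
    have "gen 5 (vector [5/4, 7/4, - 1/4, 1/4, - 5/4, - 7/4, 1/4, - 1/4]) \<in> T"
      by (rule br [of 2 6]) (simp_all add: forall_8 lc_simps vec_eq_iff)
    moreover have "gen 5 (vector [5/4, - 1/4, 7/4, 1/4, - 5/4, 1/4, - 7/4, - 1/4]) \<in> T"
      by (rule br [of 3 7]) (simp_all add: forall_8 lc_simps vec_eq_iff)
    moreover have "gen 5 (vector [- 5/4, 1/4, 1/4, 7/4, 5/4, - 1/4, - 1/4, - 7/4]) \<in> T"
      by (rule br [of 4 8]) (simp_all add: forall_8 lc_simps vec_eq_iff)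
    moreover have "c = (3/5 * c$2 + 1/10 * c$3 + (- 1/10 * c$4)) *\<^sub>R vector [5/4, 7/4, - 1/4, 1/4, - 5/4, - 7/4, 1/4, - 1/4] + (1/10 * c$2 + 3/5 * c$3 + (- 1/10 * c$4)) *\<^sub>R vector [5/4, - 1/4, 7/4, 1/4, - 5/4, 1/4, - 7/4, - 1/4] + ((- 1/10 * c$2) + (- 1/10 * c$3) + 3/5 * c$4) *\<^sub>R vector [- 5/4, 1/4, 1/4, 7/4, 5/4, - 1/4, - 1/4, - 7/4]"
      by (simp add: vec_eq_iff forall_8 4 field_simps)
    ultimately show ?thesis unfolding 4(1) by (metis comb)
  next
    case 5
    have "gen 6 (vector [- 5/4, 7/4, - 1/4, - 1/4, - 7/4, 5/4, 1/4, 1/4]) \<in> T"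
      by (rule br [of 2 5]) (simp_all add: forall_8 lc_simps vec_eq_iff)
    moreover have "gen 6 (vector [- 5/4, - 1/4, 7/4, - 1/4, 1/4, 5/4, 1/4, - 7/4]) \<in> T"
      by (rule br [of 3 8]) (simp_all add: forall_8 lc_simps vec_eq_iff)
    moreover have "gen 6 (vector [- 5/4, - 1/4, - 1/4, 7/4, 1/4, 5/4, - 7/4, 1/4]) \<in> T"
      by (rule br [of 4 7]) (simp_all add: forall_8 lc_simps vec_eq_iff)
    moreover have "c = (3/5 * c$2 + 1/10 * c$3 + 1/10 * c$4) *\<^sub>R vector [- 5/4, 7/4, - 1/4, - 1/4, - 7/4, 5/4, 1/4, 1/4] + (1/10 * c$2 + 3/5 * c$3 + 1/10 * c$4) *\<^sub>R vector [- 5/4, - 1/4, 7/4, - 1/4, 1/4, 5/4, 1/4, - 7/4] + (1/10 * c$2 + 1/10 * c$3 + 3/5 * c$4) *\<^sub>R vector [- 5/4, - 1/4, - 1/4, 7/4, 1/4, 5/4, - 7/4, 1/4]"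
      by (simp add: vec_eq_iff forall_8 5 field_simps)
    ultimately show ?thesis unfolding 5(1) by (metis comb)
  next
    case 6
    have "gen 7 (vector [5/4, 7/4, 1/4, - 1/4, - 1/4, 1/4, - 5/4, - 7/4]) \<in> T"
      by (rule br [of 2 8]) (simp_all add: forall_8 lc_simps vec_eq_iff)
    moreover have "gen 7 (vector [- 5/4, 1/4, 7/4, 1/4, - 7/4, - 1/4, 5/4, - 1/4]) \<in> T"
      by (rule br [of 3 5]) (simp_all add: forall_8 lc_simps vec_eq_iff)
    moreover have "gen 7 (vector [5/4, - 1/4, 1/4, 7/4, - 1/4, - 7/4, - 5/4, 1/4]) \<in> T"
      by (rule br [of 4 6]) (simp_all add: forall_8 lc_simps vec_eq_iff)
    moreover have "c = (3/5 * c$2 + (- 1/10 * c$3) + 1/10 * c$4) *\<^sub>R vector [5/4, 7/4, 1/4, - 1/4, - 1/4, 1/4, - 5/4, - 7/4] + ((- 1/10 * c$2) + 3/5 * c$3 + (- 1/10 * c$4)) *\<^sub>R vector [- 5/4, 1/4, 7/4, 1/4, - 7/4, - 1/4, 5/4, - 1/4] + (1/10 * c$2 + (- 1/10 * c$3) + 3/5 * c$4) *\<^sub>R vector [5/4, - 1/4, 1/4, 7/4, - 1/4, - 7/4, - 5/4, 1/4]"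
      by (simp add: vec_eq_iff forall_8 6 field_simps)
    ultimately show ?thesis unfolding 6(1) by (metis comb)
  next
    case 7
    have "gen 8 (vector [- 5/4, 7/4, 1/4, 1/4, - 1/4, - 1/4, - 7/4, 5/4]) \<in> T"
      by (rule br [of 2 7]) (simp_all add: forall_8 lc_simps vec_eq_iff)
    moreover have "gen 8 (vector [5/4, 1/4, 7/4, - 1/4, 1/4, - 7/4, - 1/4, - 5/4]) \<in> T"
      by (rule br [of 3 6]) (simp_all add: forall_8 lc_simps vec_eq_iff)
    moreover have "gen 8 (vector [5/4, 1/4, - 1/4, 7/4, - 7/4, 1/4, - 1/4, - 5/4]) \<in> T"
      by (rule br [of 4 5]) (simp_all add: forall_8 lc_simps vec_eq_iff)
    moreover have "c = (3/5 * c$2 + (- 1/10 * c$3) + (- 1/10 * c$4)) *\<^sub>R vector [- 5/4, 7/4, 1/4, 1/4, - 1/4, - 1/4, - 7/4, 5/4] + ((- 1/10 * c$2) + 3/5 * c$3 + 1/10 * c$4) *\<^sub>R vector [5/4, 1/4, 7/4, - 1/4, 1/4, - 7/4, - 1/4, - 5/4] + ((- 1/10 * c$2) + 1/10 * c$3 + 3/5 * c$4) *\<^sub>R vector [5/4, 1/4, - 1/4, 7/4, - 7/4, 1/4, - 1/4, - 5/4]"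
      by (simp add: vec_eq_iff forall_8 7 field_simps)
    ultimately show ?thesis unfolding 7(1) by (metis comb)

  qed
qed

theorem (in matrix_monoid) contains_stabiliser:
  assumes pres: "\<And>A. A \<in> H \<Longrightarrow> preserves_cayley A"
    and M: "\<And>m. m \<noteq> 1 \<Longrightarrow> gen m (lc 1 1 1 m) \<in> curve_tangents H"
    and ad: "\<And>m X. m \<noteq> 1 \<Longrightarrow> X \<in> curve_tangents H \<Longrightarrow>
      gen m (lc 1 1 1 m) ** X - X ** gen m (lc 1 1 1 m) \<in> curve_tangents H"
    and A: "preserves_cayley A"
  shows "A \<in> H"
proof -
  obtain d where d: "d > 0" "\<And>A. preserves_cayley A \<Longrightarrow> dist (mat 1) A < d \<Longrightarrow> A \<in> H"
    using neighbourhood_of_one [OF pres generated_subspace [OF subspace_curve_tangents M ad]] by blast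
  interpret rot_monoid H
    by unfold_locales (use rot_mem [OF d] pres in blast)+
  show ?thesis by (rule contains_preservers [OF A])
qed

section \<open>Parallel transport in a moving coframe\<close>

lemma linear_basis_expansion:
  fixes F :: "'a::euclidean_space \<Rightarrow> 'b::real_vector"
  assumes "linear F"
  shows "F v = (\<Sum>b\<in>Basis. (v \<bullet> b) *\<^sub>R F b)"
proof -
  have "F v = F (\<Sum>b\<in>Basis. (v \<bullet> b) *\<^sub>R b)" by (simp only: euclidean_representation)
  also have "\<dots> = (\<Sum>b\<in>Basis. (v \<bullet> b) *\<^sub>R F b)"
    by (simp only: linear_sum [OF assms] linear_scale [OF assms])
  finally show ?thesis .
qed

lemma has_vector_derivative_eventually_eq:
  assumes "(f has_vector_derivative f') (at x)" "\<forall>\<^sub>F s in nhds x. f s = g s"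
  shows "(g has_vector_derivative f') (at x)"
  using assms has_vector_derivative_cong_ev [of UNIV f g x f'] eventually_nhds_x_imp_x [OF assms(2)]
  by simp

section \<open>Piecewise continuously differentiable paths\<close>

lemma piecewise_C1_path_continuous:
  assumes "piecewise_C1_path \<gamma>"
  shows "continuous_on {0..1} \<gamma>"
proof -
  obtain n t where t: "t 0 = 0" "t n = 1" and
    piece: "\<And>i. i < n \<Longrightarrow> t i < t (Suc i) \<and>
          (\<exists>c. continuous_on {t i..t (Suc i)} c \<and>
            (\<forall>s\<in>{t i..t (Suc i)}. (\<gamma> has_vector_derivative c s) (at s within {t i..t (Suc i)})))"
    using assms unfolding piecewise_C1_path_def by blast
  have "0 \<le> t k \<and> continuous_on {0..t k} \<gamma>" if "k \<le> n" for k
    using that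
  proof (induction k)
    case (Suc k)
    have "continuous_on {t k..t (Suc k)} \<gamma>"
      using piece [of k] Suc.prems
      by (meson Suc_le_eq continuous_on_eq_continuous_within has_vector_derivative_continuous)
    moreover have "{0..t (Suc k)} = {0..t k} \<union> {t k..t (Suc k)}"
      using Suc piece [of k] by auto
    ultimately show ?case
      using Suc piece [of k] by (simp add: continuous_on_closed_Un)
  qed (simp add: t)
  from this [of n] t show ?thesis by simp
qed

lemma piecewise_C1_path_linepath: "piecewise_C1_path (linepath a b)"
  unfolding piecewise_C1_path_def
  by (rule exI [of _ 1], rule exI [of _ real])
    (auto intro!: exI [of _ "\<lambda>_. b - a"] has_vector_derivative_linepath_within)

lemma joinpaths_left: "t \<le> 1/2 \<Longrightarrow> (f +++ g) t = f (2 * t)"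
  by (simp add: joinpaths_def)

lemma joinpaths_right: "f 1 = g 0 \<Longrightarrow> 1/2 \<le> t \<Longrightarrow> (f +++ g) t = g (2 * t - 1)"
  by (cases "2 * t = 1") (auto simp: joinpaths_def)

lemma affine_reparametrisation:
  fixes f :: "real \<Rightarrow> 'a::real_normed_vector"
  assumes "(f has_vector_derivative c) (at (2 * s + d) within (\<lambda>s. 2 * s + d) ` T)"
    and "s \<in> T" "\<And>s. s \<in> T \<Longrightarrow> g s = f (2 * s + d)"
  shows "(g has_vector_derivative 2 *\<^sub>R c) (at s within T)"
proof -
  have "((\<lambda>s. 2 * s + d) has_vector_derivative 2) (at s within T)"
    by (auto intro!: derivative_eq_intros simp flip: has_real_derivative_iff_has_vector_derivative)
  from vector_diff_chain_within [OF this assms(1)] assms(2,3)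
  show ?thesis
    by (auto simp: o_def intro: has_vector_derivative_transform)
qed

lemma piecewise_C1_path_join:
  assumes "piecewise_C1_path \<gamma>" "piecewise_C1_path \<delta>" "\<gamma> 1 = \<delta> 0"
  shows "piecewise_C1_path (\<gamma> +++ \<delta>)"
proof -
  obtain n t where t: "t 0 = 0" "t n = 1" and
    pt: "\<And>i. i < n \<Longrightarrow> t i < t (Suc i) \<and>
          (\<exists>c. continuous_on {t i..t (Suc i)} c \<and>
            (\<forall>s\<in>{t i..t (Suc i)}. (\<gamma> has_vector_derivative c s) (at s within {t i..t (Suc i)})))"
    using assms(1) unfolding piecewise_C1_path_def by blast
  obtain m r where r: "r 0 = 0" "r m = 1" and
    pr: "\<And>i. i < m \<Longrightarrow> r i < r (Suc i) \<and>
          (\<exists>c. continuous_on {r i..r (Suc i)} c \<and>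
            (\<forall>s\<in>{r i..r (Suc i)}. (\<delta> has_vector_derivative c s) (at s within {r i..r (Suc i)})))"
    using assms(2) unfolding piecewise_C1_path_def by blast
  have t1: "t i \<le> 1" if "i \<le> n" for i
    using that by (induction rule: inc_induct) (use t pt in \<open>force+\<close>)
  have r0: "0 \<le> r i" if "i \<le> m" for i
    using that
  proof (induction i)
    case (Suc i)
    then show ?case using pr [of i] by auto
  qed (simp add: r)
  \<comment> \<open>At \<open>i = n\<close> both branches would give 1/2, as \<open>t n = 1\<close>
    and \<open>r 0 = 0\<close>; hence the intervals on either side fit together.\<close>
  define q where "q i = (if i \<le> n then t i / 2 else (r (i - n) + 1) / 2)" for i
  have piece: "q i < q (Suc i) \<and>
          (\<exists>c. continuous_on {q i..q (Suc i)} c \<and>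
            (\<forall>s\<in>{q i..q (Suc i)}. (\<gamma> +++ \<delta> has_vector_derivative c s) (at s within {q i..q (Suc i)})))"
    if i: "i < n + m" for i
  proof (cases "i < n")
    case True
    then have q: "q i = t i / 2" "q (Suc i) = t (Suc i) / 2" by (auto simp: q_def)
    obtain c where c: "continuous_on {t i..t (Suc i)} c"
      "\<And>s. s \<in> {t i..t (Suc i)} \<Longrightarrow> (\<gamma> has_vector_derivative c s) (at s within {t i..t (Suc i)})"
      using pt [OF True] by blast
    have img: "(\<lambda>s. 2 * s + 0) ` {q i..q (Suc i)} \<subseteq> {t i..t (Suc i)}" by (auto simp: q)
    have "(\<gamma> +++ \<delta> has_vector_derivative 2 *\<^sub>R c (2 * s)) (at s within {q i..q (Suc i)})"
      if s: "s \<in> {q i..q (Suc i)}" for s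
    proof (rule affine_reparametrisation [where d = 0])
      show "(\<gamma> has_vector_derivative c (2 * s)) (at (2 * s + 0) within (\<lambda>s. 2 * s + 0) ` {q i..q (Suc i)})"
        using has_vector_derivative_within_subset [OF c(2) img] s by (auto simp: q)
      fix s assume "s \<in> {q i..q (Suc i)}"
      then show "(\<gamma> +++ \<delta>) s = \<gamma> (2 * s + 0)"
        using t1 [of "Suc i"] True by (simp add: q joinpaths_left)
    qed (rule s)
    moreover have "continuous_on {q i..q (Suc i)} (\<lambda>s. 2 *\<^sub>R c (2 * s))"
      by (intro continuous_intros continuous_on_compose2 [OF c(1)]) (auto simp: q)
    ultimately show ?thesis using pt [OF True] by (auto simp: q)
  next
    case False
    define j where "j = i - n"
    have j: "j < m" using False i by (simp add: j_def)
    have q: "q i = (r j + 1) / 2" "q (Suc i) = (r (Suc j) + 1) / 2"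
      using False t r by (auto simp: q_def j_def Suc_diff_le not_less le_Suc_eq)
    obtain c where c: "continuous_on {r j..r (Suc j)} c"
      "\<And>s. s \<in> {r j..r (Suc j)} \<Longrightarrow> (\<delta> has_vector_derivative c s) (at s within {r j..r (Suc j)})"
      using pr [OF j] by blast
    have img: "(\<lambda>s. 2 * s + - 1) ` {q i..q (Suc i)} \<subseteq> {r j..r (Suc j)}" by (auto simp: q field_simps)
    have "(\<gamma> +++ \<delta> has_vector_derivative 2 *\<^sub>R c (2 * s - 1)) (at s within {q i..q (Suc i)})"
      if s: "s \<in> {q i..q (Suc i)}" for s
    proof (rule affine_reparametrisation [where d = "- 1"])
      show "(\<delta> has_vector_derivative c (2 * s - 1)) (at (2 * s + - 1) within (\<lambda>s. 2 * s + - 1) ` {q i..q (Suc i)})"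
        using has_vector_derivative_within_subset [OF c(2) img] s by (auto simp: q field_simps)
      fix s assume "s \<in> {q i..q (Suc i)}"
      then show "(\<gamma> +++ \<delta>) s = \<delta> (2 * s + - 1)"
        using r0 [of j] j assms(3) by (simp add: q joinpaths_right)
    qed (rule s)
    moreover have "continuous_on {q i..q (Suc i)} (\<lambda>s. 2 *\<^sub>R c (2 * s - 1))"
      by (intro continuous_intros continuous_on_compose2 [OF c(1)]) (auto simp: q field_simps)
    ultimately show ?thesis using pr [OF j] by (auto simp: q)
  qed
  have "0 < n" using t by (cases n) auto
  then have "q 0 = 0" by (simp add: q_def t)
  moreover have "q (n + m) = 1"
    using r by (cases "m = 0") (auto simp: q_def)
  ultimately show ?thesis
    unfolding piecewise_C1_path_def using piece by blast
qed

text \<open>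
  \<open>\<theta> p\<close> is an orthonormal coframe with inverse \<open>L p\<close>, \<open>D p c w\<close> the derivative of \<open>\<theta> q w\<close> at \<open>p\<close> in
  direction \<open>c\<close>, and \<open>\<Omega> p (\<theta> p c)\<close> the connection form in direction \<open>c\<close>; \<open>torsion\<close> is Cartan's
  first structure equation \<open>d\<theta> + \<Omega> \<and> \<theta> = 0\<close>.
\<close>

locale moving_coframe =
  fixes U :: "'a::euclidean_space set" and g :: "'a \<Rightarrow> 'a \<Rightarrow> 'a \<Rightarrow> real"
    and \<theta> :: "'a \<Rightarrow> 'a \<Rightarrow> 'b::euclidean_space" and L :: "'a \<Rightarrow> 'b \<Rightarrow> 'a"
    and D :: "'a \<Rightarrow> 'a \<Rightarrow> 'a \<Rightarrow> 'b" and \<Omega> :: "'a \<Rightarrow> 'b \<Rightarrow> 'b \<Rightarrow> 'b"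
  assumes open_U: "open U"
    and linear_\<theta>: "p \<in> U \<Longrightarrow> linear (\<theta> p)" and linear_L: "p \<in> U \<Longrightarrow> linear (L p)"
    and \<theta>_L [simp]: "p \<in> U \<Longrightarrow> \<theta> p (L p y) = y" and L_\<theta> [simp]: "p \<in> U \<Longrightarrow> L p (\<theta> p v) = v"
    and metric: "p \<in> U \<Longrightarrow> g p v w = \<theta> p v \<bullet> \<theta> p w"
    and \<theta>_deriv: "p \<in> U \<Longrightarrow> ((\<lambda>q. \<theta> q w) has_derivative (\<lambda>c. D p c w)) (at p)"
    and linear_D: "p \<in> U \<Longrightarrow> linear (D p c)"
    and L_diff: "p \<in> U \<Longrightarrow> (\<lambda>q. L q y) differentiable (at p)"
    and linear_\<Omega>: "linear (\<lambda>y. \<Omega> p y z)" "linear (\<Omega> p y)"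
    and skew: "\<Omega> p y z \<bullet> z' = - (z \<bullet> \<Omega> p y z')"
    and torsion: "p \<in> U \<Longrightarrow> D p c w + \<Omega> p (\<theta> p c) (\<theta> p w) = D p w c + \<Omega> p (\<theta> p w) (\<theta> p c)"
begin

text \<open>In the coframe, covariant differentiation is \<open>d + \<Omega>\<close>;
  \<open>L p\<close> carries the result back to the tangent space.\<close>

definition christoffel :: "'a \<Rightarrow> 'a \<Rightarrow> 'a \<Rightarrow> 'a" where
  "christoffel p c w = L p (D p c w + \<Omega> p (\<theta> p c) (\<theta> p w))"

lemma orthonormal_frame_L:
  assumes "p \<in> U"
  shows "orthonormal_frame g p (L p)"
  unfolding orthonormal_frame_def
proof (intro conjI allI)
  show "bij (L p)"
    by (rule bij_betw_byWitness [where f' = "\<theta> p"]) (use assms in auto)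
qed (use assms linear_L metric in auto)

lemma bilinear_christoffel:
  assumes "p \<in> U"
  shows "bilinear (christoffel p)"
proof -
  have "linear (\<lambda>c. D p c w)" for w
    using has_derivative_linear [OF \<theta>_deriv [OF assms]] .
  then have "linear (\<lambda>c. D p c w + \<Omega> p (\<theta> p c) (\<theta> p w))" "linear (\<lambda>w. D p c w + \<Omega> p (\<theta> p c) (\<theta> p w))" for c w
    using linear_compose [OF linear_\<theta> [OF assms] linear_\<Omega>(1)] linear_compose [OF linear_\<theta> [OF assms] linear_\<Omega>(2)]
      linear_D [OF assms]
    by (auto simp: o_def intro!: linear_compose_add)
  then show ?thesis
    unfolding bilinear_def christoffel_def
    using linear_compose [OF _ linear_L [OF assms]] by (auto simp: o_def)
qed

lemma metric_derivative:
  assumes "p \<in> U"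
  shows "frechet_derivative (\<lambda>q. g q w y) (at p) c = g p (christoffel p c w) y + g p w (christoffel p c y)"
proof -
  have "((\<lambda>q. \<theta> q w \<bullet> \<theta> q y) has_derivative (\<lambda>c. \<theta> p w \<bullet> D p c y + D p c w \<bullet> \<theta> p y)) (at p)"
    by (intro has_derivative_inner \<theta>_deriv assms)
  then have "((\<lambda>q. g q w y) has_derivative (\<lambda>c. \<theta> p w \<bullet> D p c y + D p c w \<bullet> \<theta> p y)) (at p)"
    by (rule has_derivative_transform_within_open [OF _ open_U assms]) (simp add: metric)
  then have "frechet_derivative (\<lambda>q. g q w y) (at p) = (\<lambda>c. \<theta> p w \<bullet> D p c y + D p c w \<bullet> \<theta> p y)"
    by (rule frechet_derivative_at [symmetric])
  then show ?thesis
    using assms by (simp add: metric christoffel_def inner_add_left inner_add_right skew)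
qed

text \<open>Uniqueness is the Koszul argument: the difference of two solutions is symmetric in its
  first two slots and skew in its last two, and such a trilinear form vanishes.\<close>

lemma levi_civita_eq:
  assumes p: "p \<in> U"
  shows "levi_civita g p = christoffel p"
proof -
  have chsym: "christoffel p v w = christoffel p w v" for v w
    unfolding christoffel_def by (simp only: torsion [OF p, of v w])
  show ?thesis
    unfolding levi_civita_def
  proof (rule the_equality)
    show "bilinear (christoffel p) \<and> (\<forall>v w. christoffel p v w = christoffel p w v) \<and>
      (\<forall>v w y. frechet_derivative (\<lambda>q. g q w y) (at p) v = g p (christoffel p v w) y + g p w (christoffel p v y))"
      using bilinear_christoffel [OF p] metric_derivative [OF p] chsym by blast
  next
    fix G assume G: "bilinear G \<and> (\<forall>v w. G v w = G w v) \<and>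
       (\<forall>v w y. frechet_derivative (\<lambda>q. g q w y) (at p) v = g p (G v w) y + g p w (G v y))"
    let ?T = "\<lambda>v w. G v w - christoffel p v w"
    have sub: "g p (x - y) z = g p x z - g p y z" "g p z (x - y) = g p z x - g p z y" and gsym: "g p x y = g p y x" for x y z
      using p linear_diff [OF linear_\<theta> [OF p]]
      by (simp_all add: metric inner_diff_left inner_diff_right inner_commute)
    have sym: "?T v w = ?T w v" for v w
      using G chsym [of v w] by metis
    have skewT: "g p (?T v w) y = - g p (?T v y) w" for v w y
    proof -
      have "g p (G v w) y + g p w (G v y) = g p (christoffel p v w) y + g p w (christoffel p v y)"
        using G metric_derivative [OF p, of w y v] by metis
      then show ?thesis unfolding sub using gsym [of w "G v y"] gsym [of w "christoffel p v y"] by linarith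
    qed
    have "g p (?T v w) y = 0" for v w y
    proof -
      have "g p (?T v w) y = - g p (?T y v) w" using skewT [of v w y] sym [of v y] by simp
      also have "\<dots> = g p (?T w y) v" using skewT [of y v w] sym [of y w] by simp
      also have "\<dots> = - g p (?T v w) y" using skewT [of w y v] sym [of w v] by simp
      finally show ?thesis by simp
    qed
    then have "g p (?T v w) (?T v w) = 0" for v w .
    then have "\<theta> p (?T v w) = 0" for v w by (simp add: metric p)
    then have "?T v w = 0" for v w
      using L_\<theta> [OF p, of "?T v w"] linear_0 [OF linear_L [OF p]] by simp
    then show "G = christoffel p" by (intro ext) simp
  qed
qed

lemma \<theta>_along_curve:
  assumes p: "\<gamma> t \<in> U" and "(\<gamma> has_vector_derivative c) (at t)" and "(V has_vector_derivative V') (at t)"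
  shows "((\<lambda>t. \<theta> (\<gamma> t) (V t)) has_vector_derivative D (\<gamma> t) c (V t) + \<theta> (\<gamma> t) V') (at t)"
proof -
  have 1: "((\<lambda>s. \<theta> (\<gamma> s) b) has_vector_derivative D (\<gamma> t) c b) (at t)" for b
  proof -
    have "((\<lambda>q. \<theta> q b) \<circ> \<gamma> has_derivative (\<lambda>c. D (\<gamma> t) c b) \<circ> (\<lambda>h. h *\<^sub>R c)) (at t)"
      using assms(2) by (intro diff_chain_at \<theta>_deriv p) (simp add: has_vector_derivative_def)
    moreover have "D (\<gamma> t) (h *\<^sub>R c) b = h *\<^sub>R D (\<gamma> t) c b" for h
      using linear_scale [OF has_derivative_linear [OF \<theta>_deriv [OF p]]] by fast
    ultimately show ?thesis by (simp add: has_vector_derivative_def o_def)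
  qed
  have "((\<lambda>s. \<Sum>b\<in>Basis. (V s \<bullet> b) *\<^sub>R \<theta> (\<gamma> s) b) has_vector_derivative
      (\<Sum>b\<in>Basis. (V t \<bullet> b) *\<^sub>R D (\<gamma> t) c b + (V' \<bullet> b) *\<^sub>R \<theta> (\<gamma> t) b)) (at t)"
    by (intro has_vector_derivative_sum has_vector_derivative_scaleR 1)
      (use bounded_linear.has_vector_derivative [OF bounded_linear_inner_left assms(3)]
        in \<open>simp add: has_real_derivative_iff_has_vector_derivative\<close>)
  then have *: "((\<lambda>s. \<Sum>b\<in>Basis. (V s \<bullet> b) *\<^sub>R \<theta> (\<gamma> s) b) has_vector_derivative D (\<gamma> t) c (V t) + \<theta> (\<gamma> t) V') (at t)"
    using linear_basis_expansion [OF linear_D [OF p], of c "V t"] linear_basis_expansion [OF linear_\<theta> [OF p], of V'] by (simp add: sum.distrib)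
  have "isCont \<gamma> t" using assms(2) by (rule has_vector_derivative_continuous)
  then have "\<forall>\<^sub>F s in nhds t. \<gamma> s \<in> U"
    using open_U p by (simp add: continuous_at_open eventually_nhds)
  then have "\<forall>\<^sub>F s in nhds t. (\<Sum>b\<in>Basis. (V s \<bullet> b) *\<^sub>R \<theta> (\<gamma> s) b) = \<theta> (\<gamma> s) (V s)"
    by eventually_elim (metis linear_basis_expansion linear_\<theta>)
  with * show ?thesis by (rule has_vector_derivative_eventually_eq)
qed

lemma continuous_on_\<theta>:
  assumes "continuous_on T \<gamma>" "\<gamma> ` T \<subseteq> U" "continuous_on T V"
  shows "continuous_on T (\<lambda>t. \<theta> (\<gamma> t) (V t))"
proof -
  have "continuous_on U (\<lambda>q. \<theta> q b)" for b
    by (intro continuous_at_imp_continuous_on ballI has_derivative_continuous [OF \<theta>_deriv])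
  then have "continuous_on T (\<lambda>t. \<theta> (\<gamma> t) b)" for b
    by (rule continuous_on_compose2 [OF _ assms(1,2)])
  then have "continuous_on T (\<lambda>t. \<Sum>b\<in>Basis. (V t \<bullet> b) *\<^sub>R \<theta> (\<gamma> t) b)"
    using assms by (intro continuous_intros)
  moreover have "(\<Sum>b\<in>Basis. (V t \<bullet> b) *\<^sub>R \<theta> (\<gamma> t) b) = \<theta> (\<gamma> t) (V t)" if "t \<in> T" for t
  proof -
    have lin: "linear (\<theta> (\<gamma> t))" using linear_\<theta> assms that by blast
    show ?thesis by (rule linear_basis_expansion [OF lin, symmetric])
  qed
  ultimately show ?thesis by (simp cong: continuous_on_cong)
qed

lemma parallel_frame_components:
  assumes "parallel_along g \<gamma> V" "path_image \<gamma> \<subseteq> U" "continuous_on {0..1} \<gamma>"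
  shows "continuous_on {0..1} (\<lambda>t. \<theta> (\<gamma> t) (V t))"
    and "\<exists>S. finite S \<and> (\<forall>t\<in>{0..1} - S. \<exists>c. (\<gamma> has_vector_derivative c) (at t) \<and>
      ((\<lambda>t. \<theta> (\<gamma> t) (V t)) has_vector_derivative - \<Omega> (\<gamma> t) (\<theta> (\<gamma> t) c) (\<theta> (\<gamma> t) (V t))) (at t))"
proof -
  have U: "\<gamma> t \<in> U" if "t \<in> {0..1}" for t using assms(2) that by (auto simp: path_image_def)
  obtain S where V: "continuous_on {0..1} V" and S: "finite S" "\<forall>t\<in>{0..1} - S. \<exists>c.
        (\<gamma> has_vector_derivative c) (at t) \<and>
        (V has_vector_derivative - levi_civita g (\<gamma> t) c (V t)) (at t)"
    using assms(1) unfolding parallel_along_def by blast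
  show "continuous_on {0..1} (\<lambda>t. \<theta> (\<gamma> t) (V t))"
    by (rule continuous_on_\<theta>) (use assms V U in auto)
  have "\<exists>c. (\<gamma> has_vector_derivative c) (at t) \<and>
      ((\<lambda>t. \<theta> (\<gamma> t) (V t)) has_vector_derivative - \<Omega> (\<gamma> t) (\<theta> (\<gamma> t) c) (\<theta> (\<gamma> t) (V t))) (at t)"
    if t: "t \<in> {0..1} - S" for t
  proof -
    obtain c where c: "(\<gamma> has_vector_derivative c) (at t)"
        "(V has_vector_derivative - levi_civita g (\<gamma> t) c (V t)) (at t)"
      using S(2) t by blast
    have p: "\<gamma> t \<in> U" using U t by blast
    have "((\<lambda>t. \<theta> (\<gamma> t) (V t)) has_vector_derivative
        D (\<gamma> t) c (V t) + \<theta> (\<gamma> t) (- levi_civita g (\<gamma> t) c (V t))) (at t)"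
      by (rule \<theta>_along_curve [OF p c])
    then show ?thesis
      using c(1) p by (auto simp: levi_civita_eq christoffel_def linear_neg [OF linear_\<theta>])
  qed
  then show "\<exists>S. finite S \<and> (\<forall>t\<in>{0..1} - S. \<exists>c. (\<gamma> has_vector_derivative c) (at t) \<and>
      ((\<lambda>t. \<theta> (\<gamma> t) (V t)) has_vector_derivative - \<Omega> (\<gamma> t) (\<theta> (\<gamma> t) c) (\<theta> (\<gamma> t) (V t))) (at t))"
    using S(1) by blast
qed

text \<open>Differentiability of the frame only shows that a derivative \<open>V'\<close> exists.
  Its value is found by applying \<open>\<theta>\<close>, which avoids any formula for the
  derivative of \<open>L\<close>.\<close>

lemma parallel_of_frame_components:
  assumes p: "\<gamma> t \<in> U" and \<gamma>: "(\<gamma> has_vector_derivative c) (at t)"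
    and \<xi>: "(\<xi> has_vector_derivative - \<Omega> (\<gamma> t) (\<theta> (\<gamma> t) c) (\<xi> t)) (at t)"
  shows "((\<lambda>t. L (\<gamma> t) (\<xi> t)) has_vector_derivative - levi_civita g (\<gamma> t) c (L (\<gamma> t) (\<xi> t))) (at t)"
proof -
  let ?V = "\<lambda>t. L (\<gamma> t) (\<xi> t)"
  have "isCont \<gamma> t" using \<gamma> by (rule has_vector_derivative_continuous)
  then have ev: "\<forall>\<^sub>F s in nhds t. \<gamma> s \<in> U"
    using open_U p by (simp add: continuous_at_open eventually_nhds)
  have "(\<lambda>s. L (\<gamma> s) b) differentiable (at t)" for b
    using differentiable_chain_at [of \<gamma> t "\<lambda>q. L q b"] L_diff [OF p] \<gamma>
    by (auto simp: o_def intro: differentiableI_vector)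
  moreover have "\<xi> differentiable (at t)" using \<xi> by (rule differentiableI_vector)
  ultimately have "(\<lambda>s. \<Sum>b\<in>Basis. (\<xi> s \<bullet> b) *\<^sub>R L (\<gamma> s) b) differentiable (at t)"
    by (intro differentiable_sum differentiable_scaleR differentiable_inner differentiable_const) auto
  then obtain V' where "((\<lambda>s. \<Sum>b\<in>Basis. (\<xi> s \<bullet> b) *\<^sub>R L (\<gamma> s) b) has_vector_derivative V') (at t)"
    using vector_derivative_works by blast
  moreover have "\<forall>\<^sub>F s in nhds t. (\<Sum>b\<in>Basis. (\<xi> s \<bullet> b) *\<^sub>R L (\<gamma> s) b) = ?V s"
    using ev by eventually_elim (metis linear_basis_expansion linear_L)
  ultimately have V': "(?V has_vector_derivative V') (at t)"
    by (rule has_vector_derivative_eventually_eq)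
  have "((\<lambda>s. \<theta> (\<gamma> s) (?V s)) has_vector_derivative D (\<gamma> t) c (?V t) + \<theta> (\<gamma> t) V') (at t)"
    by (rule \<theta>_along_curve [OF p \<gamma> V'])
  moreover have "\<forall>\<^sub>F s in nhds t. \<theta> (\<gamma> s) (?V s) = \<xi> s"
    using ev by eventually_elim simp
  ultimately have "(\<xi> has_vector_derivative D (\<gamma> t) c (?V t) + \<theta> (\<gamma> t) V') (at t)"
    by (rule has_vector_derivative_eventually_eq)
  then have "D (\<gamma> t) c (?V t) + \<theta> (\<gamma> t) V' = - \<Omega> (\<gamma> t) (\<theta> (\<gamma> t) c) (\<xi> t)"
    using \<xi> vector_derivative_unique_at by blast
  then have "\<theta> (\<gamma> t) V' = - (D (\<gamma> t) c (?V t) + \<Omega> (\<gamma> t) (\<theta> (\<gamma> t) c) (\<xi> t))"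
    by (simp only: eq_neg_iff_add_eq_0 ac_simps)
  then have "V' = L (\<gamma> t) (- (D (\<gamma> t) c (?V t) + \<Omega> (\<gamma> t) (\<theta> (\<gamma> t) c) (\<xi> t)))"
    by (metis L_\<theta> p)
  then have "V' = - L (\<gamma> t) (D (\<gamma> t) c (?V t) + \<Omega> (\<gamma> t) (\<theta> (\<gamma> t) c) (\<xi> t))"
    by (simp only: linear_neg [OF linear_L [OF p]])
  then have "V' = - levi_civita g (\<gamma> t) c (?V t)"
    by (simp only: levi_civita_eq [OF p] christoffel_def \<theta>_L [OF p])
  then show ?thesis using V' by simp
qed

lemma continuous_on_L:
  assumes "continuous_on T \<gamma>" "\<gamma> ` T \<subseteq> U" "continuous_on T \<xi>"
  shows "continuous_on T (\<lambda>t. L (\<gamma> t) (\<xi> t))"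
proof -
  have "continuous_on U (\<lambda>q. L q b)" for b
    by (intro continuous_at_imp_continuous_on ballI differentiable_imp_continuous_within L_diff)
  then have "continuous_on T (\<lambda>t. L (\<gamma> t) b)" for b
    by (rule continuous_on_compose2 [OF _ assms(1,2)])
  then have "continuous_on T (\<lambda>t. \<Sum>b\<in>Basis. (\<xi> t \<bullet> b) *\<^sub>R L (\<gamma> t) b)"
    using assms by (intro continuous_intros)
  moreover have "(\<Sum>b\<in>Basis. (\<xi> t \<bullet> b) *\<^sub>R L (\<gamma> t) b) = L (\<gamma> t) (\<xi> t)" if "t \<in> T" for t
  proof -
    have lin: "linear (L (\<gamma> t))" using linear_L assms that by blast
    show ?thesis by (rule linear_basis_expansion [OF lin, symmetric])
  qed
  ultimately show ?thesis by (simp cong: continuous_on_cong)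
qed

text \<open>Transport read in the frames at both endpoints. Allowing open paths lets loops be
  assembled from straight segments.\<close>

definition transports :: "'a \<Rightarrow> 'a \<Rightarrow> ('b \<Rightarrow> 'b) \<Rightarrow> bool" where
  "transports p q M \<longleftrightarrow> (\<exists>\<gamma>. piecewise_C1_path \<gamma> \<and> path_image \<gamma> \<subseteq> U \<and> pathstart \<gamma> = p \<and> pathfinish \<gamma> = q \<and>
     (\<forall>y. \<exists>V. parallel_along g \<gamma> V \<and> V 0 = L p y \<and> V 1 = L q (M y)))"

text \<open>The solution \<open>\<xi>\<close> is supplied explicitly, so no existence theorem for
  linear differential equations enters.\<close>

lemma transports_line:
  assumes U: "\<And>s. s \<in> {0..1} \<Longrightarrow> p + s *\<^sub>R v \<in> U"
    and \<xi>: "\<And>y. \<xi> y 0 = y" "\<And>y. \<xi> y 1 = M y" "\<And>y s. s \<in> {0..1} \<Longrightarrow>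
      (\<xi> y has_vector_derivative - \<Omega> (p + s *\<^sub>R v) (\<theta> (p + s *\<^sub>R v) v) (\<xi> y s)) (at s)"
  shows "transports p (p + v) M"
proof -
  let ?\<gamma> = "linepath p (p + v)"
  have \<gamma>: "?\<gamma> s = p + s *\<^sub>R v" for s by (simp add: linepath_def algebra_simps)
  have img: "path_image ?\<gamma> \<subseteq> U"
  proof -
    have "path_image ?\<gamma> = ?\<gamma> ` {0..1}" by (simp add: path_image_def)
    then show ?thesis using U by (auto simp only: \<gamma>)
  qed
  have "\<forall>y. \<exists>V. parallel_along g ?\<gamma> V \<and> V 0 = L p y \<and> V 1 = L (p + v) (M y)"
  proof (intro allI exI conjI)
    fix y
    let ?V = "\<lambda>t. L (?\<gamma> t) (\<xi> y t)"
    have "continuous_on {0..1} (\<xi> y)"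
      by (intro continuous_at_imp_continuous_on ballI has_vector_derivative_continuous [OF \<xi>(3)])
    then have "continuous_on {0..1} ?V"
      by (intro continuous_on_L) (use img in \<open>auto simp: path_image_def\<close>)
    moreover have \<gamma>': "(?\<gamma> has_vector_derivative v) (at t)" for t
      using has_vector_derivative_linepath_within [of p "p + v" t UNIV] by simp
    moreover have "(?V has_vector_derivative - levi_civita g (?\<gamma> t) v (?V t)) (at t)" if "t \<in> {0..1}" for t
    proof (rule parallel_of_frame_components [OF _ \<gamma>'])
      show "?\<gamma> t \<in> U" by (simp only: \<gamma> U [OF that])
      show "(\<xi> y has_vector_derivative - \<Omega> (?\<gamma> t) (\<theta> (?\<gamma> t) v) (\<xi> y t)) (at t)"
        using \<xi>(3) [OF that] by (simp only: \<gamma>)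
    qed
    ultimately show "parallel_along g ?\<gamma> ?V"
      unfolding parallel_along_def by (intro conjI exI [of _ "{}"]) blast+
  qed (simp_all add: \<xi>(1,2) \<gamma>)
  then show ?thesis
    unfolding transports_def using img piecewise_C1_path_linepath pathstart_linepath pathfinish_linepath
    by blast
qed

lemma parallel_along_join:
  assumes "parallel_along g \<gamma> V" "parallel_along g \<delta> W" "V 1 = W 0" "\<gamma> 1 = \<delta> 0"
    and img: "path_image \<gamma> \<subseteq> U" "path_image \<delta> \<subseteq> U"
  shows "parallel_along g (\<gamma> +++ \<delta>) (V +++ W)"
proof -
  obtain S T where V: "continuous_on {0..1} V" and W: "continuous_on {0..1} W" and fin: "finite S" "finite T"
    and S: "\<And>t. t \<in> {0..1} - S \<Longrightarrow> \<exists>c. (\<gamma> has_vector_derivative c) (at t) \<and>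
        (V has_vector_derivative - levi_civita g (\<gamma> t) c (V t)) (at t)"
    and T: "\<And>t. t \<in> {0..1} - T \<Longrightarrow> \<exists>c. (\<delta> has_vector_derivative c) (at t) \<and>
        (W has_vector_derivative - levi_civita g (\<delta> t) c (W t)) (at t)"
    using assms(1,2) unfolding parallel_along_def by meson
  have cont: "continuous_on {0..1} (V +++ W)"
    using V W assms(3) by (intro continuous_on_joinpaths) (auto simp: pathfinish_def pathstart_def)
  have lc2: "levi_civita g p (2 *\<^sub>R c) w = 2 *\<^sub>R levi_civita g p c w" if "p \<in> U" for p c w
    using bilinear_christoffel [OF that] by (simp add: levi_civita_eq that bilinear_lmul)
  \<comment> \<open>Exceptional parameters: the junction and the rescaled exceptional sets of the
    two halves. Elsewhere the factor 2 in the velocity is matched by linearity of the connection in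
    the direction, \<open>lc2\<close>.\<close>
  let ?S = "{1/2} \<union> (\<lambda>s. s / 2) ` S \<union> (\<lambda>s. (s + 1) / 2) ` T"
  have half: "(f +++ h has_vector_derivative 2 *\<^sub>R c) (at t)"
    if "(f has_vector_derivative c) (at (2 * t))" "t < 1/2" for f h :: "real \<Rightarrow> 'a" and c t
  proof -
    have "((\<lambda>s. f (2 * s)) has_vector_derivative 2 *\<^sub>R c) (at t)"
      by (rule affine_reparametrisation [where d = 0 and f = f]) (use that in \<open>auto intro: has_vector_derivative_at_within\<close>)
    then show ?thesis
      by (rule has_vector_derivative_transform_within_open [where S = "{..<1/2}"])
        (use that in \<open>auto simp: joinpaths_left\<close>)
  qed
  have half': "(f +++ h has_vector_derivative 2 *\<^sub>R c) (at t)"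
    if "(h has_vector_derivative c) (at (2 * t - 1))" "1/2 < t" for f h :: "real \<Rightarrow> 'a" and c t
  proof -
    have "((\<lambda>s. h (2 * s - 1)) has_vector_derivative 2 *\<^sub>R c) (at t)"
      by (rule affine_reparametrisation [where d = "- 1" and f = h]) (use that in \<open>auto intro: has_vector_derivative_at_within\<close>)
    then show ?thesis
      by (rule has_vector_derivative_transform_within_open [where S = "{1/2<..}"])
        (use that in \<open>auto simp: joinpaths_def\<close>)
  qed
  have "\<exists>c. (\<gamma> +++ \<delta> has_vector_derivative c) (at t) \<and>
      (V +++ W has_vector_derivative - levi_civita g ((\<gamma> +++ \<delta>) t) c ((V +++ W) t)) (at t)"
    if t: "t \<in> {0..1} - ?S" for t
  proof (cases "t < 1/2")
    case True
    have "t \<noteq> s / 2" if "s \<in> S" for s using t that by blast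
    then have "2 * t \<notin> S" by force
    then have "2 * t \<in> {0..1} - S" using t True by auto
    then obtain c where c: "(\<gamma> has_vector_derivative c) (at (2 * t))"
        "(V has_vector_derivative - levi_civita g (\<gamma> (2 * t)) c (V (2 * t))) (at (2 * t))"
      using S by blast
    have "\<gamma> (2 * t) \<in> U" using img(1) t True by (auto simp: path_image_def)
    then show ?thesis
      using half [OF c(1) True] half [OF c(2) True] True
      by (intro exI [of _ "2 *\<^sub>R c"]) (simp add: joinpaths_left lc2)
  next
    case False
    then have t2: "1/2 < t" using t by auto
    have "t \<noteq> (s + 1) / 2" if "s \<in> T" for s using t that by blast
    then have "2 * t - 1 \<notin> T" by force
    then have "2 * t - 1 \<in> {0..1} - T" using t t2 by auto
    then obtain c where c: "(\<delta> has_vector_derivative c) (at (2 * t - 1))"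
        "(W has_vector_derivative - levi_civita g (\<delta> (2 * t - 1)) c (W (2 * t - 1))) (at (2 * t - 1))"
      using T by blast
    have "\<delta> (2 * t - 1) \<in> U" using img(2) t t2 by (auto simp: path_image_def)
    then show ?thesis
      using half' [OF c(1) t2] half' [OF c(2) t2] t2
      by (intro exI [of _ "2 *\<^sub>R c"]) (simp add: joinpaths_def lc2)
  qed
  then show ?thesis
    unfolding parallel_along_def using cont fin by (intro conjI exI [of _ ?S]) auto
qed

lemma transports_trans:
  assumes "transports p q M" "transports q r N"
  shows "transports p r (N \<circ> M)"
proof -
  obtain \<gamma> where \<gamma>: "piecewise_C1_path \<gamma>" "path_image \<gamma> \<subseteq> U" "pathstart \<gamma> = p" "pathfinish \<gamma> = q"
     "\<And>y. \<exists>V. parallel_along g \<gamma> V \<and> V 0 = L p y \<and> V 1 = L q (M y)"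
    using assms(1) unfolding transports_def by blast
  obtain \<delta> where \<delta>: "piecewise_C1_path \<delta>" "path_image \<delta> \<subseteq> U" "pathstart \<delta> = q" "pathfinish \<delta> = r"
     "\<And>y. \<exists>V. parallel_along g \<delta> V \<and> V 0 = L q y \<and> V 1 = L r (N y)"
    using assms(2) unfolding transports_def by blast
  have match: "\<gamma> 1 = \<delta> 0" using \<gamma>(4) \<delta>(3) by (simp add: pathfinish_def pathstart_def)
  have "\<exists>V. parallel_along g (\<gamma> +++ \<delta>) V \<and> V 0 = L p y \<and> V 1 = L r ((N \<circ> M) y)" for y
  proof -
    obtain V where V: "parallel_along g \<gamma> V" "V 0 = L p y" "V 1 = L q (M y)" using \<gamma>(5) by blast
    obtain W where W: "parallel_along g \<delta> W" "W 0 = L q (M y)" "W 1 = L r (N (M y))" using \<delta>(5) by blast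
    have "parallel_along g (\<gamma> +++ \<delta>) (V +++ W)"
      using V W match \<gamma>(2) \<delta>(2) by (intro parallel_along_join) auto
    then show ?thesis using V W by (intro exI [of _ "V +++ W"]) (simp add: joinpaths_def)
  qed
  moreover have "piecewise_C1_path (\<gamma> +++ \<delta>)"
    by (rule piecewise_C1_path_join [OF \<gamma>(1) \<delta>(1) match])
  moreover have "path_image (\<gamma> +++ \<delta>) \<subseteq> U"
    using \<gamma>(2) \<delta>(2) path_image_join_subset by blast
  ultimately show ?thesis
    unfolding transports_def using \<gamma>(3) \<delta>(4) by (intro exI [of _ "\<gamma> +++ \<delta>"]) simp
qed

lemma holonomy_of_transports:
  assumes "transports p p M" "p \<in> U"
  shows "M \<in> (\<lambda>P. inv (L p) \<circ> P \<circ> L p) ` holonomy_group U g p"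
proof -
  obtain \<gamma> where \<gamma>: "piecewise_C1_path \<gamma>" "path_image \<gamma> \<subseteq> U" "pathstart \<gamma> = p" "pathfinish \<gamma> = p"
     "\<And>y. \<exists>V. parallel_along g \<gamma> V \<and> V 0 = L p y \<and> V 1 = L p (M y)"
    using assms(1) unfolding transports_def by blast
  let ?P = "L p \<circ> M \<circ> \<theta> p"
  have "parallel_transport g \<gamma> ?P"
    unfolding parallel_transport_def
  proof
    fix v
    show "\<exists>V. parallel_along g \<gamma> V \<and> V 0 = v \<and> V 1 = ?P v"
      using \<gamma>(5) [of "\<theta> p v"] assms(2) by simp
  qed
  then have "?P \<in> holonomy_group U g p" using \<gamma> unfolding holonomy_group_def by blast
  moreover have "inv (L p) = \<theta> p"
    using assms(2) by (intro inv_equality) auto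
  then have "M = inv (L p) \<circ> ?P \<circ> L p" using assms(2) by (auto simp: fun_eq_iff)
  ultimately show ?thesis by blast
qed

end

context moving_coframe
begin

lemma riemannian_pointwise:
  assumes p: "p \<in> U"
  shows "bilinear (g p)" "g p v w = g p w v" "v \<noteq> 0 \<Longrightarrow> g p v v > 0"
proof -
  have "linear (\<lambda>v. \<theta> p v \<bullet> y)" "linear (\<lambda>v. y \<bullet> \<theta> p v)" for y
    using linear_\<theta> [OF p] by (auto intro!: linearI simp: linear_add linear_scale inner_simps)
  then show "bilinear (g p)" unfolding bilinear_def metric [OF p, abs_def] by blast
  show "g p v w = g p w v" using p by (simp add: metric inner_commute)
  assume "v \<noteq> 0"
  then have "\<theta> p v \<noteq> 0" using L_\<theta> [OF p, of v] linear_0 [OF linear_L [OF p]] by force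
  then show "g p v v > 0" using p by (simp add: metric)
qed

end

section \<open>Conserved quantities of parallel transport\<close>

lemma constant_on_unit_interval:
  fixes f :: "real \<Rightarrow> real"
  assumes "continuous_on {0..1} f" "finite S" "\<And>t. t \<in> {0..1} - S \<Longrightarrow> (f has_derivative (\<lambda>h. 0)) (at t)"
  shows "f 1 = f 0"
  by (rule has_derivative_zero_unique_strong_interval [where k = S and a = 0 and b = 1])
    (use assms in \<open>auto intro: has_derivative_at_withinI\<close>)

lemma continuous_on_cayley_form:
  assumes "continuous_on T a" "continuous_on T b" "continuous_on T c" "continuous_on T d"
  shows "continuous_on T (\<lambda>t. cayley_form (a t) (b t) (c t) (d t))"
  unfolding cayley_form_def dx4_expand by (intro continuous_intros assms)

locale spin_coframe = moving_coframe U g \<theta> L D \<Omega>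
  for U :: "'a::euclidean_space set" and g and \<theta> :: "'a \<Rightarrow> 'a \<Rightarrow> real^8" and L D \<Omega> +
  assumes cayley_skew: "cayley_form (\<Omega> p y v) w x z + cayley_form v (\<Omega> p y w) x z
    + cayley_form v w (\<Omega> p y x) z + cayley_form v w x (\<Omega> p y z) = 0"
begin

text \<open>By \<open>skew\<close> and \<open>cayley_skew\<close> both quantities have zero
  derivative off a finite set, and continuity carries constancy across it.\<close>

lemma parallel_invariants:
  assumes \<gamma>: "piecewise_C1_path \<gamma>" "path_image \<gamma> \<subseteq> U"
    and par: "\<And>i::nat. parallel_along g \<gamma> (V i)"
  defines "\<xi> i t \<equiv> \<theta> (\<gamma> t) (V i t)"
  shows "\<xi> i 1 \<bullet> \<xi> j 1 = \<xi> i 0 \<bullet> \<xi> j 0"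
    and "cayley_form (\<xi> i 1) (\<xi> j 1) (\<xi> k 1) (\<xi> l 1) = cayley_form (\<xi> i 0) (\<xi> j 0) (\<xi> k 0) (\<xi> l 0)"
proof -
  note comps = parallel_frame_components [OF par \<gamma>(2) piecewise_C1_path_continuous [OF \<gamma>(1)], folded \<xi>_def]
  have "\<forall>i. \<exists>S. finite S \<and> (\<forall>t\<in>{0..1} - S. \<exists>c. (\<gamma> has_vector_derivative c) (at t) \<and>
      (\<xi> i has_vector_derivative - \<Omega> (\<gamma> t) (\<theta> (\<gamma> t) c) (\<xi> i t)) (at t))"
    using comps(2) by (simp add: \<xi>_def [abs_def])
  then obtain S where S: "\<And>i. finite (S i)"
    "\<And>i t. t \<in> {0..1} - S i \<Longrightarrow> \<exists>c. (\<gamma> has_vector_derivative c) (at t) \<and>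
      (\<xi> i has_vector_derivative - \<Omega> (\<gamma> t) (\<theta> (\<gamma> t) c) (\<xi> i t)) (at t)"
    by metis
  have cont: "continuous_on {0..1} (\<xi> i)" for i using comps(1) by (simp add: \<xi>_def [abs_def])
  define T where "T = S i \<union> S j \<union> S k \<union> S l"
  have "finite T" using S(1) by (simp add: T_def)
  have deriv: "\<exists>y. \<forall>n\<in>{i,j,k,l}. (\<xi> n has_derivative (\<lambda>h. h *\<^sub>R (- \<Omega> (\<gamma> t) y (\<xi> n t)))) (at t)"
    if t: "t \<in> {0..1} - T" for t
  proof -
    have "\<exists>c. (\<gamma> has_vector_derivative c) (at t) \<and>
      (\<xi> n has_vector_derivative - \<Omega> (\<gamma> t) (\<theta> (\<gamma> t) c) (\<xi> n t)) (at t)" if "n \<in> {i,j,k,l}" for n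
      using S(2) [of t n] t that by (auto simp: T_def)
    then obtain c where c: "\<And>n. n \<in> {i,j,k,l} \<Longrightarrow> (\<gamma> has_vector_derivative c n) (at t) \<and>
      (\<xi> n has_vector_derivative - \<Omega> (\<gamma> t) (\<theta> (\<gamma> t) (c n)) (\<xi> n t)) (at t)"
      by metis
    \<comment> \<open>Each field brings its own velocity of \<open>\<gamma>\<close>; uniqueness of
      the derivative provides the common \<open>y\<close> needed in the product rule.\<close>
    then have "c n = c i" if "n \<in> {i,j,k,l}" for n
      using that vector_derivative_unique_at by blast
    then show ?thesis
      using c unfolding has_vector_derivative_def by (intro exI [of _ "\<theta> (\<gamma> t) (c i)"]) metis
  qed
  show "\<xi> i 1 \<bullet> \<xi> j 1 = \<xi> i 0 \<bullet> \<xi> j 0"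
  proof (rule constant_on_unit_interval [OF _ \<open>finite T\<close>])
    show "continuous_on {0..1} (\<lambda>t. \<xi> i t \<bullet> \<xi> j t)" by (intro continuous_intros cont)
    fix t assume "t \<in> {0..1} - T"
    then obtain y where y: "\<And>n. n \<in> {i,j,k,l} \<Longrightarrow> (\<xi> n has_derivative (\<lambda>h. h *\<^sub>R (- \<Omega> (\<gamma> t) y (\<xi> n t)))) (at t)"
      using deriv by blast
    show "((\<lambda>t. \<xi> i t \<bullet> \<xi> j t) has_derivative (\<lambda>h. 0)) (at t)"
      by (rule has_derivative_eq_rhs [OF has_derivative_inner [OF y [of i] y [of j]]])
        (auto simp: fun_eq_iff skew)
  qed
  show "cayley_form (\<xi> i 1) (\<xi> j 1) (\<xi> k 1) (\<xi> l 1) = cayley_form (\<xi> i 0) (\<xi> j 0) (\<xi> k 0) (\<xi> l 0)"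
  proof (rule constant_on_unit_interval [OF _ \<open>finite T\<close>])
    show "continuous_on {0..1} (\<lambda>t. cayley_form (\<xi> i t) (\<xi> j t) (\<xi> k t) (\<xi> l t))"
      by (intro continuous_on_cayley_form cont)
    fix t assume "t \<in> {0..1} - T"
    then obtain y where y: "\<And>n. n \<in> {i,j,k,l} \<Longrightarrow> (\<xi> n has_derivative (\<lambda>h. h *\<^sub>R (- \<Omega> (\<gamma> t) y (\<xi> n t)))) (at t)"
      using deriv by blast
    have "(\<lambda>h. cayley_form (h *\<^sub>R (- \<Omega> (\<gamma> t) y (\<xi> i t))) (\<xi> j t) (\<xi> k t) (\<xi> l t)
        + cayley_form (\<xi> i t) (h *\<^sub>R (- \<Omega> (\<gamma> t) y (\<xi> j t))) (\<xi> k t) (\<xi> l t)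
        + cayley_form (\<xi> i t) (\<xi> j t) (h *\<^sub>R (- \<Omega> (\<gamma> t) y (\<xi> k t))) (\<xi> l t)
        + cayley_form (\<xi> i t) (\<xi> j t) (\<xi> k t) (h *\<^sub>R (- \<Omega> (\<gamma> t) y (\<xi> l t)))) = (\<lambda>h. 0)"
    proof
      fix h
      have neg: "h *\<^sub>R (- v) = (- h) *\<^sub>R v" for v :: "real^8" by simp
      show "cayley_form (h *\<^sub>R (- \<Omega> (\<gamma> t) y (\<xi> i t))) (\<xi> j t) (\<xi> k t) (\<xi> l t)
        + cayley_form (\<xi> i t) (h *\<^sub>R (- \<Omega> (\<gamma> t) y (\<xi> j t))) (\<xi> k t) (\<xi> l t)
        + cayley_form (\<xi> i t) (\<xi> j t) (h *\<^sub>R (- \<Omega> (\<gamma> t) y (\<xi> k t))) (\<xi> l t)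
        + cayley_form (\<xi> i t) (\<xi> j t) (\<xi> k t) (h *\<^sub>R (- \<Omega> (\<gamma> t) y (\<xi> l t))) = 0"
        unfolding neg cayley_form_scaleR distrib_left [symmetric] cayley_skew by simp
    qed
    then show "((\<lambda>t. cayley_form (\<xi> i t) (\<xi> j t) (\<xi> k t) (\<xi> l t)) has_derivative (\<lambda>h. 0)) (at t)"
      using cayley_form_has_derivative [OF y [of i] y [of j] y [of k] y [of l]] by simp
  qed
qed

lemma transports_preserves_cayley:
  assumes "transports p q M" "p \<in> U" "q \<in> U"
  shows "M v \<bullet> M w = v \<bullet> w"
    and "cayley_form (M v) (M w) (M x) (M y) = cayley_form v w x y"
proof -
  obtain \<gamma> where \<gamma>: "piecewise_C1_path \<gamma>" "path_image \<gamma> \<subseteq> U" "pathstart \<gamma> = p" "pathfinish \<gamma> = q"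
     "\<And>y. \<exists>V. parallel_along g \<gamma> V \<and> V 0 = L p y \<and> V 1 = L q (M y)"
    using assms(1) unfolding transports_def by blast
  then obtain W where W: "\<And>y. parallel_along g \<gamma> (W y) \<and> W y 0 = L p y \<and> W y 1 = L q (M y)"
    by metis
  define V where "V n = (if n = 0 then W v else if n = 1 then W w else if n = 2 then W x else W y)" for n :: nat
  have ends: "\<gamma> 0 = p" "\<gamma> 1 = q" using \<gamma>(3,4) by (simp_all add: pathstart_def pathfinish_def)
  have "parallel_along g \<gamma> (V n)" for n using W by (simp add: V_def)
  note inv = parallel_invariants [where V = V, OF \<gamma>(1,2) this]
  show "M v \<bullet> M w = v \<bullet> w"
    using inv(1) [where i = 0 and j = 1] W assms(2,3) by (simp add: V_def ends)
  show "cayley_form (M v) (M w) (M x) (M y) = cayley_form v w x y"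
    using inv(2) [where i = 0 and j = 1 and k = 2 and l = 3] W assms(2,3) by (simp add: V_def ends)
qed

text \<open>Linearity of \<open>M\<close> is not part of \<open>transports\<close>; it follows
  because an isometry fixing the origin is linear.\<close>

lemma Spin7_of_transports:
  assumes "transports p p M" "p \<in> U"
  shows "M \<in> Spin7"
proof -
  note inv = transports_preserves_cayley [OF assms assms(2)]
  have "dist (M v) (M w) = dist v w" for v w
    by (simp add: dist_norm norm_eq_sqrt_inner inner_diff_left inner_diff_right inv(1))
  moreover have "M 0 = 0" using inv(1) [of 0 0] by simp
  ultimately have "orthogonal_transformation M"
    unfolding orthogonal_transformation_isometry by blast
  then show ?thesis
    unfolding Spin7_def using inv(2) orthogonal_transformation_bij orthogonal_transformation_linear by blast
qed

lemma transports_of_holonomy: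
  assumes "P \<in> holonomy_group U g p" "p \<in> U"
  shows "transports p p (inv (L p) \<circ> P \<circ> L p)"
proof -
  obtain \<gamma> where \<gamma>: "piecewise_C1_path \<gamma>" "path_image \<gamma> \<subseteq> U" "pathstart \<gamma> = p" "pathfinish \<gamma> = p"
    "\<And>v. \<exists>V. parallel_along g \<gamma> V \<and> V 0 = v \<and> V 1 = P v"
    using assms(1) unfolding holonomy_group_def parallel_transport_def by blast
  have "inv (L p) = \<theta> p" using assms(2) by (intro inv_equality) auto
  then have "L p ((inv (L p) \<circ> P \<circ> L p) y) = P (L p y)" for y using assms(2) by simp
  then show ?thesis unfolding transports_def using \<gamma> by metis
qed

theorem holonomy_contained_in_Spin7: "holonomy_contained_in U g Spin7"
  unfolding holonomy_contained_in_def
  using orthonormal_frame_L Spin7_of_transports transports_of_holonomy by blast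

theorem holonomy_equals_Spin7:
  assumes "\<And>p A. p \<in> U \<Longrightarrow> preserves_cayley A \<Longrightarrow> transports p p ((*v) A)"
  shows "holonomy_equals U g Spin7"
  unfolding holonomy_equals_def
proof (intro ballI exI conjI)
  fix p assume p: "p \<in> U"
  show "orthonormal_frame g p (L p)" by (rule orthonormal_frame_L [OF p])
  show "(\<lambda>P. inv (L p) \<circ> P \<circ> L p) ` holonomy_group U g p = Spin7"
  proof
    show "(\<lambda>P. inv (L p) \<circ> P \<circ> L p) ` holonomy_group U g p \<subseteq> Spin7"
      using Spin7_of_transports transports_of_holonomy p by blast
    show "Spin7 \<subseteq> (\<lambda>P. inv (L p) \<circ> P \<circ> L p) ` holonomy_group U g p"
    proof
      fix M assume M: "M \<in> Spin7"
      then have lin: "linear M" by (simp add: Spin7_def)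
      then have "preserves_cayley (matrix M)"
        using M by (simp add: preserves_cayley_def Spin7_def matrix_works)
      then have "transports p p ((*v) (matrix M))" by (rule assms [OF p])
      moreover have "(*v) (matrix M) = M" using lin by (simp add: fun_eq_iff matrix_works)
      ultimately show "M \<in> (\<lambda>P. inv (L p) \<circ> P \<circ> L p) ` holonomy_group U g p"
        using holonomy_of_transports p by simp
    qed
  qed
qed

end

section \<open>Smooth functions\<close>

lemma Ck_on_cong:
  assumes "open U" "\<And>p. p \<in> U \<Longrightarrow> f p = g p"
  shows "Ck_on k U f \<Longrightarrow> Ck_on k U g"
  using assms(2)
proof (induction k arbitrary: f g)
  case 0
  then show ?case using continuous_on_cong [of U U f g] by simp
next
  case (Suc k)
  have d: "(g has_derivative frechet_derivative f (at p)) (at p)" if "p \<in> U" for p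
  proof -
    have "(f has_derivative frechet_derivative f (at p)) (at p)"
      using Suc.prems(1) that frechet_derivative_works by auto
    then show ?thesis
      by (rule has_derivative_transform_within_open [OF _ assms(1) that]) (rule Suc.prems(2))
  qed
  then have "frechet_derivative f (at p) = frechet_derivative g (at p)" if "p \<in> U" for p
    using that frechet_derivative_at by blast
  then have "Ck_on k U (\<lambda>p. frechet_derivative g (at p) v)" for v
    using Suc.IH [of "\<lambda>p. frechet_derivative f (at p) v" "\<lambda>p. frechet_derivative g (at p) v"] Suc.prems by simp
  then show ?case using d by (auto intro: differentiableI)
qed

lemma Ck_on_SucI:
  assumes "open U" "\<And>p. p \<in> U \<Longrightarrow> (f has_derivative f' p) (at p)" "\<And>v. Ck_on k U (\<lambda>p. f' p v)"
  shows "Ck_on (Suc k) U f"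
proof -
  have "f' p v = frechet_derivative f (at p) v" if "p \<in> U" for p v
    using frechet_derivative_at [OF assms(2) [OF that]] by simp
  then have "Ck_on k U (\<lambda>p. frechet_derivative f (at p) v)" for v
    by (rule Ck_on_cong [OF assms(1) _ assms(3)])
  then show ?thesis using assms(2) by (auto intro: differentiableI)
qed

lemma Ck_on_frechet:
  assumes "Ck_on (Suc k) U f"
  shows "p \<in> U \<Longrightarrow> (f has_derivative frechet_derivative f (at p)) (at p)"
    and "Ck_on k U (\<lambda>p. frechet_derivative f (at p) v)"
  using assms frechet_derivative_works by auto

lemma Ck_on_Suc_imp: "Ck_on (Suc k) U f \<Longrightarrow> Ck_on k U f"
proof (induction k arbitrary: f)
  case 0
  then show ?case
    by (auto intro!: continuous_at_imp_continuous_on differentiable_imp_continuous_within)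
qed auto

lemma Ck_on_const:
  assumes "open U"
  shows "Ck_on k U (\<lambda>p. c)"
proof (induction k arbitrary: c)
  case (Suc k)
  show ?case by (rule Ck_on_SucI [OF assms has_derivative_const Suc])
qed simp

lemma Ck_on_linear:
  assumes "open U" "bounded_linear f"
  shows "Ck_on k U f"
proof (cases k)
  case 0
  then show ?thesis using linear_continuous_on [OF assms(2)] by simp
next
  case (Suc n)
  then show ?thesis
    using Ck_on_SucI [OF assms(1) bounded_linear_imp_has_derivative [OF assms(2)]] Ck_on_const [OF assms(1)]
    by blast
qed

lemma Ck_on_add:
  assumes "open U"
  shows "Ck_on k U f \<Longrightarrow> Ck_on k U g \<Longrightarrow> Ck_on k U (\<lambda>p. f p + g p)"
proof (induction k arbitrary: f g)
  case 0
  then show ?case by (simp add: continuous_on_add continuous_on_mult)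
next
  case (Suc k)
  note f = Ck_on_frechet [OF Suc.prems(1)] and g = Ck_on_frechet [OF Suc.prems(2)]
  show ?case
  proof (rule Ck_on_SucI [OF assms])
    show "((\<lambda>p. f p + g p) has_derivative
        (\<lambda>h. frechet_derivative f (at p) h + frechet_derivative g (at p) h)) (at p)" if "p \<in> U" for p
      by (intro has_derivative_add f(1) g(1) that)
    show "Ck_on k U (\<lambda>p. frechet_derivative f (at p) v + frechet_derivative g (at p) v)" for v
      by (intro Suc.IH f(2) g(2))
  qed
qed

lemma Ck_on_mult:
  assumes "open U"
  shows "Ck_on k U f \<Longrightarrow> Ck_on k U g \<Longrightarrow> Ck_on k U (\<lambda>p. f p * g p)"
proof (induction k arbitrary: f g)
  case 0
  then show ?case by (simp add: continuous_on_add continuous_on_mult)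
next
  case (Suc k)
  note f = Ck_on_frechet [OF Suc.prems(1)] and g = Ck_on_frechet [OF Suc.prems(2)]
  show ?case
  proof (rule Ck_on_SucI [OF assms])
    show "((\<lambda>p. f p * g p) has_derivative
        (\<lambda>h. f p * frechet_derivative g (at p) h + frechet_derivative f (at p) h * g p)) (at p)" if "p \<in> U" for p
      by (intro has_derivative_mult f(1) g(1) that)
    show "Ck_on k U (\<lambda>p. f p * frechet_derivative g (at p) v + frechet_derivative f (at p) v * g p)" for v
      by (intro Ck_on_add [OF assms] Suc.IH f(2) g(2) Ck_on_Suc_imp [OF Suc.prems(1)] Ck_on_Suc_imp [OF Suc.prems(2)])
  qed
qed

lemma Ck_on_inverse:
  assumes "open U" "\<And>p. p \<in> U \<Longrightarrow> f p \<noteq> 0"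
  shows "Ck_on k U f \<Longrightarrow> Ck_on k U (\<lambda>p. inverse (f p))"
proof (induction k)
  case 0
  then show ?case using assms(2) by (auto intro!: continuous_intros)
next
  case (Suc k)
  note f = Ck_on_frechet [OF Suc.prems]
  have i: "Ck_on k U (\<lambda>p. inverse (f p))" by (rule Suc.IH [OF Ck_on_Suc_imp [OF Suc.prems]])
  have "Ck_on k U (\<lambda>p. (- 1) * (inverse (f p) * frechet_derivative f (at p) v * inverse (f p)))" for v
    by (intro Ck_on_mult [OF assms(1)] Ck_on_const [OF assms(1)] i f(2))
  then have "Ck_on k U (\<lambda>p. - (inverse (f p) * frechet_derivative f (at p) v * inverse (f p)))" for v
    by simp
  then show ?case
    by (intro Ck_on_SucI [OF assms(1) Deriv.has_derivative_inverse [OF assms(2) f(1)]])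
qed

lemma has_derivative_vec:
  fixes f :: "'a::real_normed_vector \<Rightarrow> real^'n"
  assumes "\<And>i. ((\<lambda>x. f x $ i) has_derivative (\<lambda>h. f' h $ i)) (at x within S)"
  shows "(f has_derivative f') (at x within S)"
proof (subst has_derivative_componentwise_within, rule ballI)
  fix b :: "real^'n" assume "b \<in> Basis"
  then obtain i where "b = axis i 1" unfolding Basis_vec_def by auto
  then show "((\<lambda>x. f x \<bullet> b) has_derivative (\<lambda>h. f' h \<bullet> b)) (at x within S)"
    using assms [of i] by (simp add: inner_axis)
qed

lemma differentiable_vec:
  fixes f :: "'a::real_normed_vector \<Rightarrow> real^'n"
  assumes "\<And>i. (\<lambda>x. f x $ i) differentiable (at x within S)"
  shows "f differentiable (at x within S)"
proof -
  have "\<forall>i. \<exists>D. ((\<lambda>x. f x $ i) has_derivative D) (at x within S)"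
    using assms by (simp add: differentiable_def)
  then obtain D where "\<And>i. ((\<lambda>x. f x $ i) has_derivative D i) (at x within S)" by metis
  then have "(f has_derivative (\<lambda>h. \<chi> i. D i h)) (at x within S)"
    by (intro has_derivative_vec) simp
  then show ?thesis by (rule differentiableI)
qed

lemma has_derivative_snd_comp:
  assumes "(f has_real_derivative f') (at (snd p))"
  shows "((\<lambda>q. f (snd q)) has_derivative (\<lambda>h. f' * snd h)) (at p)"
  using diff_chain_at [OF bounded_linear_imp_has_derivative [OF bounded_linear_snd] assms [unfolded has_field_derivative_def]]
  by (simp add: o_def)

lemma vector_7 [simp]:
  "(vector [a,b,c,d,e,f,g] ::('a::zero)^7) $ 1 = a"
  "(vector [a,b,c,d,e,f,g] ::('a::zero)^7) $ 2 = b"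
  "(vector [a,b,c,d,e,f,g] ::('a::zero)^7) $ 3 = c"
  "(vector [a,b,c,d,e,f,g] ::('a::zero)^7) $ 4 = d"
  "(vector [a,b,c,d,e,f,g] ::('a::zero)^7) $ 5 = e"
  "(vector [a,b,c,d,e,f,g] ::('a::zero)^7) $ 6 = f"
  "(vector [a,b,c,d,e,f,g] ::('a::zero)^7) $ 7 = g"
  unfolding vector_def by simp_all

section \<open>The coframe of the metric\<close>

locale heis =
  fixes C a1 a2 a3 :: real and I :: "real set"
  assumes C: "C > 0" and open_I: "open I" and pos: "u \<in> I \<Longrightarrow> (u + a1) * (u + a2) * (a3 - u) > 0"
begin

definition "P u = (u + a1) * (u + a2) * (a3 - u)"
definition "P' u = (u + a2) * (a3 - u) + (u + a1) * (a3 - u) - (u + a1) * (u + a2)"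
definition "rho = sqrt (2 / C)"
definition "beta = sqrt (C^3 / 8)"
definition "mu u = sqrt (C * P u)"
text \<open>\<open>sa\<close>, \<open>sb\<close>, \<open>sc\<close> are the factors
  \<open>r\<close>, \<open>s\<close>, \<open>t\<close> of the structure equations behind
  \<open>lc\<close>. The \<open>du\<close> terms come from differentiating
  \<open>1 / (u + a1)\<close>, \<open>1 / (u + a2)\<close> and \<open>1 / (a3 - u)\<close>; the last
  denominator decreases in \<open>u\<close>, whence the sign of \<open>sc\<close>.\<close>

definition "sa u = 1 / (beta * P u * (u + a1))"
definition "sb u = 1 / (beta * P u * (u + a2))"
definition "sc u = - 1 / (beta * P u * (a3 - u))"

definition coframe :: "(real^7) \<times> real \<Rightarrow> (real^7) \<times> real \<Rightarrow> real^8" where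
  "coframe p w = vector [beta * P (snd p) * snd w, rho / (snd p + a1) * eta1 (fst p) (fst w),
     rho / (snd p + a2) * eta2 (fst p) (fst w), rho / (a3 - snd p) * eta3 (fst p) (fst w),
     mu (snd p) * fst w $ 1, mu (snd p) * fst w $ 2, mu (snd p) * fst w $ 3, mu (snd p) * fst w $ 4]"

definition frame :: "(real^7) \<times> real \<Rightarrow> real^8 \<Rightarrow> (real^7) \<times> real" where
  "frame p y = (let x = fst p; u = snd p; m = 1 / mu u in
     (vector [m * y $ 5, m * y $ 6, m * y $ 7, m * y $ 8,
       (u + a1) / rho * y $ 2 - 2 * x $ 1 * (m * y $ 6) - 2 * x $ 3 * (m * y $ 8),
       (u + a2) / rho * y $ 3 - 2 * x $ 1 * (m * y $ 7) - 2 * x $ 4 * (m * y $ 6),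
       (a3 - u) / rho * y $ 4 - 2 * x $ 1 * (m * y $ 8) - 2 * x $ 2 * (m * y $ 7)],
      y $ 1 / (beta * P u)))"

definition dcoframe :: "(real^7) \<times> real \<Rightarrow> (real^7) \<times> real \<Rightarrow> (real^7) \<times> real \<Rightarrow> real^8" where
  "dcoframe p c w = (let u = snd p; v = fst c; t = snd c; z = fst w; m = C * P' u / (2 * mu u) in
     vector [beta * P' u * t * snd w,
       rho / (u + a1) * (2 * v $ 1 * z $ 2 + 2 * v $ 3 * z $ 4) - rho / (u + a1)^2 * t * eta1 (fst p) z,
       rho / (u + a2) * (2 * v $ 1 * z $ 3 + 2 * v $ 4 * z $ 2) - rho / (u + a2)^2 * t * eta2 (fst p) z,
       rho / (a3 - u) * (2 * v $ 1 * z $ 4 + 2 * v $ 2 * z $ 3) + rho / (a3 - u)^2 * t * eta3 (fst p) z,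
       m * t * z $ 1, m * t * z $ 2, m * t * z $ 3, m * t * z $ 4])"

definition conn :: "(real^7) \<times> real \<Rightarrow> real^8 \<Rightarrow> real^8 \<Rightarrow> real^8" where
  "conn p y z = (\<Sum>m\<in>UNIV. y $ m *\<^sub>R gen m (lc (sa (snd p)) (sb (snd p)) (sc (snd p)) m)) *v z"

lemma nonzero:
  assumes "u \<in> I"
  shows "P u > 0" "mu u > 0" "u + a1 \<noteq> 0" "u + a2 \<noteq> 0" "a3 - u \<noteq> 0" "rho > 0" "beta > 0"
proof -
  have *: "(u + a1) * (u + a2) * (a3 - u) > 0" using pos [OF assms] .
  then show "P u > 0" by (simp add: P_def)
  with C show "mu u > 0" by (simp add: mu_def)
  show "u + a1 \<noteq> 0" "u + a2 \<noteq> 0" "a3 - u \<noteq> 0" using * by auto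
  show "rho > 0" "beta > 0" using C by (simp_all add: rho_def beta_def)
qed

lemma squares:
  "rho * rho = 2 / C" "beta * beta = C^3 / 8" "u \<in> I \<Longrightarrow> mu u * mu u = C * P u" "2 * rho * beta = C"
proof -
  show "rho * rho = 2 / C" "beta * beta = C^3 / 8" using C by (simp_all add: rho_def beta_def)
  show "mu u * mu u = C * P u" if "u \<in> I"
  proof -
    have "C * P u \<ge> 0" using C nonzero(1) [OF that] by simp
    then show ?thesis by (simp add: mu_def)
  qed
  have "rho * beta = sqrt ((C / 2)\<^sup>2)"
    unfolding rho_def beta_def real_sqrt_mult [symmetric] using C
    by (simp add: power2_eq_square power3_eq_cube)
  then show "2 * rho * beta = C" using C by simp
qed

text \<open>Written with products and inverses only, so that the closure rules for
  \<open>Ck_on\<close> apply term by term.\<close>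

lemma heis_metric_alt:
  "heis_metric C a1 a2 a3 p v w =
     C * P (snd p) * (fst v $ 1 * fst w $ 1 + fst v $ 2 * fst w $ 2 + fst v $ 3 * fst w $ 3 + fst v $ 4 * fst w $ 4)
     + 2 / C * (inverse (snd p + a1) * inverse (snd p + a1)) * (eta1 (fst p) (fst v) * eta1 (fst p) (fst w))
     + 2 / C * (inverse (snd p + a2) * inverse (snd p + a2)) * (eta2 (fst p) (fst v) * eta2 (fst p) (fst w))
     + 2 / C * (inverse (a3 - snd p) * inverse (a3 - snd p)) * (eta3 (fst p) (fst v) * eta3 (fst p) (fst w))
     + C^3 / 8 * (P (snd p) * P (snd p)) * (snd v * snd w)"
proof -
  obtain x u v' s w' t where "p = (x, u)" "v = (v', s)" "w = (w', t)" by (metis surj_pair)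
  then show ?thesis
    by (simp only: heis_metric.simps P_def fst_conv snd_conv power2_eq_square divide_inverse
        inverse_mult_distrib mult_1_left mult_ac)
qed

lemma heis_metric_smooth: "smooth_on (UNIV \<times> I) (\<lambda>p. heis_metric C a1 a2 a3 p v w)"
proof -
  let ?U = "UNIV \<times> I :: ((real^7) \<times> real) set"
  have U: "open ?U" using open_I by (intro open_Times) auto
  have x: "Ck_on k ?U (\<lambda>p. fst p $ i)" for k i
    by (rule Ck_on_linear [OF U])
      (intro bounded_linear_compose [OF bounded_linear_vec_nth bounded_linear_fst])
  have u: "Ck_on k ?U snd" for k
    by (rule Ck_on_linear [OF U bounded_linear_snd])
  have q: "Ck_on k ?U (\<lambda>p. snd p + c)" for k c
    by (intro Ck_on_const [OF U] Ck_on_add [OF U] u)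
  have q3: "Ck_on k ?U (\<lambda>p. a3 - snd p)" for k
  proof -
    have "Ck_on k ?U (\<lambda>p. a3 + (- 1) * snd p)"
      by (intro Ck_on_const [OF U] Ck_on_add [OF U] Ck_on_mult [OF U] u)
    then show ?thesis by simp
  qed
  have nz: "snd p + a1 \<noteq> 0" "snd p + a2 \<noteq> 0" "a3 - snd p \<noteq> 0" if "p \<in> ?U" for p
    using nonzero(3-5) [of "snd p"] that by auto
  have inv: "Ck_on k ?U (\<lambda>p. inverse (snd p + a1))" "Ck_on k ?U (\<lambda>p. inverse (snd p + a2))"
    "Ck_on k ?U (\<lambda>p. inverse (a3 - snd p))" for k
    by (rule Ck_on_inverse [OF U nz(1) q] Ck_on_inverse [OF U nz(2) q] Ck_on_inverse [OF U nz(3) q3], assumption)+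
  have eta: "Ck_on k ?U (\<lambda>p. eta1 (fst p) z)" "Ck_on k ?U (\<lambda>p. eta2 (fst p) z)" "Ck_on k ?U (\<lambda>p. eta3 (fst p) z)" for k z
    unfolding eta1_def eta2_def eta3_def
    by (intro Ck_on_const [OF U] Ck_on_add [OF U] Ck_on_mult [OF U] x)+
  show ?thesis
    unfolding smooth_on_def heis_metric_alt P_def
    by (intro allI Ck_on_const [OF U] Ck_on_add [OF U] Ck_on_mult [OF U] u q q3 inv eta)
qed

lemma P_deriv: "(P has_real_derivative P' u) (at u)"
  unfolding P_def [abs_def] P'_def by (auto intro!: derivative_eq_intros simp: algebra_simps)

lemma mu_deriv:
  assumes "u \<in> I"
  shows "(mu has_real_derivative C * P' u / (2 * mu u)) (at u)"
proof -
  have "C * P u > 0" using C nonzero(1) [OF assms] by simp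
  then have "((\<lambda>u. sqrt (C * P u)) has_real_derivative inverse (sqrt (C * P u)) / 2 * (C * P' u)) (at u)"
    by (intro DERIV_chain2 [where f = sqrt and g = "\<lambda>u. C * P u"] DERIV_real_sqrt DERIV_cmult P_deriv)
  then have "(mu has_real_derivative inverse (mu u) / 2 * (C * P' u)) (at u)"
    by (simp only: mu_def [abs_def])
  moreover have "inverse (mu u) / 2 * (C * P' u) = C * P' u / (2 * mu u)"
    by (simp add: inverse_eq_divide)
  ultimately show ?thesis by (simp only:)
qed

lemma coframe_deriv:
  assumes "snd p \<in> I"
  shows "((\<lambda>q. coframe q w) has_derivative (\<lambda>c. dcoframe p c w)) (at p)"
proof (rule has_derivative_vec)
  let ?u = "snd p"
  note nz = nonzero [OF assms]
  have fst_nth: "((\<lambda>q. fst q $ i) has_derivative (\<lambda>h. fst h $ i)) (at p)" for i :: 7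
    by (intro bounded_linear_imp_has_derivative bounded_linear_compose [OF bounded_linear_vec_nth bounded_linear_fst])
  have eta: "((\<lambda>q. eta1 (fst q) z) has_derivative (\<lambda>h. 2 * fst h $ 1 * z $ 2 + 2 * fst h $ 3 * z $ 4)) (at p)"
    "((\<lambda>q. eta2 (fst q) z) has_derivative (\<lambda>h. 2 * fst h $ 1 * z $ 3 + 2 * fst h $ 4 * z $ 2)) (at p)"
    "((\<lambda>q. eta3 (fst q) z) has_derivative (\<lambda>h. 2 * fst h $ 1 * z $ 4 + 2 * fst h $ 2 * z $ 3)) (at p)" for z
    unfolding eta1_def eta2_def eta3_def by (auto intro!: derivative_eq_intros fst_nth)
  note dP = P_deriv [of ?u] and dmu = mu_deriv [OF assms]
  have d1: "((\<lambda>u. rho / (u + a1)) has_real_derivative - (rho / (?u + a1)^2)) (at ?u)"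
    and d2: "((\<lambda>u. rho / (u + a2)) has_real_derivative - (rho / (?u + a2)^2)) (at ?u)"
    and d3: "((\<lambda>u. rho / (a3 - u)) has_real_derivative rho / (a3 - ?u)^2) (at ?u)"
    using nz by (auto intro!: derivative_eq_intros simp: power2_eq_square)
  note ds = has_derivative_snd_comp
  note prods = has_derivative_mult_left [OF has_derivative_mult_right [OF ds [OF dP]]]
    has_derivative_mult [OF ds [OF d1] eta(1)] has_derivative_mult [OF ds [OF d2] eta(2)]
    has_derivative_mult [OF ds [OF d3] eta(3)] has_derivative_mult_left [OF ds [OF dmu]]
  have "\<forall>i. ((\<lambda>q. coframe q w $ i) has_derivative (\<lambda>c. dcoframe p c w $ i)) (at p)"
    unfolding forall_8 coframe_def dcoframe_def Let_def vector_8
    by (intro conjI; rule has_derivative_eq_rhs, rule prods, simp add: fun_eq_iff algebra_simps)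
  then show "((\<lambda>q. coframe q w $ i) has_derivative (\<lambda>c. dcoframe p c w $ i)) (at p)" for i
    by blast
qed

lemma frame_differentiable:
  assumes "snd p \<in> I"
  shows "(\<lambda>q. frame q y) differentiable (at p)"
proof -
  let ?u = "snd p"
  note nz = nonzero [OF assms]
  have fst_nth: "(\<lambda>q. fst q $ i) differentiable (at p)" for i :: 7
    by (intro bounded_linear_imp_differentiable bounded_linear_compose [OF bounded_linear_vec_nth bounded_linear_fst])
  note dP = P_deriv [of ?u] and dmu = mu_deriv [OF assms]
  have P: "(\<lambda>q. P (snd q)) differentiable (at p)" and mu: "(\<lambda>q. mu (snd q)) differentiable (at p)"
    using has_derivative_snd_comp [OF dP] has_derivative_snd_comp [OF dmu] by (auto intro: differentiableI)
  have snd: "snd differentiable (at p)"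
    by (rule bounded_linear_imp_differentiable [OF bounded_linear_snd])
  have "(\<lambda>q. fst (frame q y)) differentiable (at p)"
  proof (rule differentiable_vec)
    fix i
    show "(\<lambda>q. fst (frame q y) $ i) differentiable (at p)"
      using exhaust_7 [of i] nz
      by (elim disjE)
        (auto simp: frame_def Let_def intro!: differentiable_mult differentiable_divide differentiable_diff
          differentiable_add differentiable_const fst_nth mu snd)
  qed
  moreover have "(\<lambda>q. snd (frame q y)) differentiable (at p)"
    using nz by (auto simp: frame_def Let_def intro!: differentiable_divide differentiable_mult P)
  ultimately have "(\<lambda>q. (fst (frame q y), snd (frame q y))) differentiable (at p)"
    unfolding differentiable_def using has_derivative_Pair by blast
  then show ?thesis by simp
qed

text \<open>The antisymmetrised derivative of the coframe and the antisymmetrised connection are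
  both compared with the right hand side \<open>s\<close> of the structure equations.\<close>

lemma coframe_torsion:
  assumes "snd p \<in> I"
  shows "dcoframe p c w + conn p (coframe p c) (coframe p w) = dcoframe p w c + conn p (coframe p w) (coframe p c)"
proof -
  define u where "u = snd p"
  define y where "y = coframe p c"
  define z where "z = coframe p w"
  have u: "u \<in> I" using assms by (simp add: u_def)
  note nz = nonzero [OF u]
  \<comment> \<open>\<open>k1\<close> governs the derivative of the fibre coefficients;
    \<open>k2\<close> governs the exterior derivatives of the \<open>\<eta>\<close> forms, through
    \<open>mu u * mu u = C * P u\<close> and \<open>2 * rho * beta = C\<close>; \<open>k3\<close> is
    the logarithmic derivative of \<open>mu\<close>, by partial fractions.\<close>
  have k1: "sa u * (beta * P u) = 1 / (u + a1)" "sb u * (beta * P u) = 1 / (u + a2)" "sc u * (beta * P u) = - 1 / (a3 - u)"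
    using nz by (simp_all add: sa_def sb_def sc_def)
  have m: "x * (mu u * mu u) = 2 * rho * (x * (beta * P u))" for x
  proof -
    have "x * (mu u * mu u) = x * (C * P u)" by (simp only: squares(3) [OF u])
    also have "\<dots> = x * ((2 * rho * beta) * P u)" by (simp only: squares(4))
    also have "\<dots> = 2 * rho * (x * (beta * P u))" by (simp only: mult_ac)
    finally show ?thesis .
  qed
  have k2: "sa u * (mu u * mu u) = 2 * rho / (u + a1)" "sb u * (mu u * mu u) = 2 * rho / (u + a2)"
    "sc u * (mu u * mu u) = - 2 * rho / (a3 - u)"
    using m [of "sa u"] m [of "sb u"] m [of "sc u"] unfolding k1 by simp_all
  have k3: "C * P' u / (2 * mu u) = (sa u + sb u + sc u) / 2 * (beta * P u) * mu u"
  proof -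
    have partial_fractions: "1 / x + 1 / y - 1 / z = (y * z + x * z - x * y) / (x * y * z)"
      if "x \<noteq> 0" "y \<noteq> 0" "z \<noteq> 0" for x y z :: real
      using that by (simp add: field_simps)
    have "(sa u + sb u + sc u) * (beta * P u) = 1 / (u + a1) + 1 / (u + a2) - 1 / (a3 - u)"
      by (simp add: distrib_right k1)
    also have "\<dots> = P' u / P u"
      unfolding P'_def P_def by (rule partial_fractions [OF nz(3-5)])
    finally have "(sa u + sb u + sc u) / 2 * (beta * P u) * mu u = P' u / P u * mu u / 2" by simp
    also have "\<dots> = P' u * (mu u * mu u) / (2 * P u * mu u)" using nz by simp
    also have "\<dots> = C * P' u / (2 * mu u)" unfolding squares(3) [OF u] using nz by simp
    finally show ?thesis by simp
  qed
  define s where "s = (vector [0,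
      sa u * (- (y$1 * z$2 - y$2 * z$1) + (y$5 * z$6 - y$6 * z$5) + (y$7 * z$8 - y$8 * z$7)),
      sb u * (- (y$1 * z$3 - y$3 * z$1) + (y$5 * z$7 - y$7 * z$5) - (y$6 * z$8 - y$8 * z$6)),
      sc u * (- (y$1 * z$4 - y$4 * z$1) - (y$5 * z$8 - y$8 * z$5) - (y$6 * z$7 - y$7 * z$6)),
      (sa u + sb u + sc u) / 2 * (y$1 * z$5 - y$5 * z$1), (sa u + sb u + sc u) / 2 * (y$1 * z$6 - y$6 * z$1),
      (sa u + sb u + sc u) / 2 * (y$1 * z$7 - y$7 * z$1), (sa u + sb u + sc u) / 2 * (y$1 * z$8 - y$8 * z$1)] :: real^8)"
  have "\<forall>i. (dcoframe p c w - dcoframe p w c) $ i = s $ i"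
  proof -
    let ?v = "fst c" and ?z = "fst w" and ?t = "snd c" and ?r = "snd w"
    have "s $ 2 = - (sa u * (beta * P u)) * (rho / (u + a1)) * (?t * eta1 (fst p) ?z - ?r * eta1 (fst p) ?v)
        + (sa u * (mu u * mu u)) * (?v$1 * ?z$2 - ?v$2 * ?z$1 + ?v$3 * ?z$4 - ?v$4 * ?z$3)"
      by (simp add: s_def y_def z_def coframe_def u_def [symmetric] algebra_simps add_divide_distrib diff_divide_distrib)
    then have c2: "(dcoframe p c w - dcoframe p w c) $ 2 = s $ 2"
      unfolding k1 k2 by (simp add: dcoframe_def Let_def u_def [symmetric] power2_eq_square algebra_simps add_divide_distrib diff_divide_distrib)
    have "s $ 3 = - (sb u * (beta * P u)) * (rho / (u + a2)) * (?t * eta2 (fst p) ?z - ?r * eta2 (fst p) ?v)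
        + (sb u * (mu u * mu u)) * (?v$1 * ?z$3 - ?v$3 * ?z$1 - ?v$2 * ?z$4 + ?v$4 * ?z$2)"
      by (simp add: s_def y_def z_def coframe_def u_def [symmetric] algebra_simps add_divide_distrib diff_divide_distrib)
    then have c3: "(dcoframe p c w - dcoframe p w c) $ 3 = s $ 3"
      unfolding k1 k2 by (simp add: dcoframe_def Let_def u_def [symmetric] power2_eq_square algebra_simps add_divide_distrib diff_divide_distrib)
    have "s $ 4 = - (sc u * (beta * P u)) * (rho / (a3 - u)) * (?t * eta3 (fst p) ?z - ?r * eta3 (fst p) ?v)
        - (sc u * (mu u * mu u)) * (?v$1 * ?z$4 - ?v$4 * ?z$1 + ?v$2 * ?z$3 - ?v$3 * ?z$2)"
      by (simp add: s_def y_def z_def coframe_def u_def [symmetric] algebra_simps add_divide_distrib diff_divide_distrib)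
    then have c4: "(dcoframe p c w - dcoframe p w c) $ 4 = s $ 4"
      unfolding k1 k2 by (simp add: dcoframe_def Let_def u_def [symmetric] power2_eq_square algebra_simps add_divide_distrib diff_divide_distrib)
    have c1: "(dcoframe p c w - dcoframe p w c) $ 1 = s $ 1"
      by (simp add: dcoframe_def Let_def s_def)
    have scale: "K * t * z - K * r * v = S * (B * t * (m * z) - m * v * (B * r))"
      if "K = S * B * m" for K S B m t z r v :: real
      using that by (simp add: algebra_simps)
    then have "(dcoframe p c w - dcoframe p w c) $ 5 = s $ 5" "(dcoframe p c w - dcoframe p w c) $ 6 = s $ 6"
      "(dcoframe p c w - dcoframe p w c) $ 7 = s $ 7" "(dcoframe p c w - dcoframe p w c) $ 8 = s $ 8"
      unfolding dcoframe_def Let_def vector_minus_component s_def y_def z_def coframe_def u_def [symmetric] vector_8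
      using k3 by blast+
    with c1 c2 c3 c4 show ?thesis unfolding forall_8 by blast
  qed
  then have "dcoframe p c w - dcoframe p w c = s" unfolding vec_eq_iff by blast
  moreover have "s = conn p z y - conn p y z"
  proof -
    have cn: "conn p y z $ i = (\<Sum>m\<in>UNIV. y $ m * (lc (sa u) (sb u) (sc u) m $ i * z $ sg m i))" for y z i
      unfolding conn_def u_def
      by (simp add: mv.sum_left mv.scaleR_left)
    have l1: "lc (sa u) (sb u) (sc u) 1 = 0" by (simp add: lc_def Let_def)
    have "\<forall>i. s $ i = conn p z y $ i - conn p y z $ i"
      unfolding forall_8 cn sum_8 by (simp add: s_def lc_simps l1 field_simps)
    then show ?thesis unfolding vec_eq_iff vector_minus_component by blast
  qed
  ultimately have "dcoframe p c w - dcoframe p w c = conn p z y - conn p y z" by simp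
  then show ?thesis unfolding y_def z_def by (simp add: algebra_simps)
qed

end

context heis
begin

lemma conn_alt:
  "conn p y z = (\<Sum>m\<in>UNIV. y $ m *\<^sub>R (gen m (lc (sa (snd p)) (sb (snd p)) (sc (snd p)) m) *v z))"
  by (simp add: conn_def mv.sum_left mv.scaleR_left)

sublocale spin_coframe "UNIV \<times> I" "heis_metric C a1 a2 a3" coframe frame dcoframe conn
proof (intro spin_coframe.intro moving_coframe.intro spin_coframe_axioms.intro)
  show "open (UNIV \<times> I :: ((real^7) \<times> real) set)" using open_I by (intro open_Times) auto
next
  fix p :: "(real^7) \<times> real" assume "p \<in> UNIV \<times> I"
  then have u: "snd p \<in> I" by auto
  note nz = nonzero [OF u]
  show "linear (coframe p)"
    by (rule linearI) (simp_all add: vec_eq_iff forall_8 coframe_def eta1_def eta2_def eta3_def algebra_simps)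
  show "linear (frame p)"
    by (rule linearI; rule prod_eqI) (simp_all add: vec_eq_iff forall_7 frame_def Let_def algebra_simps add_divide_distrib)
  show "coframe p (frame p y) = y" for y
    using nz by (simp add: vec_eq_iff forall_8 coframe_def frame_def Let_def eta1_def eta2_def eta3_def)
  show "frame p (coframe p v) = v" for v
    using nz by (intro prod_eqI) (simp_all add: vec_eq_iff forall_7 coframe_def frame_def Let_def eta1_def eta2_def eta3_def)
  show "heis_metric C a1 a2 a3 p v w = coframe p v \<bullet> coframe p w" for v w
  proof -
    have "coframe p v \<bullet> coframe p w = (beta * beta) * (P (snd p) * P (snd p)) * (snd v * snd w)
      + (rho * rho) * (inverse (snd p + a1) * inverse (snd p + a1)) * (eta1 (fst p) (fst v) * eta1 (fst p) (fst w))
      + (rho * rho) * (inverse (snd p + a2) * inverse (snd p + a2)) * (eta2 (fst p) (fst v) * eta2 (fst p) (fst w))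
      + (rho * rho) * (inverse (a3 - snd p) * inverse (a3 - snd p)) * (eta3 (fst p) (fst v) * eta3 (fst p) (fst w))
      + (mu (snd p) * mu (snd p)) * (fst v $ 1 * fst w $ 1 + fst v $ 2 * fst w $ 2 + fst v $ 3 * fst w $ 3 + fst v $ 4 * fst w $ 4)"
      unfolding inner_8 coframe_def vector_8 divide_inverse by algebra
    then show ?thesis
      unfolding heis_metric_alt squares(1,2) squares(3) [OF u] by simp
  qed
  show "((\<lambda>q. coframe q w) has_derivative (\<lambda>c. dcoframe p c w)) (at p)" for w
    by (rule coframe_deriv [OF u])
  show "linear (dcoframe p c)" for c
    by (rule linearI)
      (simp_all add: vec_eq_iff forall_8 dcoframe_def Let_def eta1_def eta2_def eta3_def algebra_simps
        add_divide_distrib diff_divide_distrib)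
  show "(\<lambda>q. frame q y) differentiable (at p)" for y by (rule frame_differentiable [OF u])
  show "dcoframe p c w + conn p (coframe p c) (coframe p w) = dcoframe p w c + conn p (coframe p w) (coframe p c)" for c w
    by (rule coframe_torsion [OF u])
next
  fix p :: "(real^7) \<times> real" and y z z'
  show "linear (\<lambda>y. conn p y z)"
    by (rule linearI) (simp_all add: conn_alt sum.distrib scaleR_add_left scaleR_sum_right)
  show "linear (conn p y)"
    by (rule linearI)
      (simp_all add: conn_alt mv.add_right mv.scaleR_right sum.distrib scaleR_add_right scaleR_sum_right mult.commute)
  let ?X = "\<lambda>m. gen m (lc (sa (snd p)) (sb (snd p)) (sc (snd p)) m)"
  have gen1: "?X 1 = 0" by (simp add: lc_def Let_def gen_def vec_eq_iff)
  have "(?X m *v z) \<bullet> z' = - (z \<bullet> (?X m *v z'))" for m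
  proof (cases "m = 1")
    case False
    let ?c = "lc (sa (snd p)) (sb (snd p)) (sc (snd p)) m"
    have "?c $ sg m i = - ?c $ i" for i using adm_lc [OF False] by (simp add: adm_def)
    \<comment> \<open>Reindexing by the involution \<open>sg m\<close> turns oddness of the
      coefficients into skewness of the matrix.\<close>
    then have "(\<Sum>i\<in>UNIV. ?c $ i * z $ sg m i * z' $ i) = (\<Sum>i\<in>UNIV. - (z $ i * (?c $ i * z' $ sg m i)))"
      by (intro sum.reindex_bij_witness [where i = "sg m" and j = "sg m"]) (auto simp: sg_sg)
    then show ?thesis by (simp add: inner_vec_def sum_negf)
  qed (use gen1 in \<open>simp\<close>)
  then show "conn p y z \<bullet> z' = - (z \<bullet> conn p y z')"
    by (simp add: conn_alt inner_sum_left inner_sum_right sum_negf)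
next
  fix p :: "(real^7) \<times> real" and y v w x z
  let ?X = "\<lambda>m. gen m (lc (sa (snd p)) (sb (snd p)) (sc (snd p)) m)"
  have "cayley_action (?X m) v w x z = 0" for m
  proof (cases "m = 1")
    case True
    then have "?X m = 0" by (simp add: lc_def Let_def gen_def vec_eq_iff)
    then show ?thesis using cayley_form_linear [THEN linear_0] by (simp add: cayley_action_def)
  qed (intro cayley_action_gen_adm adm_lc)
  then have "(\<Sum>m\<in>UNIV. y $ m * cayley_action (?X m) v w x z) = 0" by simp
  then show "cayley_form (conn p y v) w x z + cayley_form v (conn p y w) x z
    + cayley_form v w (conn p y x) z + cayley_form v w x (conn p y z) = 0"
    by (simp add: cayley_form_linear [THEN linear_sum] conn_alt cayley_form_scaleR cayley_action_def sum.distrib distrib_left)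
qed

theorem riemannian: "riemannian_metric_on (UNIV \<times> I) (heis_metric C a1 a2 a3)"
  unfolding riemannian_metric_on_def
  using open_U riemannian_pointwise heis_metric_smooth by blast

end

section \<open>Full holonomy near minus infinity\<close>

lemma has_vector_derivative_matrix:
  fixes A :: "real \<Rightarrow> real^'n^'m"
  assumes "\<And>i j. ((\<lambda>t. A t $ i $ j) has_real_derivative D $ i $ j) (at x within S)"
  shows "(A has_vector_derivative D) (at x within S)"
  unfolding has_vector_derivative_def
proof (subst has_derivative_componentwise_within, rule ballI)
  fix b :: "real^'n^'m" assume "b \<in> Basis"
  then obtain i c where "b = axis i c" "c \<in> Basis" unfolding Basis_vec_def by auto
  then obtain j where b: "b = axis i (axis j 1)" unfolding Basis_vec_def by auto
  show "((\<lambda>t. A t \<bullet> b) has_derivative (\<lambda>h. h *\<^sub>R D \<bullet> b)) (at x within S)"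
    using assms [of i j] unfolding b inner_axis has_field_derivative_def
    by (simp add: mult_commute_abs inner_axis)
qed

lemma rot_matrix_derivative:
  assumes "adm m c"
  shows "((\<lambda>t. rot m c (a * t)) has_vector_derivative a *\<^sub>R gen m c) (at 0)"
proof (rule has_vector_derivative_matrix)
  fix i j
  have m: "m \<noteq> 1" using assms by (simp add: adm_def)
  show "((\<lambda>t. rot m c (a * t) $ i $ j) has_real_derivative (a *\<^sub>R gen m c) $ i $ j) (at 0)"
    using sg_neq [OF m, of i]
    by (cases "j = i"; cases "j = sg m i") (auto simp: rot_def gen_def intro!: derivative_eq_intros)
qed

lemma continuous_on_rot: "continuous_on UNIV (\<lambda>t. rot m c (a * t))"
  unfolding rot_def
proof (intro continuous_on_vec_lambda)
  fix i j
  show "continuous_on UNIV (\<lambda>t. if j = i then cos (c $ i * (a * t)) else if j = sg m i then sin (c $ i * (a * t)) else 0)"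
    by (cases "j = i"; cases "j = sg m i") (auto intro!: continuous_intros)
qed

text \<open>Subspaces are closed, so they contain the velocities of their curves.\<close>

lemma subspace_contains_derivative:
  fixes T :: "'a::euclidean_space set"
  assumes T: "subspace T" "\<And>t. f t \<in> T" and f: "(f has_vector_derivative D) (at 0)"
  shows "D \<in> T"
proof -
  obtain y z where yz: "y \<in> span T" "\<And>w. w \<in> span T \<Longrightarrow> orthogonal z w" "D = y + z"
    using orthogonal_subspace_decomp_exists [of T D] by metis
  have "((\<lambda>t. f t \<bullet> z) has_vector_derivative D \<bullet> z) (at 0)"
    using bounded_linear.has_vector_derivative [OF bounded_linear_inner_left f] .
  moreover have "f t \<bullet> z = 0" for t
    using yz(2) [OF span_base [OF T(2) [of t]]] by (simp add: orthogonal_def inner_commute)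
  ultimately have "((\<lambda>t::real. 0) has_vector_derivative D \<bullet> z) (at 0)" by simp
  then have "D \<bullet> z = 0" using vector_derivative_unique_at has_vector_derivative_const by blast
  moreover have "y \<bullet> z = 0" using yz(1,2) by (simp add: orthogonal_def inner_commute)
  ultimately have "z = 0" using yz(3) by (simp add: inner_add_left)
  then show ?thesis using yz(1,3) T(1) by (simp add: span_eq_iff [THEN iffD2])
qed

lemma lc_scale: "a *\<^sub>R lc r s t m = lc (a * r) (a * s) (a * t) m"
proof -
  have "\<forall>m. a *\<^sub>R lc r s t m = lc (a * r) (a * s) (a * t) m"
    unfolding forall_8 by (simp add: lc_simps vec_eq_iff forall_8 field_simps) (simp add: lc_def Let_def)
  then show ?thesis by blast
qed

lemma tendsto_lc:
  assumes "(f \<longlongrightarrow> r) F" "(g \<longlongrightarrow> s) F" "(h \<longlongrightarrow> t) F"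
  shows "((\<lambda>u. lc (f u) (g u) (h u) m) \<longlongrightarrow> lc r s t m) F"
proof (rule vec_tendstoI)
  fix i
  have "\<forall>m i. ((\<lambda>u. lc (f u) (g u) (h u) m $ i) \<longlongrightarrow> lc r s t m $ i) F"
    unfolding forall_8 lc_simps vector_8
    by (auto simp: lc_def Let_def intro!: tendsto_intros assms)
  then show "((\<lambda>u. lc (f u) (g u) (h u) m $ i) \<longlongrightarrow> lc r s t m $ i) F" by blast
qed

section \<open>Transport along left-invariant fields\<close>

text \<open>The frame dual to the \<open>\<eta>\<close> forms and the \<open>dx\<close> forms on the
  group, numbered as in the coframe; slot 1 belongs to \<open>u\<close> and is empty.\<close>

definition left_field :: "8 \<Rightarrow> real^7 \<Rightarrow> real^7" where
  "left_field m x = (vector [0, axis 5 1, axis 6 1, axis 7 1, vector [1, 0, 0, 0, 0, 0, 0],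
     vector [0, 1, 0, 0, - 2 * x $ 1, - 2 * x $ 4, 0], vector [0, 0, 1, 0, 0, - 2 * x $ 1, - 2 * x $ 2],
     vector [0, 0, 0, 1, - 2 * x $ 3, 0, - 2 * x $ 1]] :: real^7^8) $ m"

text \<open>No field moves a coordinate on which its own coefficients depend. Hence its integral
  curves are straight segments.\<close>

lemma left_field_along: "left_field m (x + s *\<^sub>R left_field m x) = left_field m x"
proof -
  have "\<forall>m. left_field m (x + s *\<^sub>R left_field m x) = left_field m x"
    unfolding forall_8 by (simp add: left_field_def vec_eq_iff forall_7)
  then show ?thesis by blast
qed

context heis
begin

text \<open>The factor relating a left-invariant field to its unit frame vector; the matrix
  \<open>A\<^sub>m(u)\<close> is \<open>kappa m u *\<^sub>R gen m (cc u m)\<close>.\<close>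

definition kappa :: "8 \<Rightarrow> real \<Rightarrow> real" where
  "kappa m u = (vector [0, rho / (u + a1), rho / (u + a2), rho / (a3 - u), mu u, mu u, mu u, mu u] :: real^8) $ m"

abbreviation "cc u m \<equiv> lc (sa u) (sb u) (sc u) m"

lemma coframe_left_field:
  assumes "m \<noteq> 1"
  shows "coframe (x, u) (t *\<^sub>R left_field m x, 0) = (kappa m u * t) *\<^sub>R axis m 1"
proof -
  have "\<forall>m. m \<noteq> 1 \<longrightarrow> coframe (x, u) (t *\<^sub>R left_field m x, 0) = (kappa m u * t) *\<^sub>R axis m 1"
    unfolding forall_8
    by (simp add: coframe_def left_field_def kappa_def eta1_def eta2_def eta3_def vec_eq_iff forall_8 axis_component)
  with assms show ?thesis by blast
qed

lemma kappa_nonzero: "u \<in> I \<Longrightarrow> m \<noteq> 1 \<Longrightarrow> kappa m u \<noteq> 0"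
proof -
  assume "u \<in> I"
  from nonzero [OF this] have "\<forall>m. m \<noteq> 1 \<longrightarrow> kappa m u \<noteq> 0"
    unfolding forall_8 by (simp add: kappa_def)
  then show "m \<noteq> 1 \<Longrightarrow> kappa m u \<noteq> 0" by blast
qed

lemma conn_axis: "conn p (r *\<^sub>R axis m 1) z = r *\<^sub>R (gen m (cc (snd p) m) *v z)"
proof -
  have "conn p (r *\<^sub>R axis m 1) z = (\<Sum>n\<in>UNIV. if n = m then r *\<^sub>R (gen n (cc (snd p) n) *v z) else 0)"
    unfolding conn_alt by (intro sum.cong) (auto simp: axis_component)
  then show ?thesis by simp
qed

text \<open>Along the segment both \<open>u\<close> and the coframe components of the velocity are
  constant, so the transport equation has constant coefficients and \<open>rot\<close> solves
  it.\<close>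

lemma move_along_left_field:
  assumes u: "u \<in> I" and m: "m \<noteq> 1"
  shows "transports (x, u) (x + t *\<^sub>R left_field m x, u) ((*v) (rot m (cc u m) (- kappa m u * t)))"
proof -
  let ?v = "(t *\<^sub>R left_field m x, 0 :: real)" and ?k = "kappa m u * t"
  let ?\<xi> = "\<lambda>y s. rot m (cc u m) (- ?k * s) *v y"
  have coframe: "coframe ((x, u) + s *\<^sub>R ?v) ?v = ?k *\<^sub>R axis m 1" for s
    using coframe_left_field [OF m, of "x + (s * t) *\<^sub>R left_field m x" u t]
    by (simp add: left_field_along)
  have "transports (x, u) ((x, u) + ?v) ((*v) (rot m (cc u m) (- ?k)))"
  proof (rule transports_line [where \<xi> = ?\<xi>])
    show "(x, u) + s *\<^sub>R ?v \<in> UNIV \<times> I" for s using u by simp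
    show "?\<xi> y 0 = y" for y using m by simp
    show "?\<xi> y 1 = rot m (cc u m) (- ?k) *v y" for y by simp
    show "(?\<xi> y has_vector_derivative - conn ((x, u) + s *\<^sub>R ?v) (coframe ((x, u) + s *\<^sub>R ?v) ?v) (?\<xi> y s)) (at s)" for y s
    proof -
      have "((\<lambda>s. - ?k * s) has_vector_derivative - ?k) (at s)"
        by (auto intro!: derivative_eq_intros simp flip: has_real_derivative_iff_has_vector_derivative)
      from vector_diff_chain_at [OF this rot_has_vector_derivative [OF adm_lc [OF m]]]
      show ?thesis unfolding coframe conn_axis by (simp add: o_def)
    qed
  qed
  then show ?thesis by simp
qed

lemma move_vertically:
  assumes "is_interval I" "u \<in> I" "u' \<in> I"
  shows "transports (x, u) (x, u') ((*v) (mat 1))"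
proof -
  let ?v = "(0 :: real^7, u' - u)"
  have "transports (x, u) ((x, u) + ?v) ((*v) (mat 1))"
  proof (rule transports_line [where \<xi> = "\<lambda>y s. y"])
    show "(x, u) + s *\<^sub>R ?v \<in> UNIV \<times> I" if "s \<in> {0..1}" for s
    proof -
      have "(1 - s) *\<^sub>R u + s *\<^sub>R u' \<in> I"
        using assms that is_interval_convex convexD_alt by fastforce
      then show ?thesis by (simp add: algebra_simps)
    qed
    fix y :: "real^8" and s :: real
    have "coframe ((x, u) + s *\<^sub>R ?v) ?v = (beta * P (u + s * (u' - u)) * (u' - u)) *\<^sub>R axis 1 1"
      by (simp add: coframe_def vec_eq_iff forall_8 axis_component eta1_def eta2_def eta3_def)
    moreover have "gen 1 (cc w 1) = 0" for w by (simp add: lc_def Let_def gen_def vec_eq_iff)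
    ultimately show "((\<lambda>s. y) has_vector_derivative - conn ((x, u) + s *\<^sub>R ?v) (coframe ((x, u) + s *\<^sub>R ?v) ?v) y) (at s)"
      by (simp only: conn_axis) simp
  qed auto
  then show ?thesis by simp
qed

text \<open>
  Holonomies over loops that can be traversed from every point of the level \<open>u\<close>: quantifying over the
  base point replaces the invariance under left translations.
\<close>

definition level_holonomy :: "real \<Rightarrow> (real^8^8) set" where
  "level_holonomy u = {A. \<forall>x. transports (x, u) (x, u) ((*v) A)}"

lemma transports_matrix_trans:
  assumes "transports p q ((*v) A)" "transports q r ((*v) B)"
  shows "transports p r ((*v) (B ** A))"
proof -
  have "(*v) B \<circ> (*v) A = (*v) (B ** A)" by (simp add: fun_eq_iff matrix_vector_mul_assoc)
  then show ?thesis using transports_trans [OF assms] by simp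
qed

lemma level_holonomy_preserves:
  assumes "A \<in> level_holonomy u" "u \<in> I"
  shows "preserves_cayley A"
proof -
  have "transports (0, u) (0, u) ((*v) A)" using assms(1) by (simp add: level_holonomy_def)
  from transports_preserves_cayley(2) [OF this] assms(2)
  show ?thesis by (simp add: preserves_cayley_def)
qed

end

section \<open>Loops based at one level\<close>

locale heis_interval = heis +
  fixes u0 :: real
  assumes interval: "is_interval I" and u0: "u0 \<in> I"
begin

sublocale matrix_monoid "level_holonomy u0"
proof
  show "mat 1 \<in> level_holonomy u0"
    using move_vertically [OF interval u0 u0] by (simp add: level_holonomy_def)
  show "A ** B \<in> level_holonomy u0" if "A \<in> level_holonomy u0" "B \<in> level_holonomy u0" for A B
    unfolding level_holonomy_def
  proof (intro CollectI allI)
    fix x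
    show "transports (x, u0) (x, u0) ((*v) (A ** B))"
      by (rule transports_matrix_trans [of _ "(x, u0)"]) (use that in \<open>simp_all add: level_holonomy_def\<close>)
  qed
qed

lemma rectangle_mem:
  assumes u: "u \<in> I" "u' \<in> I" and m: "m \<noteq> 1"
  shows "rot m (cc u' m) (kappa m u' * t) ** rot m (cc u m) (- kappa m u * t) \<in> level_holonomy u0"
  unfolding level_holonomy_def
proof (intro CollectI allI)
  fix x
  let ?x = "x + t *\<^sub>R left_field m x"
  have ret: "?x + (- t) *\<^sub>R left_field m ?x = x" by (simp add: left_field_along)
  have 1: "transports (x, u0) (?x, u) ((*v) (rot m (cc u m) (- kappa m u * t)))"
    using transports_matrix_trans [OF move_vertically [OF interval u0 u(1)] move_along_left_field [OF u(1) m]] by simp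
  have 2: "transports (?x, u) (x, u') ((*v) (rot m (cc u' m) (kappa m u' * t)))"
    using transports_matrix_trans [OF move_vertically [OF interval u, of ?x] move_along_left_field [OF u(2) m, of ?x "- t"]]
    unfolding ret by simp
  show "transports (x, u0) (x, u0) ((*v) (rot m (cc u' m) (kappa m u' * t) ** rot m (cc u m) (- kappa m u * t)))"
    using transports_matrix_trans [OF transports_matrix_trans [OF 1 2] move_vertically [OF interval u(2) u0]] by simp
qed

text \<open>The loop for \<open>A\<close> is run at the displaced point \<open>?x\<close>, reached
  along a left-invariant field at level \<open>u\<close>. This is where \<open>A\<close> must be a
  holonomy at every point of the level.\<close>

lemma conjugate_mem:
  assumes u: "u \<in> I" and m: "m \<noteq> 1" and A: "A \<in> level_holonomy u0"
  shows "rot m (cc u m) t ** A ** rot m (cc u m) (- t) \<in> level_holonomy u0"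
  unfolding level_holonomy_def
proof (intro CollectI allI)
  fix x
  define s where "s = t / kappa m u"
  have s: "kappa m u * s = t" using kappa_nonzero [OF u m] by (simp add: s_def)
  let ?x = "x + s *\<^sub>R left_field m x"
  have ret: "?x + (- s) *\<^sub>R left_field m ?x = x" by (simp add: left_field_along)
  have 1: "transports (x, u0) (?x, u0) ((*v) (rot m (cc u m) (- t)))"
    using transports_matrix_trans [OF transports_matrix_trans [OF move_vertically [OF interval u0 u]
        move_along_left_field [OF u m, of x s]] move_vertically [OF interval u u0]] by (simp add: s)
  have 2: "transports (?x, u0) (x, u0) ((*v) (rot m (cc u m) t))"
    using transports_matrix_trans [OF transports_matrix_trans [OF move_vertically [OF interval u0 u, of ?x]
        move_along_left_field [OF u m, of ?x "- s"]] move_vertically [OF interval u u0]]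
    unfolding ret by (simp add: s)
  have "transports (?x, u0) (?x, u0) ((*v) A)" using A by (simp add: level_holonomy_def)
  from transports_matrix_trans [OF transports_matrix_trans [OF 1 this] 2]
  show "transports (x, u0) (x, u0) ((*v) (rot m (cc u m) t ** A ** rot m (cc u m) (- t)))"
    by (simp add: matrix_mul_assoc)
qed

lemma difference_tangent:
  assumes u: "u \<in> I" "u' \<in> I" and m: "m \<noteq> 1"
  shows "kappa m u' *\<^sub>R gen m (cc u' m) - kappa m u *\<^sub>R gen m (cc u m) \<in> curve_tangents (level_holonomy u0)"
proof -
  let ?h = "\<lambda>t. rot m (cc u' m) (kappa m u' * t) ** rot m (cc u m) (- kappa m u * t)"
  have "(?h has_vector_derivative kappa m u' *\<^sub>R gen m (cc u' m) - kappa m u *\<^sub>R gen m (cc u m)) (at 0)"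
    using mm.has_vector_derivative [OF rot_matrix_derivative [OF adm_lc [OF m]] rot_matrix_derivative [OF adm_lc [OF m]],
        of "sa u'" "sb u'" "sc u'" "kappa m u'" "sa u" "sb u" "sc u" "- kappa m u"] m
    by simp
  moreover have "continuous_on UNIV ?h" by (intro mm.continuous_on continuous_on_rot)
  moreover have "?h 0 = mat 1" using m by simp
  ultimately show ?thesis
    unfolding curve_tangents_def using rectangle_mem [OF u m] by blast
qed

text \<open>The bracket is the velocity at 0 of the conjugates of \<open>X\<close> by the rotations,
  a curve inside the tangent space.\<close>

lemma bracket_tangent:
  assumes u: "u \<in> I" and m: "m \<noteq> 1" and X: "X \<in> curve_tangents (level_holonomy u0)"
  shows "gen m (cc u m) ** X - X ** gen m (cc u m) \<in> curve_tangents (level_holonomy u0)"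
proof (rule subspace_contains_derivative [OF subspace_curve_tangents])
  let ?r = "rot m (cc u m)"
  show "?r (1 * t) ** X ** ?r ((- 1) * t) \<in> curve_tangents (level_holonomy u0)" for t
  proof (rule curve_tangents_conj [OF X])
    show "?r (1 * t) ** A ** ?r (- 1 * t) \<in> level_holonomy u0" if "A \<in> level_holonomy u0" for A
      using conjugate_mem [OF u m that] by simp
    show "?r (1 * t) ** ?r (- 1 * t) = mat 1"
      using rot_add [OF adm_lc [OF m], of "sa u" "sb u" "sc u" t "- t"] m by simp
  qed
  have "((\<lambda>t. ?r (1 * t) ** X) has_vector_derivative gen m (cc u m) ** X) (at 0)"
    using bounded_linear.has_vector_derivative [OF mm.bounded_linear_left rot_matrix_derivative [OF adm_lc [OF m], of "sa u" "sb u" "sc u" 1]] by simp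
  from mm.has_vector_derivative [OF this rot_matrix_derivative [OF adm_lc [OF m], of "sa u" "sb u" "sc u" "- 1"]]
  show "((\<lambda>t. ?r (1 * t) ** X ** ?r ((- 1) * t)) has_vector_derivative
      gen m (cc u m) ** X - X ** gen m (cc u m)) (at 0)"
    using m by (simp add: mm.minus_right)
qed

end

section \<open>Limits at minus infinity\<close>

locale heis_far = heis_interval +
  fixes R :: real
  assumes I: "I = {..<- R}"
begin

lemma eventually_I: "\<forall>\<^sub>F u in at_bot. u \<in> I"
  unfolding I using eventually_gt_at_bot [of "- R"] by simp

text \<open>\<open>P u\<close> grows like the cube of \<open>\<bar>u\<bar>\<close>, so
  \<open>cc u m\<close> is of order -4, whereas \<open>kappa m u\<close> grows at most with exponent
  3/2.\<close>

lemma kappa_cc_vanishes: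
  assumes "m \<noteq> 1"
  shows "((\<lambda>u. kappa m u *\<^sub>R cc u m) \<longlongrightarrow> 0) at_bot"
proof -
  have b: "beta > 0" using C by (simp add: beta_def)
  have 1: "((\<lambda>u. rho / (u + a1) * sa u) \<longlongrightarrow> 0) at_bot" "((\<lambda>u. rho / (u + a1) * sb u) \<longlongrightarrow> 0) at_bot"
    "((\<lambda>u. rho / (u + a1) * sc u) \<longlongrightarrow> 0) at_bot"
    "((\<lambda>u. rho / (u + a2) * sa u) \<longlongrightarrow> 0) at_bot" "((\<lambda>u. rho / (u + a2) * sb u) \<longlongrightarrow> 0) at_bot"
    "((\<lambda>u. rho / (u + a2) * sc u) \<longlongrightarrow> 0) at_bot"
    "((\<lambda>u. rho / (a3 - u) * sa u) \<longlongrightarrow> 0) at_bot" "((\<lambda>u. rho / (a3 - u) * sb u) \<longlongrightarrow> 0) at_bot"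
    "((\<lambda>u. rho / (a3 - u) * sc u) \<longlongrightarrow> 0) at_bot"
    "((\<lambda>u. mu u * sa u) \<longlongrightarrow> 0) at_bot" "((\<lambda>u. mu u * sb u) \<longlongrightarrow> 0) at_bot" "((\<lambda>u. mu u * sc u) \<longlongrightarrow> 0) at_bot"
    unfolding sa_def sb_def sc_def mu_def P_def using b C by real_asymp+
  have lc0: "lc 0 0 0 m = 0" using lc_scale [of 0 0 0 0 m] by simp
  have "\<forall>m. m \<noteq> 1 \<longrightarrow> ((\<lambda>u. kappa m u *\<^sub>R cc u m) \<longlongrightarrow> lc 0 0 0 m) at_bot"
    unfolding forall_8 lc_scale by (auto simp: kappa_def intro!: tendsto_lc 1 [simplified])
  then have "((\<lambda>u. kappa m u *\<^sub>R cc u m) \<longlongrightarrow> lc 0 0 0 m) at_bot" using assms by blast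
  then show ?thesis by (simp only: lc0)
qed

text \<open>The rescaled coefficients are \<open>u / (u + a1)\<close>, \<open>u / (u + a2)\<close>
  and \<open>- u / (a3 - u)\<close>, each tending to 1; the minus sign in \<open>sc\<close> is what
  makes the third limit positive.\<close>

lemma rescaled_cc_limit: "((\<lambda>u. (beta * P u * u) *\<^sub>R cc u m) \<longlongrightarrow> lc 1 1 1 m) at_bot"
proof -
  have "beta > 0" using C by (simp add: beta_def)
  then show ?thesis
    unfolding lc_scale
    by (intro tendsto_lc; unfold sa_def sb_def sc_def P_def; real_asymp)
qed

lemma limit_in_subspace:
  assumes S: "subspace (S :: (real^8) set)" and mem: "\<And>u. u \<in> I \<Longrightarrow> cc u m \<in> S"
  shows "lc 1 1 1 m \<in> S"
proof (rule Lim_in_closed_set [OF closed_subspace [OF S] _ _ rescaled_cc_limit])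
  show "\<forall>\<^sub>F u in at_bot. (beta * P u * u) *\<^sub>R cc u m \<in> S"
    using eventually_I by eventually_elim (intro subspace_scale [OF S] mem)
qed simp

lemma gen_tangent:
  assumes u: "u \<in> I" and m: "m \<noteq> 1"
  shows "gen m (cc u m) \<in> curve_tangents (level_holonomy u0)"
proof -
  let ?T = "curve_tangents (level_holonomy u0)"
  have lin: "linear (gen m)" by (rule linearI) (simp_all add: gen_linear)
  then have S: "subspace {c. gen m c \<in> ?T}"
    using linear_subspace_vimage [OF lin subspace_curve_tangents] by (simp add: vimage_def)
  have lim: "((\<lambda>u'. kappa m u' *\<^sub>R cc u' m - kappa m u *\<^sub>R cc u m) \<longlongrightarrow> 0 - kappa m u *\<^sub>R cc u m) at_bot"
    by (intro tendsto_intros kappa_cc_vanishes m)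
  have "0 - kappa m u *\<^sub>R cc u m \<in> {c. gen m c \<in> ?T}"
  proof (rule Lim_in_closed_set [OF closed_subspace [OF S] _ _ lim])
    show "\<forall>\<^sub>F u' in at_bot. kappa m u' *\<^sub>R cc u' m - kappa m u *\<^sub>R cc u m \<in> {c. gen m c \<in> ?T}"
      using eventually_I
    proof eventually_elim
      case (elim u')
      then show ?case
        using difference_tangent [OF u elim m] by (simp add: linear_diff [OF lin] gen_linear)
    qed
  qed simp
  then have "(- (1 / kappa m u)) *\<^sub>R (0 - kappa m u *\<^sub>R cc u m) \<in> {c. gen m c \<in> ?T}"
    by (rule subspace_scale [OF S])
  then show ?thesis using kappa_nonzero [OF u m] by simp
qed

text \<open>For fixed \<open>X\<close>, membership of \<open>gen m c\<close> and of its bracket with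
  \<open>X\<close> are linear conditions on \<open>c\<close>. They hold for all
  \<open>cc u m\<close>, hence for the limit \<open>lc 1 1 1 m\<close>.\<close>

theorem level_holonomy_full:
  assumes A: "preserves_cayley A"
  shows "A \<in> level_holonomy u0"
proof (rule contains_stabiliser [OF _ _ _ A])
  let ?T = "curve_tangents (level_holonomy u0)"
  show "preserves_cayley B" if "B \<in> level_holonomy u0" for B
    using level_holonomy_preserves [OF that u0] .
  fix m :: 8 assume m: "m \<noteq> 1"
  have lin: "linear (gen m)" by (rule linearI) (simp_all add: gen_linear)
  have "subspace {c. gen m c \<in> ?T}"
    using linear_subspace_vimage [OF lin subspace_curve_tangents] by (simp add: vimage_def)
  from limit_in_subspace [OF this] gen_tangent [OF _ m]
  show "gen m (lc 1 1 1 m) \<in> ?T" by simp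
  fix X assume X: "X \<in> ?T"
  have "linear (\<lambda>c. gen m c ** X - X ** gen m c)"
    by (rule linearI)
      (simp_all add: gen_linear mm.add_left mm.add_right mm.scaleR_left mm.scaleR_right scaleR_diff_right)
  from linear_subspace_vimage [OF this subspace_curve_tangents]
  have "subspace {c. gen m c ** X - X ** gen m c \<in> ?T}" by (simp add: vimage_def)
  from limit_in_subspace [OF this] bracket_tangent [OF _ m X]
  show "gen m (lc 1 1 1 m) ** X - X ** gen m (lc 1 1 1 m) \<in> ?T" by simp
qed

end

theorem mainTheorem11:
  fixes C a1 a2 a3 :: real
  assumes "C > 0"
  shows "(\<forall>I::real set. open I \<and> is_interval I \<and> (\<forall>u\<in>I. (u + a1) * (u + a2) * (a3 - u) > 0) \<longrightarrow>
            riemannian_metric_on (UNIV \<times> I) (heis_metric C a1 a2 a3) \<and>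
            holonomy_contained_in (UNIV \<times> I) (heis_metric C a1 a2 a3) Spin7) \<and>
         (\<exists>J::real set. open J \<and> is_interval J \<and> J \<noteq> {} \<and>
            riemannian_metric_on (UNIV \<times> J) (heis_metric C a1 a2 a3) \<and>
            holonomy_equals (UNIV \<times> J) (heis_metric C a1 a2 a3) Spin7)"
proof (intro conjI allI impI)
  fix I :: "real set"
  assume I: "open I \<and> is_interval I \<and> (\<forall>u\<in>I. (u + a1) * (u + a2) * (a3 - u) > 0)"
  then interpret heis C a1 a2 a3 I
    by unfold_locales (use assms in auto)
  show "riemannian_metric_on (UNIV \<times> I) (heis_metric C a1 a2 a3)" by (rule riemannian)
  show "holonomy_contained_in (UNIV \<times> I) (heis_metric C a1 a2 a3) Spin7" by (rule holonomy_contained_in_Spin7)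
next
  \<comment> \<open>Below \<open>- R\<close> the three factors have signs -, -, + whatever the
    triple, so the metric is positive on a ray reaching minus infinity.\<close>
  define R where "R = \<bar>a1\<bar> + \<bar>a2\<bar> + \<bar>a3\<bar>"
  let ?J = "{..<- R}"
  interpret heis C a1 a2 a3 ?J
  proof
    fix u assume "u \<in> ?J"
    then have "u + a1 < 0" "u + a2 < 0" "a3 - u > 0" by (auto simp: R_def)
    then show "(u + a1) * (u + a2) * (a3 - u) > 0" by (simp add: mult_neg_neg)
  qed (use assms in auto)
  have interval: "is_interval ?J" by (simp add: is_interval_convex_1)
  have "holonomy_equals (UNIV \<times> ?J) (heis_metric C a1 a2 a3) Spin7"
  proof (rule holonomy_equals_Spin7)
    fix p :: "(real^7) \<times> real" and A assume p: "p \<in> UNIV \<times> ?J" and A: "preserves_cayley A"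
    interpret heis_far C a1 a2 a3 ?J "snd p" R
      by unfold_locales (use p interval in auto)
    have "A \<in> level_holonomy (snd p)" by (rule level_holonomy_full [OF A])
    then have "transports (fst p, snd p) (fst p, snd p) ((*v) A)" by (simp only: level_holonomy_def mem_Collect_eq)
    then show "transports p p ((*v) A)" by simp
  qed
  moreover have "?J \<noteq> {}" using lt_ex by blast
  ultimately show "\<exists>J::real set. open J \<and> is_interval J \<and> J \<noteq> {} \<and>
            riemannian_metric_on (UNIV \<times> J) (heis_metric C a1 a2 a3) \<and>
            holonomy_equals (UNIV \<times> J) (heis_metric C a1 a2 a3) Spin7"
    using riemannian interval open_lessThan by blast
qed

end
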